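(* Let $\Omega=(0,1)$ and let $a_i,b_i,c_i$ $(i=1,2)$, $\gamma,\delta$ be positive constants. Assume either $C<A<B$ or $B<A<C$, and assume further that $D(a_i,b_i,c_i,\gamma)>0$. Then for each $j\in\mathbb{N}$ there exists a pair of connected sets $\varGamma_j^+\subset\mathcal{S}_j^+$ and $\varGamma_j^-\subset\mathcal{S}_j^-$ with the following properties: (i) $\varGamma_j^+$ bifurcates from the positive constant solution branch $\{(d,u^*,\tau^* ):d>0\}$ at $d=d^{(j)}$, i.e. $(d^{(j)},u^*,\tau^* )$ belongs to the closure of $\varGamma_j^+$ in $\mathbb{R}\times X$; (ii) $\varGamma_j^+$ reaches a singular limit $(d,\tau)=(0,\tau_0)$ with some $\tau_0\ge0$, i.e. there is a sequence $(d_n,u_n,\tau_n)\in\varGamma_j^+$ with $(d_n,\tau_n)\to(0,\tau_0)$ as $n\to\infty$. Furthermore, if $C<A<B$ then $\tau_0>0$, whereas if $B<A<C$ then $\tau_0=0$; (iii) $\varGamma_j^-=\{(d,u(\,\cdot+1/j),\tau):(d,u,\tau)\in\varGamma_j^+\}$, where $u$ is regarded as extended periodically.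
   Context: $f(u,v):=u(a_1-b_1u-c_1v)$ and $g(u,v):=v(a_2-b_2u-c_2v)$. $X:=C^1([0,1])\times\mathbb{R}$ and $\mathbb{R}_+:=(0,\infty)$. The limiting system (for given $d>0$, with unknowns a positive function $u$ on $[0,1]$ and $\tau>0$): with $w:=\delta u-\gamma\tau/u\in C^2([0,1])$ and $v:=\tau/u$, $$d\,w''+f(u,v)-\gamma g(u,v)=0\ \text{ in }(0,1),\qquad w'(0)=w'(1)=0,\qquad \int_0^1 f(u,v)\,dx=0 .$$ For $j\in\mathbb{N}$, $\mathcal{S}_j^{+}$ (resp. $\mathcal{S}_j^-$) is the set of $(d,u,\tau)\in\mathbb{R}_+\times X$ satisfying the limiting system and $(-1)^{i-1}u'(x)>0$ (resp. $(-1)^{i-1}u'(x)<0$) for $x\in((i-1)/j,\,i/j)$, $i=1,2,\dots,j$. $A:=a_1/a_2$, $B:=b_1/b_2$, $C:=c_1/c_2$; $C<A<B$ is the weak competition case and $B<A<C$ the strong competition case. In these cases $$(u^*,v^* ):=\frac{1}{b_1c_2-b_2c_1}(a_1c_2-a_2c_1,\ b_1a_2-b_2a_1),\qquad \tau^*:=u^*v^*,$$ and $(u^*,\tau^* )$ is the unique constant solution of the limiting system with $u>0$, $\tau>0$. $$D(a_i,b_i,c_i,\gamma):=\gamma b_2(A-B)(B+C-2A)+c_2(C-A)\{A(B+C)-2BC\},$$ $$d^{(j)}:=\frac{(\gamma b_2+c_1)\tau^*-b_1(u^* )^2-\gamma c_2(v^* )^2}{(\delta u^*+\gamma v^* )(j\pi)^2}=\frac{a_2^2b_2c_2\,D(a_i,b_i,c_i,\gamma)}{(b_2c_1-b_1c_2)^2(\delta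 u^*+\gamma v^* )(j\pi)^2}.$$ Periodic extension in (iii): $u$ is extended from $[0,1]$ to $\mathbb{R}$ by even reflection at $0$ and $1$, i.e. as an even function of period $2$ (equivalently, for such solutions, an even function of period $2/j$), and then $u(\,\cdot+1/j)$ is restricted to $[0,1]$. *)

theory Defs
  imports "HOL-Analysis.Analysis"
begin

section \<open>The normed space of continuously differentiable functions on the unit interval\<close>

text \<open>The derivative is relative to the closed unit interval, so it is one-sided at 0 and 1.\<close>

definition deriv01 :: "(real \<Rightarrow> real) \<Rightarrow> real \<Rightarrow> real" where
  "deriv01 f x = vector_derivative f (at x within {0..1})"

definition C1_on01 :: "(real \<Rightarrow> real) \<Rightarrow> bool" where
  "C1_on01 f \<longleftrightarrow> f differentiable_on {0..1} \<and> continuous_on {0..1} (deriv01 f)"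

definition C2_on01 :: "(real \<Rightarrow> real) \<Rightarrow> bool" where
  "C2_on01 f \<longleftrightarrow> C1_on01 f \<and> C1_on01 (deriv01 f)"

lemma deriv01_eqI:
  assumes "(f has_real_derivative D) (at x within {0..1})" "x \<in> {0..1}"
  shows "deriv01 f x = D"
  using assms vector_derivative_within_cbox[of 0 1 x f D]
  by (simp add: deriv01_def has_real_derivative_iff_has_vector_derivative)

lemma differentiable_on01_DERIV:
  assumes "f differentiable_on {0..1}" "x \<in> {0..1}"
  shows "(f has_real_derivative deriv01 f x) (at x within {0..1})"
proof -
  obtain D where "(f has_real_derivative D) (at x within {0..1})"
    using assms unfolding differentiable_on_def real_differentiable_def by blast
  with deriv01_eqI[OF this] assms(2) show ?thesis by simp
qed

lemma C1_on01_DERIV: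
  assumes "C1_on01 f" "x \<in> {0..1}"
  shows "(f has_real_derivative deriv01 f x) (at x within {0..1})"
  using assms differentiable_on01_DERIV C1_on01_def by blast

lemma C1_on01I:
  assumes "\<And>x. x \<in> {0..1} \<Longrightarrow> (f has_real_derivative f' x) (at x within {0..1})"
    and "continuous_on {0..1} f'"
  shows "C1_on01 f" and "\<And>x. x \<in> {0..1} \<Longrightarrow> deriv01 f x = f' x"
proof -
  show eq: "\<And>x. x \<in> {0..1} \<Longrightarrow> deriv01 f x = f' x"
    using assms(1) deriv01_eqI by blast
  have "continuous_on {0..1} (deriv01 f)"
    using assms(2) eq by (subst continuous_on_cong[OF refl, where g = f']) auto
  moreover have "f differentiable_on {0..1}"
    using assms(1) unfolding differentiable_on_def real_differentiable_def by blast
  ultimately show "C1_on01 f" by (simp add: C1_on01_def)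
qed

lemma C1_on01_continuous:
  assumes "C1_on01 f" shows "continuous_on {0..1} f"
  using assms C1_on01_def differentiable_imp_continuous_on by blast

lemma C1_on01_add:
  assumes "C1_on01 f" "C1_on01 g"
  shows "C1_on01 (\<lambda>x. f x + g x)"
    and "\<And>x. x \<in> {0..1} \<Longrightarrow> deriv01 (\<lambda>x. f x + g x) x = deriv01 f x + deriv01 g x"
proof -
  have 1: "((\<lambda>x. f x + g x) has_real_derivative (deriv01 f x + deriv01 g x)) (at x within {0..1})"
    if "x \<in> {0..1}" for x
    using DERIV_add[OF C1_on01_DERIV[OF assms(1) that] C1_on01_DERIV[OF assms(2) that]] .
  have 2: "continuous_on {0..1} (\<lambda>x. deriv01 f x + deriv01 g x)"
    using assms by (intro continuous_intros) (auto simp: C1_on01_def)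
  show "C1_on01 (\<lambda>x. f x + g x)" by (rule C1_on01I(1)[OF 1 2])
  show "\<And>x. x \<in> {0..1} \<Longrightarrow> deriv01 (\<lambda>x. f x + g x) x = deriv01 f x + deriv01 g x"
    by (rule C1_on01I(2)[OF 1 2])
qed

lemma C1_on01_cmult:
  assumes "C1_on01 f"
  shows "C1_on01 (\<lambda>x. c * f x)"
    and "\<And>x. x \<in> {0..1} \<Longrightarrow> deriv01 (\<lambda>x. c * f x) x = c * deriv01 f x"
proof -
  have 1: "((\<lambda>x. c * f x) has_real_derivative (c * deriv01 f x)) (at x within {0..1})"
    if "x \<in> {0..1}" for x
    using DERIV_cmult[OF C1_on01_DERIV[OF assms(1) that]] .
  have 2: "continuous_on {0..1} (\<lambda>x. c * deriv01 f x)"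
    using assms by (intro continuous_intros) (auto simp: C1_on01_def)
  show "C1_on01 (\<lambda>x. c * f x)" by (rule C1_on01I(1)[OF 1 2])
  show "\<And>x. x \<in> {0..1} \<Longrightarrow> deriv01 (\<lambda>x. c * f x) x = c * deriv01 f x"
    by (rule C1_on01I(2)[OF 1 2])
qed

lemma deriv01_cong:
  assumes "\<And>x. x \<in> {0..1} \<Longrightarrow> f x = g x" "x \<in> {0..1}"
  shows "deriv01 f x = deriv01 g x"
proof -
  have "(f has_vector_derivative D) (at x within {0..1})
      \<longleftrightarrow> (g has_vector_derivative D) (at x within {0..1})" for D
    using assms by (intro has_vector_derivative_cong_ev) (auto simp: eventually_at_filter)
  then show ?thesis by (simp add: deriv01_def vector_derivative_def)
qed

lemma C1_on01_cong:
  assumes "\<And>x. x \<in> {0..1} \<Longrightarrow> f x = g x"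
  shows "C1_on01 f \<longleftrightarrow> C1_on01 g"
proof -
  have *: "C1_on01 q" if eq: "\<And>x. x \<in> {0..1} \<Longrightarrow> p x = q x" and p: "C1_on01 p" for p q
  proof (rule C1_on01I(1))
    show "continuous_on {0..1} (deriv01 p)" using p by (simp add: C1_on01_def)
    fix x :: real assume x: "x \<in> {0..1}"
    show "(q has_real_derivative deriv01 p x) (at x within {0..1})"
      by (rule has_field_derivative_transform_within[OF C1_on01_DERIV[OF p x] zero_less_one x])
      (rule eq)
  qed
  show ?thesis using *[of f g] *[of g f] assms by auto
qed

text \<open>A function on the unit interval is represented by its extension by 0 to the real line, so that
  equality of elements is equality on the unit interval.\<close>

typedef C1_01 = "{u :: real \<Rightarrow> real. C1_on01 u \<and> (\<forall>x. x \<notin> {0..1} \<longrightarrow> u x = 0)}"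
  morphisms apply_C1 Abs_C1_01
proof -
  have "C1_on01 (\<lambda>_. 0)" by (rule C1_on01I(1)[of _ "\<lambda>_. 0"]) auto
  then show ?thesis by (intro exI[of _ "\<lambda>_. 0"]) simp
qed

definition mk_C1 :: "(real \<Rightarrow> real) \<Rightarrow> C1_01" where
  "mk_C1 f = Abs_C1_01 (\<lambda>x. if x \<in> {0..1} then f x else 0)"

definition dC1 :: "C1_01 \<Rightarrow> real \<Rightarrow> real" where
  "dC1 u = deriv01 (apply_C1 u)"

lemma apply_mk_C1:
  assumes "C1_on01 f"
  shows "apply_C1 (mk_C1 f) = (\<lambda>x. if x \<in> {0..1} then f x else 0)"
proof -
  have "C1_on01 (\<lambda>x. if x \<in> {0..1} then f x else 0)"
    using assms by (subst C1_on01_cong[where g = f]) auto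
  then show ?thesis unfolding mk_C1_def by (subst Abs_C1_01_inverse) auto
qed

lemma dC1_mk_C1:
  assumes "C1_on01 f" "x \<in> {0..1}"
  shows "dC1 (mk_C1 f) x = deriv01 f x"
  unfolding dC1_def apply_mk_C1[OF assms(1)] using assms(2) by (intro deriv01_cong) auto

lemma C1_on01_apply_C1: "C1_on01 (apply_C1 u)"
  using apply_C1 by auto

lemma apply_C1_outside: "x \<notin> {0..1} \<Longrightarrow> apply_C1 u x = 0"
  using apply_C1[of u] by blast

lemma C1_01_eqI:
  assumes "\<And>x. x \<in> {0..1} \<Longrightarrow> apply_C1 u x = apply_C1 v x"
  shows "u = v"
proof -
  have "apply_C1 u = apply_C1 v"
    using assms apply_C1_outside by (metis ext)
  then show ?thesis by (simp add: apply_C1_inject)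
qed

lemma continuous_on_apply_C1: "continuous_on {0..1} (apply_C1 u)"
  by (rule C1_on01_continuous[OF C1_on01_apply_C1])

lemma continuous_on_dC1: "continuous_on {0..1} (dC1 u)"
  using C1_on01_apply_C1[of u] by (simp add: C1_on01_def dC1_def)

lemma C1_on01_const: "C1_on01 (\<lambda>_. c)"
  by (rule C1_on01I(1)[of _ "\<lambda>_. 0"]) auto

lemma deriv01_const: "x \<in> {0..1} \<Longrightarrow> deriv01 (\<lambda>_. c) x = 0"
  by (rule deriv01_eqI) auto

definition sup_norm01 :: "(real \<Rightarrow> real) \<Rightarrow> real" where
  "sup_norm01 f = (SUP x\<in>{0..1}. \<bar>f x\<bar>)"

lemma sup_norm01_bdd:
  fixes f :: "real \<Rightarrow> real"
  assumes "continuous_on {0..1} f"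
  shows "bdd_above ((\<lambda>x. \<bar>f x\<bar>) ` {0..1::real})"
proof -
  have "compact ((\<lambda>x. \<bar>f x\<bar>) ` {0..1::real})"
    using assms by (intro compact_continuous_image continuous_on_rabs) auto
  then show ?thesis by (intro bounded_imp_bdd_above compact_imp_bounded)
qed

lemma sup_norm01_upper:
  assumes "continuous_on {0..1} f" "x \<in> {0..1}"
  shows "\<bar>f x\<bar> \<le> sup_norm01 f"
  unfolding sup_norm01_def using assms sup_norm01_bdd by (intro cSUP_upper) auto

lemma sup_norm01_least:
  assumes "\<And>x. x \<in> {0..1} \<Longrightarrow> \<bar>f x\<bar> \<le> M"
  shows "sup_norm01 f \<le> M"
  unfolding sup_norm01_def using assms by (intro cSUP_least) auto

lemma sup_norm01_nonneg: "continuous_on {0..1} f \<Longrightarrow> 0 \<le> sup_norm01 f"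
  using sup_norm01_upper[of f 0] by force

lemma sup_norm01_cong:
  assumes "\<And>x. x \<in> {0..1} \<Longrightarrow> f x = g x"
  shows "sup_norm01 f = sup_norm01 g"
  unfolding sup_norm01_def using assms by (intro SUP_cong) auto

lemma sup_norm01_triangle:
  assumes "continuous_on {0..1} f" "continuous_on {0..1} g"
  shows "sup_norm01 (\<lambda>x. f x + g x) \<le> sup_norm01 f + sup_norm01 g"
proof (rule sup_norm01_least)
  fix x :: real assume x: "x \<in> {0..1}"
  show "\<bar>f x + g x\<bar> \<le> sup_norm01 f + sup_norm01 g"
    using sup_norm01_upper[OF assms(1) x] sup_norm01_upper[OF assms(2) x] by linarith
qed

lemma sup_norm01_cmult_le:
  assumes "continuous_on {0..1} f"
  shows "sup_norm01 (\<lambda>x. c * f x) \<le> \<bar>c\<bar> * sup_norm01 f"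
proof (rule sup_norm01_least)
  fix x :: real assume x: "x \<in> {0..1}"
  show "\<bar>c * f x\<bar> \<le> \<bar>c\<bar> * sup_norm01 f"
    using sup_norm01_upper[OF assms(1) x] by (simp add: abs_mult mult_left_mono)
qed

lemma sup_norm01_cmult:
  assumes "continuous_on {0..1} f"
  shows "sup_norm01 (\<lambda>x. c * f x) = \<bar>c\<bar> * sup_norm01 f"
proof (cases "c = 0")
  case True
  then show ?thesis by (simp add: sup_norm01_def)
next
  case False
  have "continuous_on {0..1} (\<lambda>x. c * f x)" using assms by (intro continuous_intros)
  from sup_norm01_cmult_le[OF this, of "1 / c"] False
  have "\<bar>c\<bar> * sup_norm01 f \<le> sup_norm01 (\<lambda>x. c * f x)"
    by (simp add: field_simps)
  with sup_norm01_cmult_le[OF assms, of c] show ?thesis by linarith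
qed

instantiation C1_01 :: real_normed_vector
begin

definition zero_C1_01 :: C1_01 where "0 = mk_C1 (\<lambda>_. 0)"

definition plus_C1_01 :: "C1_01 \<Rightarrow> C1_01 \<Rightarrow> C1_01" where
  "u + v = mk_C1 (\<lambda>x. apply_C1 u x + apply_C1 v x)"

definition scaleR_C1_01 :: "real \<Rightarrow> C1_01 \<Rightarrow> C1_01" where
  "c *\<^sub>R u = mk_C1 (\<lambda>x. c * apply_C1 u x)"

definition uminus_C1_01 :: "C1_01 \<Rightarrow> C1_01" where "- u = (-1) *\<^sub>R (u :: C1_01)"

definition minus_C1_01 :: "C1_01 \<Rightarrow> C1_01 \<Rightarrow> C1_01" where "u - v = u + - (v :: C1_01)"

definition norm_C1_01 :: "C1_01 \<Rightarrow> real" where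
  "norm u = sup_norm01 (apply_C1 u) + sup_norm01 (dC1 u)"

definition dist_C1_01 :: "C1_01 \<Rightarrow> C1_01 \<Rightarrow> real" where
  "dist u v = norm (u - v :: C1_01)"

definition sgn_C1_01 :: "C1_01 \<Rightarrow> C1_01" where
  "sgn u = inverse (norm u) *\<^sub>R (u :: C1_01)"

definition uniformity_C1_01 :: "(C1_01 \<times> C1_01) filter" where
  "uniformity = (INF e\<in>{0<..}. principal {(x :: C1_01, y). dist x y < e})"

definition open_C1_01 :: "C1_01 set \<Rightarrow> bool" where
  "open (S :: C1_01 set) = (\<forall>x\<in>S. \<forall>\<^sub>F (x', y) in uniformity. x' = x \<longrightarrow> y \<in> S)"

lemma apply_C1_zero: "apply_C1 0 x = 0"
  unfolding zero_C1_01_def by (subst apply_mk_C1[OF C1_on01_const]) auto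

lemma apply_C1_add: "apply_C1 (u + v) x = apply_C1 u x + apply_C1 v x"
  unfolding plus_C1_01_def
  by (subst apply_mk_C1) (auto intro: C1_on01_add C1_on01_apply_C1 simp: apply_C1_outside)

lemma apply_C1_scaleR: "apply_C1 (c *\<^sub>R u) x = c * apply_C1 u x"
  unfolding scaleR_C1_01_def
  by (subst apply_mk_C1) (auto intro: C1_on01_cmult C1_on01_apply_C1 simp: apply_C1_outside)

lemma apply_C1_uminus: "apply_C1 (- u) x = - apply_C1 u x"
  by (simp add: uminus_C1_01_def apply_C1_scaleR)

lemma apply_C1_diff: "apply_C1 (u - v) x = apply_C1 u x - apply_C1 v x"
  by (simp add: minus_C1_01_def apply_C1_add apply_C1_uminus)

lemma dC1_add: "x \<in> {0..1} \<Longrightarrow> dC1 (u + v) x = dC1 u x + dC1 v x"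
  unfolding plus_C1_01_def
  by (subst dC1_mk_C1) (auto simp: dC1_def C1_on01_add C1_on01_apply_C1)

lemma dC1_scaleR: "x \<in> {0..1} \<Longrightarrow> dC1 (c *\<^sub>R u) x = c * dC1 u x"
  unfolding scaleR_C1_01_def
  by (subst dC1_mk_C1) (auto simp: dC1_def C1_on01_cmult C1_on01_apply_C1)

lemma dC1_zero: "x \<in> {0..1} \<Longrightarrow> dC1 0 x = 0"
  unfolding zero_C1_01_def
  by (subst dC1_mk_C1) (auto simp: C1_on01_const deriv01_const)

instance
proof
  fix x y z :: C1_01 and a b :: real
  show "x + y + z = x + (y + z)" "x + y = y + x" "0 + x = x" "- x + x = 0" "x - y = x + - y"
    by (auto intro!: C1_01_eqI simp: apply_C1_add apply_C1_zero apply_C1_uminus apply_C1_diff)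
  show "a *\<^sub>R (x + y) = a *\<^sub>R x + a *\<^sub>R y" "(a + b) *\<^sub>R x = a *\<^sub>R x + b *\<^sub>R x"
    "a *\<^sub>R b *\<^sub>R x = (a * b) *\<^sub>R x" "1 *\<^sub>R x = x"
    by (auto intro!: C1_01_eqI simp: apply_C1_add apply_C1_scaleR algebra_simps)
  show "dist x y = norm (x - y)" by (rule dist_C1_01_def)
  show "sgn x = inverse (norm x) *\<^sub>R x" by (rule sgn_C1_01_def)
  show "(uniformity :: (C1_01 \<times> C1_01) filter) = (INF e\<in>{0<..}. principal {(x, y). dist x y < e})"
    by (rule uniformity_C1_01_def)
  show "open U = (\<forall>x\<in>U. \<forall>\<^sub>F (x', y) in uniformity. x' = x \<longrightarrow> y \<in> U)" for U :: "C1_01 set"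
    by (rule open_C1_01_def)
  show "norm x = 0 \<longleftrightarrow> x = 0"
  proof
    assume "norm x = 0"
    then have "sup_norm01 (apply_C1 x) \<le> 0"
      using sup_norm01_nonneg[OF continuous_on_dC1[of x]] by (simp add: norm_C1_01_def)
    then show "x = 0"
      using sup_norm01_upper[OF continuous_on_apply_C1[of x]]
      by (intro C1_01_eqI) (force simp: apply_C1_zero)
  next
    assume "x = 0"
    have "sup_norm01 (apply_C1 0) = 0" "sup_norm01 (dC1 0) = 0"
      by (auto simp: sup_norm01_def apply_C1_zero dC1_zero)
    with \<open>x = 0\<close> show "norm x = 0" by (simp add: norm_C1_01_def)
  qed
  show "norm (x + y) \<le> norm x + norm y"
  proof -
    have "sup_norm01 (apply_C1 (x + y)) \<le> sup_norm01 (apply_C1 x) + sup_norm01 (apply_C1 y)"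
      using sup_norm01_triangle[OF continuous_on_apply_C1[of x] continuous_on_apply_C1[of y]]
      by (simp add: apply_C1_add[abs_def])
    moreover have "sup_norm01 (dC1 (x + y)) \<le> sup_norm01 (dC1 x) + sup_norm01 (dC1 y)"
      using sup_norm01_triangle[OF continuous_on_dC1[of x] continuous_on_dC1[of y]]
        sup_norm01_cong[of "dC1 (x + y)", OF dC1_add] by simp
    ultimately show ?thesis by (simp add: norm_C1_01_def)
  qed
  show "norm (a *\<^sub>R x) = \<bar>a\<bar> * norm x"
  proof -
    have "sup_norm01 (apply_C1 (a *\<^sub>R x)) = \<bar>a\<bar> * sup_norm01 (apply_C1 x)"
      using sup_norm01_cmult[OF continuous_on_apply_C1[of x]]
      by (simp add: apply_C1_scaleR[abs_def])
    moreover have "sup_norm01 (dC1 (a *\<^sub>R x)) = \<bar>a\<bar> * sup_norm01 (dC1 x)"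
      using sup_norm01_cmult[OF continuous_on_dC1[of x]]
        sup_norm01_cong[of "dC1 (a *\<^sub>R x)", OF dC1_scaleR] by simp
    ultimately show ?thesis by (simp add: norm_C1_01_def algebra_simps)
  qed
qed

end

definition const_C1 :: "real \<Rightarrow> C1_01" where
  "const_C1 c = mk_C1 (\<lambda>_. c)"

lemma apply_const_C1: "x \<in> {0..1} \<Longrightarrow> apply_C1 (const_C1 c) x = c"
  by (simp add: const_C1_def apply_mk_C1[OF C1_on01_const])


section \<open>The limiting system\<close>

definition f_react :: "real \<Rightarrow> real \<Rightarrow> real \<Rightarrow> real \<Rightarrow> real \<Rightarrow> real" where
  "f_react a1 b1 c1 u v = u * (a1 - b1 * u - c1 * v)"

definition g_react :: "real \<Rightarrow> real \<Rightarrow> real \<Rightarrow> real \<Rightarrow> real \<Rightarrow> real" where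
  "g_react a2 b2 c2 u v = v * (a2 - b2 * u - c2 * v)"

definition limiting_system ::
  "real \<Rightarrow> real \<Rightarrow> real \<Rightarrow> real \<Rightarrow> real \<Rightarrow> real \<Rightarrow> real \<Rightarrow> real \<Rightarrow> real \<Rightarrow> (real \<Rightarrow> real) \<Rightarrow> real \<Rightarrow> bool"
where
  "limiting_system a1 a2 b1 b2 c1 c2 \<gamma> \<delta> d u \<tau> \<longleftrightarrow>
     (\<forall>x\<in>{0..1}. u x > 0) \<and> \<tau> > 0 \<and>
     (let v = (\<lambda>x. \<tau> / u x);
          w = (\<lambda>x. \<delta> * u x - \<gamma> * \<tau> / u x)
      in C2_on01 w \<and>
         (\<forall>x\<in>{0<..<1}. d * deriv01 (deriv01 w) x
             + f_react a1 b1 c1 (u x) (v x) - \<gamma> * g_react a2 b2 c2 (u x) (v x) = 0) \<and>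
         deriv01 w 0 = 0 \<and> deriv01 w 1 = 0 \<and>
         integral {0..1} (\<lambda>x. f_react a1 b1 c1 (u x) (v x)) = 0)"

definition S_plus ::
  "real \<Rightarrow> real \<Rightarrow> real \<Rightarrow> real \<Rightarrow> real \<Rightarrow> real \<Rightarrow> real \<Rightarrow> real \<Rightarrow> nat \<Rightarrow> (real \<times> C1_01 \<times> real) set"
where
  "S_plus a1 a2 b1 b2 c1 c2 \<gamma> \<delta> j =
     {(d, u, \<tau>). d > 0 \<and> limiting_system a1 a2 b1 b2 c1 c2 \<gamma> \<delta> d (apply_C1 u) \<tau> \<and>
        (\<forall>i\<in>{1..j}. \<forall>x\<in>{real (i - 1) / real j<..<real i / real j}. (-1) ^ (i - 1) * dC1 u x > 0)}"

definition S_minus ::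
  "real \<Rightarrow> real \<Rightarrow> real \<Rightarrow> real \<Rightarrow> real \<Rightarrow> real \<Rightarrow> real \<Rightarrow> real \<Rightarrow> nat \<Rightarrow> (real \<times> C1_01 \<times> real) set"
where
  "S_minus a1 a2 b1 b2 c1 c2 \<gamma> \<delta> j =
     {(d, u, \<tau>). d > 0 \<and> limiting_system a1 a2 b1 b2 c1 c2 \<gamma> \<delta> d (apply_C1 u) \<tau> \<and>
        (\<forall>i\<in>{1..j}. \<forall>x\<in>{real (i - 1) / real j<..<real i / real j}. (-1) ^ (i - 1) * dC1 u x < 0)}"

definition u_star :: "real \<Rightarrow> real \<Rightarrow> real \<Rightarrow> real \<Rightarrow> real \<Rightarrow> real \<Rightarrow> real" where
  "u_star a1 a2 b1 b2 c1 c2 = (a1 * c2 - a2 * c1) / (b1 * c2 - b2 * c1)"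

definition v_star :: "real \<Rightarrow> real \<Rightarrow> real \<Rightarrow> real \<Rightarrow> real \<Rightarrow> real \<Rightarrow> real" where
  "v_star a1 a2 b1 b2 c1 c2 = (b1 * a2 - b2 * a1) / (b1 * c2 - b2 * c1)"

definition tau_star :: "real \<Rightarrow> real \<Rightarrow> real \<Rightarrow> real \<Rightarrow> real \<Rightarrow> real \<Rightarrow> real" where
  "tau_star a1 a2 b1 b2 c1 c2 = u_star a1 a2 b1 b2 c1 c2 * v_star a1 a2 b1 b2 c1 c2"

definition D_discr :: "real \<Rightarrow> real \<Rightarrow> real \<Rightarrow> real \<Rightarrow> real \<Rightarrow> real \<Rightarrow> real \<Rightarrow> real" where
  "D_discr a1 a2 b1 b2 c1 c2 \<gamma> =
     (let A = a1 / a2; B = b1 / b2; C = c1 / c2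
      in \<gamma> * b2 * (A - B) * (B + C - 2 * A) + c2 * (C - A) * (A * (B + C) - 2 * B * C))"

definition d_bif ::
  "real \<Rightarrow> real \<Rightarrow> real \<Rightarrow> real \<Rightarrow> real \<Rightarrow> real \<Rightarrow> real \<Rightarrow> real \<Rightarrow> nat \<Rightarrow> real"
where
  "d_bif a1 a2 b1 b2 c1 c2 \<gamma> \<delta> j =
     (let us = u_star a1 a2 b1 b2 c1 c2; vs = v_star a1 a2 b1 b2 c1 c2;
          ts = tau_star a1 a2 b1 b2 c1 c2
      in ((\<gamma> * b2 + c1) * ts - b1 * us\<^sup>2 - \<gamma> * c2 * vs\<^sup>2)
           / ((\<delta> * us + \<gamma> * vs) * (real j * pi)\<^sup>2))"

lemma d_bif_eq:
  assumes pos: "a1 > 0" "a2 > 0" "b1 > 0" "b2 > 0" "c1 > 0" "c2 > 0"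
    and ndeg: "b2 * c1 \<noteq> b1 * c2"
  shows "d_bif a1 a2 b1 b2 c1 c2 \<gamma> \<delta> j =
     a2\<^sup>2 * b2 * c2 * D_discr a1 a2 b1 b2 c1 c2 \<gamma>
       / ((b2 * c1 - b1 * c2)\<^sup>2
           * (\<delta> * u_star a1 a2 b1 b2 c1 c2 + \<gamma> * v_star a1 a2 b1 b2 c1 c2) * (real j * pi)\<^sup>2)"
proof -
  let ?us = "u_star a1 a2 b1 b2 c1 c2" and ?vs = "v_star a1 a2 b1 b2 c1 c2"
  let ?N = "(\<gamma> * b2 + c1) * (?us * ?vs) - b1 * ?us\<^sup>2 - \<gamma> * c2 * ?vs\<^sup>2"
  define E where "E = b1 * c2 - b2 * c1"
  have E: "E \<noteq> 0" using ndeg by (simp add: E_def)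
  have "E\<^sup>2 * ?N = (\<gamma> * b2 + c1) * ((E * ?us) * (E * ?vs)) - b1 * (E * ?us)\<^sup>2 - \<gamma> * c2 * (E * ?vs)\<^sup>2"
    by (simp add: algebra_simps power2_eq_square)
  also have "E * ?us = a1 * c2 - a2 * c1" using E by (simp add: E_def u_star_def)
  also have "E * ?vs = b1 * a2 - b2 * a1" using E by (simp add: E_def v_star_def)
  also have "(\<gamma> * b2 + c1) * ((a1 * c2 - a2 * c1) * (b1 * a2 - b2 * a1))
      - b1 * (a1 * c2 - a2 * c1)\<^sup>2 - \<gamma> * c2 * (b1 * a2 - b2 * a1)\<^sup>2
      = a2\<^sup>2 * b2 * c2 * D_discr a1 a2 b1 b2 c1 c2 \<gamma>"
    using pos by (simp add: D_discr_def Let_def field_simps power2_eq_square)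
  finally have "?N = a2\<^sup>2 * b2 * c2 * D_discr a1 a2 b1 b2 c1 c2 \<gamma> / E\<^sup>2"
    using E by (simp add: field_simps)
  moreover have "(b2 * c1 - b1 * c2)\<^sup>2 = E\<^sup>2" by (simp add: E_def power2_commute)
  ultimately show ?thesis
    by (simp add: d_bif_def Let_def tau_star_def mult.assoc)
qed


section \<open>The half-period shift\<close>

text \<open>The even extension with period 2: the point x is folded back to the unit interval by
  taking its distance to the nearest even integer.\<close>

definition even_ext :: "(real \<Rightarrow> real) \<Rightarrow> real \<Rightarrow> real" where
  "even_ext u x = u \<bar>x - 2 * of_int (round (x / 2))\<bar>"

text \<open>If the derivative of u does not vanish at 1, the shifted function need not be continuously
  differentiable and the value is unspecified. For solutions of the limiting system it does vanish
  (limiting_system_Neumann), and then apply_shift_C1 gives the expected values.\<close>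

definition shift_C1 :: "nat \<Rightarrow> C1_01 \<Rightarrow> C1_01" where
  "shift_C1 j u = mk_C1 (\<lambda>x. even_ext (apply_C1 u) (x + 1 / real j))"

lemma even_ext_0_2:
  assumes "x \<in> {0..2}"
  shows "even_ext u x = (if x \<le> 1 then u x else u (2 - x))"
proof -
  consider "x < 1" | "x = 1" | "x > 1" by linarith
  then show ?thesis
  proof cases
    case 1
    then have "round (x / 2) = 0" using assms by (intro round_unique) auto
    then show ?thesis using 1 assms by (simp add: even_ext_def)
  next
    case 2
    have "round (1 / 2 :: real) = 1" by (intro round_unique) auto
    then show ?thesis using 2 by (simp add: even_ext_def)
  next
    case 3
    then have "round (x / 2) = 1" using assms by (intro round_unique) auto
    then show ?thesis using 3 assms by (simp add: even_ext_def abs_if)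
  qed
qed

lemma apply_shift_C1:
  assumes j: "j \<ge> 1" and N1: "dC1 u 1 = 0" and x: "x \<in> {0..1}"
  shows "apply_C1 (shift_C1 j u) x = even_ext (apply_C1 u) (x + 1 / real j)"
proof -
  define h where "h = 1 / real j"
  have h: "0 < h" "h \<le> 1" using j by (auto simp: h_def field_simps)
  let ?U = "apply_C1 u" and ?V = "dC1 u"
  define G where "G y = (if y \<in> {0..1} then ?U y else ?U (2 - y))" for y
  define G' where "G' y = (if y \<in> {0..1} then ?V y else - ?V (2 - y))" for y
  have der: "(?U has_real_derivative ?V y) (at y within {0..1})" if "y \<in> {0..1}" for y
    using C1_on01_DERIV[OF C1_on01_apply_C1 that] by (simp add: dC1_def)
  have der2: "((\<lambda>y. ?U (2 - y)) has_real_derivative - ?V (2 - y)) (at y within {1..2})"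
    if "y \<in> {1..2}" for y
  proof -
    have "(?U has_real_derivative ?V (2 - y)) (at (2 - y) within (\<lambda>y. 2 - y) ` {1..2})"
      using that by (intro DERIV_subset[OF der]) auto
    moreover have "((\<lambda>y. 2 - y) has_real_derivative - 1) (at y within {1..2})"
      by (auto intro!: derivative_eq_intros)
    ultimately show ?thesis using DERIV_image_chain[of ?U "?V (2 - y)" "\<lambda>y. 2 - y" y "{1..2}" "- 1"]
      by (simp add: o_def)
  qed
  have derG: "(G has_real_derivative G' y) (at y within {0..2})" if y: "y \<in> {0..2}" for y
  proof -
    have eq: "{0..2} = {0..1} \<union> {1..2::real}" by auto
    have "{0..1} \<union> ({0..1} \<inter> {1..2}) = {0..1::real}" "{1..2} \<union> ({0..1} \<inter> {1..2}) = {1..2::real}"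
      by auto
    then have "(G has_vector_derivative G' y) (at y within {0..2})"
      unfolding G_def G'_def
      using y der[of y] der2[of y] N1 eq
      by (intro has_vector_derivative_If_within_closures[where S = "{0..1}" and T = "{1..2}"])
        (auto simp: has_real_derivative_iff_has_vector_derivative
              dest!: order_antisym[of 1 y])
    then show ?thesis by (simp add: has_real_derivative_iff_has_vector_derivative)
  qed
  have contG': "continuous_on {0..2} G'"
  proof -
    have eq: "{0..2} = {0..1} \<union> {1..2::real}" by auto
    have "continuous_on {1..2} (\<lambda>y. - ?V (2 - y))"
      by (intro continuous_intros continuous_on_compose2[OF continuous_on_dC1]) auto
    then show ?thesis unfolding G'_def eq
      using continuous_on_dC1[of u] N1 
      by (intro continuous_on_cases) (auto intro!: antisym)
  qed
  have shift_der: "((\<lambda>x. G (x + h)) has_real_derivative G' (y + h)) (at y within {0..1})"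
    if "y \<in> {0..1}" for y
  proof -
    have "(G has_real_derivative G' (y + h)) (at (y + h) within (\<lambda>x. x + h) ` {0..1})"
      using that h by (intro DERIV_subset[OF derG]) auto
    moreover have "((\<lambda>x. x + h) has_real_derivative 1) (at y within {0..1})"
      by (auto intro!: derivative_eq_intros)
    ultimately show ?thesis using DERIV_image_chain[of G "G' (y + h)" "\<lambda>x. x + h" y "{0..1}" 1]
      by (simp add: o_def)
  qed
  have "continuous_on {0..1} (\<lambda>x. G' (x + h))"
    using h by (intro continuous_on_compose2[OF contG'] continuous_intros) auto
  then have "C1_on01 (\<lambda>x. G (x + h))"
    using C1_on01I(1)[OF shift_der] by blast
  moreover have "G (y + h) = even_ext ?U (y + h)" if "y \<in> {0..1}" for y
    using that h by (subst even_ext_0_2) (auto simp: G_def)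
  ultimately have "C1_on01 (\<lambda>x. even_ext ?U (x + h))"
    using C1_on01_cong[of "\<lambda>x. G (x + h)" "\<lambda>x. even_ext ?U (x + h)"] by simp
  then show ?thesis
    using x by (simp add: shift_C1_def h_def[symmetric] apply_mk_C1)
qed

lemma limiting_system_Neumann:
  assumes sys: "limiting_system a1 a2 b1 b2 c1 c2 \<gamma> \<delta> d (apply_C1 u) \<tau>"
    and "\<gamma> > 0" "\<delta> > 0" and x: "x \<in> {0, 1}"
  shows "dC1 u x = 0"
proof -
  let ?U = "apply_C1 u"
  have x01: "x \<in> {0..1}" using x by auto
  have U: "?U x > 0" and "\<tau> > 0"
    and w: "deriv01 (\<lambda>x. \<delta> * ?U x - \<gamma> * \<tau> / ?U x) x = 0"
    using sys x by (auto simp: limiting_system_def Let_def)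
  have "(?U has_real_derivative dC1 u x) (at x within {0..1})"
    using C1_on01_DERIV[OF C1_on01_apply_C1 x01] by (simp add: dC1_def)
  then have "((\<lambda>x. \<delta> * ?U x - \<gamma> * \<tau> / ?U x) has_real_derivative
      (\<delta> + \<gamma> * \<tau> / (?U x)\<^sup>2) * dC1 u x) (at x within {0..1})"
    using U by (auto intro!: derivative_eq_intros simp: field_simps power2_eq_square)
  from deriv01_eqI[OF this x01] w have "(\<delta> + \<gamma> * \<tau> / (?U x)\<^sup>2) * dC1 u x = 0" by simp
  moreover have "\<delta> + \<gamma> * \<tau> / (?U x)\<^sup>2 > 0"
    using assms(2,3) \<open>\<tau> > 0\<close> U by (intro add_pos_pos divide_pos_pos mult_pos_pos) auto
  ultimately show ?thesis by simp
qed

end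

theory Submission
  imports Defs
begin

text \<open>Put \<open>\<tau> = s\<^sup>2\<close>, \<open>u = s y\<close> and \<open>v = s / y\<close>. In the variable \<open>z = \<delta> y - \<gamma> / y\<close> the differential equation becomes
a conservative oscillator \<open>d z'' + h s y = 0\<close>, in which only the one parameter \<open>s\<close> is left, and the
integral condition says that \<open>fh s y\<close>, the scaled \<open>f\<close>, has mean zero along the orbit. Up to a positive
factor \<open>h s\<close> is a quartic polynomial. Where it has three positive zeros \<open>y1 s < y2 s < y3 s\<close>, the middle
one is a centre between two saddles, and the solutions with \<open>j\<close> monotone pieces are the closed orbits
around \<open>y2 s\<close>, run through for \<open>j\<close> half periods. An orbit is given by \<open>s\<close> and an amplitude \<open>A\<close>; its half
period \<open>T\<close>, measured for \<open>d = 2\<close>, has to be stretched to the length \<open>1 / j\<close>, which fixes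
\<open>d = 2 / (j T)\<^sup>2\<close>. So the whole problem is one scalar equation \<open>\<Phi> (s, A) = 0\<close> in a planar region, and
\<open>d\<close>, \<open>u\<close> and \<open>\<tau>\<close> are continuous functions \<open>\<Theta> j (s, A)\<close> of the parameters.

The amplitude is the coordinate \<open>G\<close> in which the potential is the parabola \<open>G\<^sup>2\<close>; an orbit is then
\<open>G = - A cos \<alpha>\<close>, and the half period is a regular integral over \<open>\<alpha>\<close>, also for \<open>A = 0\<close> and for \<open>A < 0\<close>.
At \<open>A = 0\<close> this gives the constant solution together with the value \<open>d\<^sup>(\<^sup>j\<^sup>)\<close> (\<open>\<Theta>_center\<close>), and changing the
sign of \<open>A\<close> is the shift by \<open>1 / j\<close> (\<open>shift_\<Theta>\<close>), which turns a continuum for increasing first pieces into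
one for decreasing first pieces.

The continuum comes from plane topology (\<open>zero_set_component_separates\<close>): if \<open>\<Phi>\<close> has opposite signs at
two points of an open rectangle, a single component of its zero set meets every connected set that
joins them. Hence it suffices to know the sign of \<open>\<Phi>\<close> along suitable paths. Two facts give these signs. By
an exact identity (\<open>qf_fh\<close>), \<open>fh s (y2 s)\<close> has the sign of \<open>\<kappa>0 (s - ss)\<close>, where \<open>ss\<close> belongs to the
constant solution and \<open>\<kappa>0 = a2 b1 - a1 b2\<close> is positive for weak and negative for strong competition; so
\<open>\<Phi>\<close> changes sign at \<open>s = ss\<close> for small \<open>A\<close>. At a positive end of the interval of bistability the centre
merges with a saddle, all orbits shrink to a point, and \<open>\<Phi>\<close> keeps that sign for every amplitude
(\<open>\<Phi>_sign_near_end\<close>). Paths along lines of constant relative amplitude \<open>t\<close> therefore force the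
component to reach these lines, for small \<open>t\<close> in the strong case and for all \<open>t\<close> in the weak case; for
\<open>t \<rightarrow> 0\<close> it tends to the constant solution.

Weak competition: the interval of bistability stays away from \<open>s = 0\<close> (\<open>weak_sa_pos\<close>). For \<open>t \<rightarrow> 1\<close> the orbits
approach a saddle connection, the half period tends to infinity (\<open>per_blowup\<close>) and \<open>d \<rightarrow> 0\<close>, while \<open>\<tau>\<close>
converges to a positive limit along a subsequence.

Strong competition: \<open>fh\<close> is negative at both saddles, so \<open>\<Phi>\<close> has the same sign near \<open>t = 1\<close> as at the right
end. A path that follows the two regions of constant sign down to a line \<open>s = \<sigma>\<close> can be crossed only on
that line; hence the component contains points with \<open>s \<rightarrow> 0\<close>, that is \<open>\<tau> \<rightarrow> 0\<close>. Along zeros of \<open>\<Phi>\<close> with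
\<open>s \<rightarrow> 0\<close> the half period tends to infinity too (\<open>per_blowup_small_s\<close>), which gives \<open>d \<rightarrow> 0\<close>.\<close>

section \<open>Planar zero sets and real intervals\<close>

text \<open>The rectangle is a copy of the plane, and in the plane a closed set that separates two points has a
component that already separates them. Working in the open rectangle lets the component run out to the
boundary without leaving the zero set, so no points have to be removed from it afterwards.\<close>

lemma zero_set_component_separates:
  fixes a b lo hi :: "real \<times> real" and \<Phi> :: "real \<times> real \<Rightarrow> real"
  assumes cont: "continuous_on (box lo hi) \<Phi>"
    and ab: "a \<in> box lo hi" "b \<in> box lo hi"
    and neg: "\<Phi> a < 0" and pos: "\<Phi> b > 0"
  obtains C where "connected C" "C \<subseteq> {w \<in> box lo hi. \<Phi> w = 0}"
    "\<And>S. connected S \<Longrightarrow> S \<subseteq> box lo hi \<Longrightarrow> a \<in> S \<Longrightarrow> b \<in> S \<Longrightarrow> S \<inter> C \<noteq> {}"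
proof -
  let ?U = "box lo hi"
  have "box lo hi homeomorphic (UNIV :: (real \<times> real) set)"
    using ab by (intro homeomorphic_box_UNIV) auto
  then obtain \<phi> \<psi> where hom: "homeomorphism ?U (UNIV :: (real \<times> real) set) \<phi> \<psi>"
    unfolding homeomorphic_def by blast
  have cpsi: "continuous_on UNIV \<psi>" and cphi: "continuous_on ?U \<phi>"
    and psiU: "\<And>z. \<psi> z \<in> ?U" and inv1: "\<And>w. w \<in> ?U \<Longrightarrow> \<psi> (\<phi> w) = w" and inv2: "\<And>z. \<phi> (\<psi> z) = z"
    using hom unfolding homeomorphism_def by auto
  define F where "F = (\<lambda>z. \<Phi> (\<psi> z))"
  have cF: "continuous_on UNIV F"
    unfolding F_def using psiU by (intro continuous_on_compose2[OF cont cpsi]) auto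
  define Z where "Z = {z. F z = 0}"
  have "closed Z"
    unfolding Z_def using cF by (intro closed_Collect_eq) auto
  have nconn: "\<not> connected_component (- Z) (\<phi> a) (\<phi> b)"
  proof
    assume "connected_component (- Z) (\<phi> a) (\<phi> b)"
    then obtain T where T: "connected T" "T \<subseteq> - Z" "\<phi> a \<in> T" "\<phi> b \<in> T"
      unfolding connected_component_def by blast
    have "connected (F ` T)"
      using T(1) cF by (intro connected_continuous_image) (auto intro: continuous_on_subset)
    moreover have "F (\<phi> a) < 0" "F (\<phi> b) > 0" using neg pos ab inv1 by (auto simp: F_def)
    ultimately have "0 \<in> F ` T"
      using T(3,4) by (meson connectedD_interval image_eqI less_imp_le)
    then show False using T(2) by (auto simp: Z_def)
  qed
  obtain C where C: "C \<in> components Z" "\<not> connected_component (- C) (\<phi> a) (\<phi> b)"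
    using separation_by_component_closed_pointwise[OF \<open>closed Z\<close> nconn] .
  show thesis
  proof
    show "connected (\<psi> ` C)"
      using C(1) cpsi by (intro connected_continuous_image)
        (auto intro: continuous_on_subset in_components_connected)
    show "\<psi> ` C \<subseteq> {w \<in> ?U. \<Phi> w = 0}"
      using in_components_subset[OF C(1)] psiU by (auto simp: Z_def F_def)
    fix S assume S: "connected S" "S \<subseteq> ?U" "a \<in> S" "b \<in> S"
    have "connected (\<phi> ` S)"
      using S cphi by (intro connected_continuous_image) (auto intro: continuous_on_subset)
    then have "\<not> \<phi> ` S \<subseteq> - C"
      using C(2) S(3,4) unfolding connected_component_def by blast
    then obtain w where "w \<in> S" "\<phi> w \<in> C" by blast
    moreover have "\<psi> (\<phi> w) = w" using \<open>w \<in> S\<close> S(2) by (intro inv1) auto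
    ultimately have "w \<in> S \<inter> \<psi> ` C" by (metis IntI imageI)
    then show "S \<inter> \<psi> ` C \<noteq> {}" by blast
  qed
qed

lemma box_real_Pair: "box (a, c) (b, d) = {a<..<b :: real} \<times> {c<..<d :: real}"
  by (auto simp: box_def Basis_prod_def inner_Pair)

lemma continuous_on_closure_image:
  fixes f :: "'a :: metric_space \<Rightarrow> 'b :: metric_space"
  assumes f: "continuous_on U f" and S: "S \<subseteq> U" and x: "x \<in> closure S" "x \<in> U"
  shows "f x \<in> closure (f ` S)"
proof -
  obtain g where g: "\<And>n. g n \<in> S" "g \<longlonglongrightarrow> x" using x(1) unfolding closure_sequential by blast
  have "(\<lambda>n. f (g n)) \<longlonglongrightarrow> f x"
    by (rule continuous_on_tendsto_compose[OF f g(2) x(2)]) (use S g(1) in \<open>auto intro!: always_eventually\<close>)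
  then show ?thesis using g(1) unfolding closure_sequential by (intro exI[of _ "\<lambda>n. f (g n)"]) auto
qed

text \<open>The connected component of \<open>x\<close> is an open interval, and by maximality its end points do not belong to \<open>T\<close>.\<close>

lemma open_interval_component:
  fixes x :: real
  assumes T: "open T" "x \<in> T" and bd: "\<And>t. t \<in> T \<Longrightarrow> a \<le> t" "\<And>t. t \<in> T \<Longrightarrow> t \<le> b"
  obtains l u where "a \<le> l" "l < x" "x < u" "u \<le> b" "{l<..<u} \<subseteq> T" "l \<notin> T" "u \<notin> T"
proof -
  define U where "U = connected_component_set T x"
  have U: "open U" "connected U" "U \<subseteq> T" "x \<in> U"
    using T by (auto simp: U_def open_connected_component connected_component_subset)
  have bdU: "bdd_below U" "bdd_above U" using U(3) bd by (meson bdd_belowI bdd_aboveI subsetD)+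
  define l where "l = Inf U"
  define u where "u = Sup U"
  have le: "l \<le> t" "t \<le> u" if "t \<in> U" for t
    using that bdU by (auto simp: l_def u_def intro: cInf_lower cSup_upper)
  have strict: "l < t" "t < u" if t: "t \<in> U" for t
  proof -
    obtain e where e: "0 < e" "ball t e \<subseteq> U" using U(1) t by (meson open_contains_ball)
    have "t - e / 2 \<in> ball t e" "t + e / 2 \<in> ball t e" using e by (auto simp: dist_real_def)
    then have "t - e / 2 \<in> U" "t + e / 2 \<in> U" using e by auto
    then show "l < t" "t < u" using le[of "t - e / 2"] le[of "t + e / 2"] e by auto
  qed
  have sub: "{l<..<u} \<subseteq> U"
  proof
    fix t assume t: "t \<in> {l<..<u}"
    obtain v where v: "v \<in> U" "v < t" using t cInf_lessD[of U t] U(4) by (auto simp: l_def)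
    obtain w where w: "w \<in> U" "t < w" using t less_cSupD[of U t] U(4) by (auto simp: u_def)
    show "t \<in> U" using connectedD_interval[OF U(2) v(1) w(1), of t] v w by auto
  qed
  have maxi: "S \<subseteq> U" if "connected S" "S \<subseteq> T" "x \<in> S" for S
    unfolding U_def using that by (intro connected_component_maximal)
  have "u \<notin> T"
  proof
    assume u: "u \<in> T"
    have "{x..u} \<subseteq> T" 
    proof
      fix t assume "t \<in> {x..u}"
      then have "t = u \<or> t \<in> {l<..<u}" using strict(1)[OF U(4)] by auto
      then show "t \<in> T" using u sub U(3) by blast
    qed
    then have "{x..u} \<subseteq> U" using strict[OF U(4)] by (intro maxi) auto
    then have "u \<in> U" using strict[OF U(4)] by auto
    then show False using strict(2) by blast
  qed
  moreover have "l \<notin> T"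
  proof
    assume l: "l \<in> T"
    have "{l..x} \<subseteq> T"
    proof
      fix t assume "t \<in> {l..x}"
      then have "t = l \<or> t \<in> {l<..<u}" using strict(2)[OF U(4)] by auto
      then show "t \<in> T" using l sub U(3) by blast
    qed
    then have "{l..x} \<subseteq> U" using strict[OF U(4)] by (intro maxi) auto
    then have "l \<in> U" using strict[OF U(4)] by auto
    then show False using strict(1) by blast
  qed
  moreover have "a \<le> l" "u \<le> b"
    using U(3,4) bd unfolding l_def u_def by (auto intro!: cInf_greatest cSup_least)
  ultimately show thesis using that[of l u] strict[OF U(4)] sub U(3) by blast
qed

lemma nonvanishing_same_sign:
  fixes g :: "real \<Rightarrow> real"
  assumes c: "continuous_on {l<..<u} g" and nz: "\<And>s. s \<in> {l<..<u} \<Longrightarrow> g s \<noteq> 0"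
    and x: "x \<in> {l<..<u}" "0 < g x" and s: "s \<in> {l<..<u}"
  shows "0 < g s"
proof (rule ccontr)
  assume "\<not> 0 < g s"
  then have "g s < 0" using nz[OF s] by simp
  have "connected (g ` {l<..<u})" by (intro connected_continuous_image c) auto
  then have "0 \<in> g ` {l<..<u}"
    using connectedD_interval[of "g ` {l<..<u}" "g s" "g x" 0] s x \<open>g s < 0\<close> by auto
  then show False using nz by force
qed

section \<open>Primitives vanishing at the origin\<close>

text \<open>The primitive of \<open>k\<close> that vanishes at \<open>0\<close>. Rescaling the integral to the unit interval makes one formula
serve both signs of \<open>x\<close>, and makes continuity in parameters an instance of continuity of
integrals over a fixed interval.\<close>

definition prim :: "(real \<Rightarrow> real) \<Rightarrow> real \<Rightarrow> real" where
  "prim k x = x * integral {0..1} (\<lambda>\<sigma>. k (\<sigma> * x))"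

lemma prim_0 [simp]: "prim k 0 = 0" by (simp add: prim_def)

text \<open>The fundamental theorem of calculus along the segment from \<open>a\<close> to \<open>b\<close>, in either order.\<close>

lemma has_integral_rescale:
  fixes k Q :: "real \<Rightarrow> real"
  assumes "\<And>y. y \<in> closed_segment a b \<Longrightarrow> (Q has_real_derivative k y) (at y within closed_segment a b)"
  shows "((\<lambda>\<sigma>. (b - a) * k (a + \<sigma> * (b - a))) has_integral (Q b - Q a)) {0..1}"
proof -
  have "((\<lambda>\<sigma>. (b - a) * k (a + \<sigma> * (b - a))) has_integral
      (Q (a + 1 * (b - a)) - Q (a + 0 * (b - a)))) {0..1}"
  proof (rule fundamental_theorem_of_calculus)
    fix \<sigma> :: real assume \<sigma>: "\<sigma> \<in> {0..1}"
    have img: "(\<lambda>\<sigma>. a + \<sigma> * (b - a)) ` {0..1} = closed_segment a b"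
      unfolding closed_segment_image_interval by (intro image_cong) (auto simp: algebra_simps)
    have "(Q has_real_derivative k (a + \<sigma> * (b - a)))
        (at (a + \<sigma> * (b - a)) within (\<lambda>\<sigma>. a + \<sigma> * (b - a)) ` {0..1})"
      unfolding img by (rule assms) (use \<sigma> img in blast)
    moreover have "((\<lambda>\<sigma>. a + \<sigma> * (b - a)) has_real_derivative (b - a)) (at \<sigma> within {0..1})"
      by (auto intro!: derivative_eq_intros)
    ultimately have "((Q \<circ> (\<lambda>\<sigma>. a + \<sigma> * (b - a))) has_real_derivative
        k (a + \<sigma> * (b - a)) * (b - a)) (at \<sigma> within {0..1})"
      by (rule DERIV_image_chain)
    then show "((\<lambda>\<sigma>. Q (a + \<sigma> * (b - a))) has_vector_derivative (b - a) * k (a + \<sigma> * (b - a)))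
        (at \<sigma> within {0..1})"
      by (simp add: has_real_derivative_iff_has_vector_derivative[symmetric] o_def mult.commute)
  qed simp
  then show ?thesis by simp
qed

lemma prim_unique:
  assumes "\<And>y. (Q has_real_derivative k y) (at y)"
  shows "prim k x = Q x - Q 0"
proof -
  have "((\<lambda>\<sigma>. (x - 0) * k (0 + \<sigma> * (x - 0))) has_integral (Q x - Q 0)) {0..1}"
    using assms by (intro has_integral_rescale) (auto intro: has_field_derivative_at_within)
  from integral_unique[OF this] show ?thesis by (simp add: prim_def)
qed

lemma DERIV_prim:
  assumes cont: "continuous_on UNIV k"
  shows "(prim k has_real_derivative k x) (at x)"
proof -
  have "\<exists>Q. \<forall>y. (Q has_real_derivative k y) (at y)"
  proof -
    define Q where "Q = (\<lambda>x. if 0 \<le> x then integral {0..x} k else - integral {x..0} k)"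
    have "(Q has_real_derivative k y) (at y)" for y
    proof -
      define a where "a = - \<bar>y\<bar> - 1"
      define b where "b = \<bar>y\<bar> + 1"
      have ab: "a < 0" "0 < b" "a < y" "y < b" by (auto simp: a_def b_def)
      have ck: "continuous_on {a..b} k" using cont continuous_on_subset by blast
      have "((\<lambda>u. integral {a..u} k) has_real_derivative k y) (at y within {a..b})"
        using integral_has_real_derivative[OF ck, of y] ab by auto
      then have 1: "((\<lambda>u. integral {a..u} k - integral {a..0} k) has_real_derivative k y) (at y)"
        using ab at_within_interior[of y "{a..b}"] by (auto intro!: derivative_eq_intros)
      have int: "k integrable_on {a..b}" by (rule integrable_continuous_interval[OF ck])
      have eq: "integral {a..u} k - integral {a..0} k = Q u" if "u \<in> {a<..<b}" for u
      proof (cases "0 \<le> u")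
        case True
        have "integral {a..0} k + integral {0..u} k = integral {a..u} k"
          using True ab that by (intro Henstock_Kurzweil_Integration.integral_combine)
            (auto intro: integrable_on_subinterval[OF int])
        then show ?thesis using True by (simp add: Q_def)
      next
        case False
        have "integral {a..u} k + integral {u..0} k = integral {a..0} k"
          using False ab that by (intro Henstock_Kurzweil_Integration.integral_combine)
            (auto intro: integrable_on_subinterval[OF int])
        then show ?thesis using False by (simp add: Q_def)
      qed
      show ?thesis
        by (rule has_field_derivative_transform_within_open[OF 1, of "{a<..<b}"]) (use eq ab in auto)
    qed
    then show ?thesis by blast
  qed
  then obtain Q where Q: "\<And>y. (Q has_real_derivative k y) (at y)" by blast
  have "prim k = (\<lambda>x. Q x - Q 0)" using prim_unique[OF Q] by auto
  then show ?thesis using Q by (auto intro!: derivative_eq_intros)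
qed

lemma continuous_on_prim:
  fixes K :: "'a :: metric_space \<Rightarrow> real \<Rightarrow> real"
  assumes "continuous_on (U \<times> UNIV) (\<lambda>(w, x). K w x)"
  shows "continuous_on (U \<times> UNIV) (\<lambda>(w, x). prim (K w) x)"
proof -
  have "continuous_on ((U \<times> UNIV) \<times> cbox 0 1) (\<lambda>(p, \<sigma>). K (fst p) (\<sigma> * snd p))"
  proof -
    have "continuous_on ((U \<times> UNIV) \<times> cbox 0 1)
        (\<lambda>z. (\<lambda>(w, x). K w x) (fst (fst z), snd z * snd (fst z)))"
      by (rule continuous_on_compose2[OF assms]) (auto intro!: continuous_intros)
    then show ?thesis by (simp add: case_prod_unfold)
  qed
  then have "continuous_on (U \<times> UNIV) (\<lambda>p. integral (cbox 0 1) (\<lambda>\<sigma>. K (fst p) (\<sigma> * snd p)))"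
    by (rule integral_continuous_on_param)
  then have "continuous_on (U \<times> UNIV) (\<lambda>p. snd p * integral {0..1} (\<lambda>\<sigma>. K (fst p) (\<sigma> * snd p)))"
    by (auto intro!: continuous_intros)
  then show ?thesis by (simp add: prim_def case_prod_unfold)
qed

lemma prim_shift:
  assumes "continuous_on UNIV k" "continuous_on UNIV l" "\<And>x. l x = k (c + x)"
  shows "prim k (c + x) = prim k c + prim l x"
proof -
  have "((\<lambda>x. prim k (c + x)) has_real_derivative l y) (at y)" for y
  proof -
    have "((\<lambda>x. c + x) has_real_derivative 1) (at y)" by (auto intro!: derivative_eq_intros)
    from DERIV_chain2[OF DERIV_prim[OF assms(1)] this] show ?thesis by (simp add: assms(3))
  qed
  from prim_unique[OF this, of x] show ?thesis by simp
qed

lemma prim_reflect: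
  assumes "continuous_on UNIV k" "continuous_on UNIV l" "\<And>x. l x = k (c - x)"
  shows "prim k (c - x) = prim k c - prim l x"
proof -
  have "((\<lambda>x. - prim k (c - x)) has_real_derivative l y) (at y)" for y
  proof -
    have "((\<lambda>x. c - x) has_real_derivative - 1) (at y)" by (auto intro!: derivative_eq_intros)
    from DERIV_minus[OF DERIV_chain2[OF DERIV_prim[OF assms(1)] this]]
    show ?thesis by (simp add: assms(3))
  qed
  from prim_unique[OF this, of x] show ?thesis by simp
qed

text \<open>For an even function of period \<open>2 pi\<close> the integrals over \<open>[0, pi]\<close> and \<open>[pi, 2 pi]\<close> agree. Applied to the
time density of an orbit this says that all monotone pieces take the same time.\<close>

lemma prim_even_periodic:
  assumes k: "continuous_on UNIV k" and even: "\<And>x. k (- x) = k x" and per: "\<And>x. k (2 * pi + x) = k x"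
  shows "prim k (2 * pi + x) = 2 * prim k pi + prim k x"
    and "prim k (real n * pi) = real n * prim k pi"
    and "prim k (- x) = - prim k x"
proof -
  have refl: "k (2 * pi - x) = k x" for x using per[of "- x"] even by simp
  have "prim k (2 * pi - pi) = prim k (2 * pi) - prim k pi"
    using k refl by (intro prim_reflect) auto
  then have two: "prim k (2 * pi) = 2 * prim k pi" by simp
  show shift: "prim k (2 * pi + x) = 2 * prim k pi + prim k x" for x
    using prim_shift[OF k k, of "2 * pi" x] per two by auto
  have "prim k (0 - x) = prim k 0 - prim k x"
    using k even by (intro prim_reflect) auto
  then show "prim k (- x) = - prim k x" by simp
  show "prim k (real n * pi) = real n * prim k pi"
  proof (induction n rule: less_induct)
    case (less n)
    consider "n = 0" | "n = 1" | m where "n = Suc (Suc m)" by (metis One_nat_def not0_implies_Suc)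
    then show ?case
    proof cases
      case 3
      have "real n * pi = 2 * pi + real m * pi" using 3 by (simp add: algebra_simps)
      then show ?thesis using shift[of "real m * pi"] less.IH[of m] 3 by (simp add: algebra_simps)
    qed auto
  qed
qed

lemma prim_diff_le:
  assumes "continuous_on UNIV f" "continuous_on UNIV g" "a \<le> b"
    and le: "\<And>x. a \<le> x \<Longrightarrow> x \<le> b \<Longrightarrow> f x \<le> g x"
  shows "prim f b - prim f a \<le> prim g b - prim g a"
proof -
  have "prim g a - prim f a \<le> prim g b - prim f b"
  proof (rule DERIV_nonneg_imp_nondecreasing[where f = "\<lambda>x. prim g x - prim f x", OF assms(3)])
    fix x assume "a \<le> x" "x \<le> b"
    then show "\<exists>d. ((\<lambda>x. prim g x - prim f x) has_real_derivative d) (at x) \<and> 0 \<le> d"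
      using le by (intro exI[of _ "g x - f x"] conjI DERIV_diff DERIV_prim assms) auto
  qed
  then show ?thesis by simp
qed

lemma prim_affine:
  assumes "continuous_on UNIV f"
  shows "prim (\<lambda>x. c * f x + d) x = c * prim f x + d * x"
proof -
  have "((\<lambda>x. c * prim f x + d * x) has_real_derivative c * f y + d) (at y)" for y
    using DERIV_add[OF DERIV_cmult[OF DERIV_prim[OF assms]] DERIV_cmult_Id] .
  from prim_unique[OF this, of x] show ?thesis by simp
qed

lemma prim_pos:
  assumes "continuous_on UNIV f" "\<And>x. 0 < f x"
  shows "0 < prim f pi"
proof -
  have "prim f 0 < prim f pi"
  proof (rule DERIV_pos_imp_increasing[where f = "prim f", OF pi_gt_zero])
    fix x show "\<exists>d. (prim f has_real_derivative d) (at x) \<and> 0 < d"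
      by (intro exI[of _ "f x"] conjI DERIV_prim assms)
  qed
  then show ?thesis by simp
qed

section \<open>Curves in the space of continuously differentiable functions\<close>

lemma continuous_on_slice:
  assumes "continuous_on W (\<lambda>(a, b). f a b)" "\<And>b. b \<in> X \<Longrightarrow> (a, b) \<in> W"
  shows "continuous_on X (f a)"
proof -
  have "continuous_on X (\<lambda>b. (a, b))" by (intro continuous_intros)
  then have "continuous_on X (\<lambda>b. (\<lambda>(a, b). f a b) (a, b))"
    using assms by (intro continuous_on_compose2[OF assms(1)]) auto
  then show ?thesis by simp
qed

text \<open>The norm of the function space is the sum of two maxima over a compact interval, so joint continuity of a
family and of its derivative is enough.\<close>

lemma continuous_on_mk_C1:
  fixes u :: "'a :: metric_space \<Rightarrow> real \<Rightarrow> real"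
  assumes der: "\<And>w x. w \<in> U \<Longrightarrow> x \<in> {0..1} \<Longrightarrow> (u w has_real_derivative u' w x) (at x)"
    and cu: "continuous_on (U \<times> {0..1}) (\<lambda>(w, x). u w x)"
    and cu': "continuous_on (U \<times> {0..1}) (\<lambda>(w, x). u' w x)"
  shows "continuous_on U (\<lambda>w. mk_C1 (u w))"
    and "w \<in> U \<Longrightarrow> x \<in> {0..1} \<Longrightarrow> apply_C1 (mk_C1 (u w)) x = u w x"
    and "w \<in> U \<Longrightarrow> x \<in> {0..1} \<Longrightarrow> dC1 (mk_C1 (u w)) x = u' w x"
proof -
  have der': "(u w has_real_derivative u' w x) (at x within {0..1})" if "w \<in> U" "x \<in> {0..1}" for w x
    using der[OF that] by (rule has_field_derivative_at_within)
  have C1: "C1_on01 (u w)" if "w \<in> U" for w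
    by (rule C1_on01I(1)[OF der'[OF that] continuous_on_slice[OF cu']]) (use that in auto)
  have ap: "apply_C1 (mk_C1 (u w)) x = u w x" if "w \<in> U" "x \<in> {0..1}" for w x
    using apply_mk_C1[OF C1[OF that(1)]] that by simp
  have dap: "dC1 (mk_C1 (u w)) x = u' w x" if "w \<in> U" "x \<in> {0..1}" for w x
    using dC1_mk_C1[OF C1[OF that(1)] that(2)] deriv01_eqI[OF der'[OF that] that(2)] by simp
  show "w \<in> U \<Longrightarrow> x \<in> {0..1} \<Longrightarrow> apply_C1 (mk_C1 (u w)) x = u w x" by (rule ap)
  show "w \<in> U \<Longrightarrow> x \<in> {0..1} \<Longrightarrow> dC1 (mk_C1 (u w)) x = u' w x" by (rule dap)
  show "continuous_on U (\<lambda>w. mk_C1 (u w))"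
    unfolding continuous_on_iff
  proof (intro ballI allI impI)
    fix w e assume w: "w \<in> U" and e: "(0 :: real) < e"
    have e4: "0 < e / 4" using e by simp
    obtain X1 where X1: "w \<in> X1" "open X1"
      "\<forall>v\<in>X1 \<inter> U. \<forall>t\<in>{0..1}. dist ((\<lambda>(w, x). u w x) (v, t)) ((\<lambda>(w, x). u w x) (w, t)) \<le> e / 4"
      by (rule continuous_on_prod_compactE[OF cu compact_Icc w e4])
    obtain X2 where X2: "w \<in> X2" "open X2"
      "\<forall>v\<in>X2 \<inter> U. \<forall>t\<in>{0..1}. dist ((\<lambda>(w, x). u' w x) (v, t)) ((\<lambda>(w, x). u' w x) (w, t)) \<le> e / 4"
      by (rule continuous_on_prod_compactE[OF cu' compact_Icc w e4])
    have "open (X1 \<inter> X2)" "w \<in> X1 \<inter> X2" using X1 X2 by auto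
    then obtain d where d: "d > 0" "ball w d \<subseteq> X1 \<inter> X2" by (meson open_contains_ball)
    have "dist (mk_C1 (u v)) (mk_C1 (u w)) < e" if v: "v \<in> U" "dist v w < d" for v
    proof -
      have v': "v \<in> X1 \<inter> U" "v \<in> X2 \<inter> U" using v d(2) by (auto simp: dist_commute subset_iff)
      have "sup_norm01 (apply_C1 (mk_C1 (u v) - mk_C1 (u w))) \<le> e / 4"
      proof (rule sup_norm01_least)
        fix x :: real assume x: "x \<in> {0..1}"
        then show "\<bar>apply_C1 (mk_C1 (u v) - mk_C1 (u w)) x\<bar> \<le> e / 4"
          using X1(3) v' v w by (auto simp: apply_C1_diff ap dist_real_def)
      qed
      moreover have "sup_norm01 (dC1 (mk_C1 (u v) - mk_C1 (u w))) \<le> e / 4"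
      proof (rule sup_norm01_least)
        fix x :: real assume x: "x \<in> {0..1}"
        have "dC1 (mk_C1 (u v) - mk_C1 (u w)) x = u' v x - u' w x"
          unfolding minus_C1_01_def uminus_C1_01_def
          by (simp only: dC1_add[OF x] dC1_scaleR[OF x] dap[OF v(1) x] dap[OF w x])
        then show "\<bar>dC1 (mk_C1 (u v) - mk_C1 (u w)) x\<bar> \<le> e / 4"
          using X2(3) v' v w x by (auto simp: dist_real_def)
      qed
      ultimately show ?thesis using e by (simp add: dist_norm norm_C1_01_def)
    qed
    then show "\<exists>d>0. \<forall>x'\<in>U. dist x' w < d \<longrightarrow> dist (mk_C1 (u x')) (mk_C1 (u w)) < e"
      using d(1) by blast
  qed
qed

lemma sin_sign_half_period:
  assumes "1 \<le> i" "real (i - 1) * pi < \<alpha>" "\<alpha> < real i * pi"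
  shows "0 < (-1) ^ (i - 1) * sin \<alpha>"
proof -
  define \<beta> where "\<beta> = \<alpha> - real (i - 1) * pi"
  have "real i = real (i - 1) + 1" using assms(1) by simp
  then have "0 < \<beta>" "\<beta> < pi" using assms by (auto simp: \<beta>_def algebra_simps)
  then have "0 < sin \<beta>" by (rule sin_gt_zero)
  moreover have "sin \<alpha> = (-1) ^ (i - 1) * sin \<beta>"
    using sin_add[of \<beta> "real (i - 1) * pi"] by (simp add: \<beta>_def)
  ultimately show ?thesis by (simp add: power_mult_distrib[symmetric])
qed

section \<open>Families of oscillators around a centre between two saddles\<close>

text \<open>A family of potentials \<open>H s\<close> with minimum at \<open>mid s\<close> and maxima at \<open>lo s\<close> and \<open>hi s\<close>. The derivative is
given in factored form, since the quotient by \<open>y - mid s\<close> has to be continuous in both arguments to treat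
all amplitudes, zero included, at once. The weight \<open>zp\<close> is the derivative of the coordinate in which
Newton's equation holds.\<close>

locale bistable_family =
  fixes I :: "real set" and lo mid hi :: "real \<Rightarrow> real" and n H :: "real \<Rightarrow> real \<Rightarrow> real"
    and zp :: "real \<Rightarrow> real"
  assumes I_open: "open I"
    and cont_lo: "continuous_on I lo" and cont_mid: "continuous_on I mid" and cont_hi: "continuous_on I hi"
    and ord: "\<And>s. s \<in> I \<Longrightarrow> 0 < lo s" "\<And>s. s \<in> I \<Longrightarrow> lo s < mid s" "\<And>s. s \<in> I \<Longrightarrow> mid s < hi s"
    and n_cont: "continuous_on (I \<times> {0<..}) (\<lambda>(s, y). n s y)"
    and n_pos: "\<And>s y. s \<in> I \<Longrightarrow> 0 < y \<Longrightarrow> 0 < n s y"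
    and H_deriv: "\<And>s y. s \<in> I \<Longrightarrow> 0 < y \<Longrightarrow>
      (H s has_real_derivative (y - mid s) * ((y - lo s) * (hi s - y) * n s y)) (at y)"
    and zp_cont: "continuous_on {0<..} zp" and zp_pos: "\<And>y. 0 < y \<Longrightarrow> 0 < zp y"
begin

definition m :: "real \<Rightarrow> real \<Rightarrow> real" where
  "m s y = (y - lo s) * (hi s - y) * n s y"

text \<open>The average with weight \<open>\<sigma>\<close> that satisfies \<open>(y - mid s)\<^sup>2 M s y = H s y - H s (mid s)\<close>; in this form it is
visibly continuous at \<open>y = mid s\<close>.\<close>

definition M :: "real \<Rightarrow> real \<Rightarrow> real" where
  "M s y = integral {0..1} (\<lambda>\<sigma>. \<sigma> * m s (mid s + \<sigma> * (y - mid s)))"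

text \<open>The coordinate in which the potential is \<open>G\<^sup>2\<close>, with the sign of \<open>y - mid s\<close>.\<close>

definition G :: "real \<Rightarrow> real \<Rightarrow> real" where
  "G s y = (y - mid s) * sqrt (M s y)"

text \<open>The derivative of \<open>G s\<close>, by \<open>2 G G' = H'\<close> after cancelling \<open>y - mid s\<close>.\<close>

definition dG :: "real \<Rightarrow> real \<Rightarrow> real" where
  "dG s y = m s y / (2 * sqrt (M s y))"

lemma m_cont: "continuous_on (I \<times> {0<..}) (\<lambda>(s, y). m s y)"
proof -
  have "continuous_on (I \<times> {0<..}) (\<lambda>p. lo (fst p))" "continuous_on (I \<times> {0<..}) (\<lambda>p. hi (fst p))"
    by (auto intro!: continuous_on_compose2[OF cont_lo] continuous_on_compose2[OF cont_hi] continuous_intros)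
  then show ?thesis using n_cont unfolding m_def case_prod_unfold
    by (intro continuous_intros) auto
qed

lemma m_pos: "s \<in> I \<Longrightarrow> lo s < y \<Longrightarrow> y < hi s \<Longrightarrow> 0 < m s y"
  using ord[of s] n_pos[of s y] by (simp add: m_def)

lemma between_pos:
  assumes "s \<in> I" "0 < y" "\<sigma> \<in> {0..1}"
  shows "0 < mid s + \<sigma> * (y - mid s)"
proof -
  have "mid s > 0" using ord[OF assms(1)] by linarith
  have "\<sigma> = 1 \<or> \<sigma> < 1" using assms(3) by auto
  then have "0 < (1 - \<sigma>) * mid s + \<sigma> * y"
  proof
    assume "\<sigma> < 1"
    then have "0 < (1 - \<sigma>) * mid s" "0 \<le> \<sigma> * y" using \<open>mid s > 0\<close> assms(2,3) by auto
    then show ?thesis by (rule add_pos_nonneg)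
  qed (use assms(2) in simp)
  then show ?thesis by (simp add: algebra_simps)
qed

lemma M_cont: "continuous_on (I \<times> {0<..}) (\<lambda>(s, y). M s y)"
proof -
  have c: "continuous_on ((I \<times> {0<..}) \<times> {0..1::real}) (\<lambda>z. mid (fst (fst z)))"
    by (auto intro!: continuous_on_compose2[OF cont_mid] continuous_intros)
  have "continuous_on ((I \<times> {0<..}) \<times> cbox 0 1)
    (\<lambda>z. (\<lambda>(s, y). m s y) (fst (fst z), mid (fst (fst z)) + snd z * (snd (fst z) - mid (fst (fst z)))))"
    using between_pos c by (intro continuous_on_compose2[OF m_cont] continuous_intros) auto
  then have "continuous_on ((I \<times> {0<..}) \<times> cbox 0 1)
     (\<lambda>(p, \<sigma>). \<sigma> * m (fst p) (mid (fst p) + \<sigma> * (snd p - mid (fst p))))"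
    unfolding case_prod_unfold by (intro continuous_intros) auto
  then have "continuous_on (I \<times> {0<..})
      (\<lambda>p. integral (cbox 0 1) (\<lambda>\<sigma>. \<sigma> * m (fst p) (mid (fst p) + \<sigma> * (snd p - mid (fst p)))))"
    by (rule integral_continuous_on_param)
  then show ?thesis by (simp add: M_def case_prod_unfold)
qed

lemma M_eq:
  assumes "s \<in> I" "0 < y"
  shows "(y - mid s)\<^sup>2 * M s y = H s y - H s (mid s)"
proof -
  have "((\<lambda>\<sigma>. (y - mid s) * ((mid s + \<sigma> * (y - mid s) - mid s) * m s (mid s + \<sigma> * (y - mid s))))
     has_integral (H s y - H s (mid s))) {0..1}"
  proof (rule has_integral_rescale)
    fix x assume "x \<in> closed_segment (mid s) y"
    then have "0 < x" using ord[OF assms(1)] assms(2) by (auto simp: closed_segment_eq_real_ivl split: if_splits)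
    then show "(H s has_real_derivative (x - mid s) * m s x) (at x within closed_segment (mid s) y)"
      using H_deriv[OF assms(1)] by (auto simp: m_def intro: has_field_derivative_at_within)
  qed
  then have "((\<lambda>\<sigma>. (y - mid s)\<^sup>2 * (\<sigma> * m s (mid s + \<sigma> * (y - mid s))))
     has_integral (H s y - H s (mid s))) {0..1}"
    by (simp add: power2_eq_square algebra_simps)
  from integral_unique[OF this] show ?thesis by (simp add: M_def)
qed

lemma H_cont_y:
  assumes "s \<in> I" "X \<subseteq> {0<..}"
  shows "continuous_on X (H s)"
proof (rule DERIV_continuous_on)
  fix x assume "x \<in> X"
  show "(H s has_real_derivative (x - mid s) * ((x - lo s) * (hi s - x) * n s x)) (at x within X)"
    by (rule has_field_derivative_at_within[OF H_deriv]) (use assms \<open>x \<in> X\<close> in auto)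
qed

lemma H_less_lo:
  assumes s: "s \<in> I" and y: "lo s \<le> x" "x < y" "y \<le> mid s"
  shows "H s y < H s x"
proof (rule DERIV_neg_imp_decreasing_open[OF y(2)])
  fix z assume z: "x < z" "z < y"
  then have "0 < m s z" using y ord[OF s] by (intro m_pos s) auto
  then have "(z - mid s) * m s z < 0" using z y by (intro mult_neg_pos) auto
  moreover have "(H s has_real_derivative (z - mid s) * m s z) (at z)"
    unfolding m_def using z y ord[OF s] by (intro H_deriv s) linarith
  ultimately show "\<exists>l. (H s has_real_derivative l) (at z) \<and> l < 0" by blast
next
  show "continuous_on {x..y} (H s)"
    using y ord[OF s] by (intro H_cont_y s) auto
qed

lemma H_less_hi:
  assumes s: "s \<in> I" and y: "mid s \<le> x" "x < y" "y \<le> hi s"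
  shows "H s x < H s y"
proof (rule DERIV_pos_imp_increasing_open[OF y(2)])
  fix z assume z: "x < z" "z < y"
  then have "0 < m s z" using y ord[OF s] by (intro m_pos s) auto
  then have "(z - mid s) * m s z > 0" using z y by (intro mult_pos_pos) auto
  moreover have "(H s has_real_derivative (z - mid s) * m s z) (at z)"
    unfolding m_def using z y ord[OF s] by (intro H_deriv s) linarith
  ultimately show "\<exists>l. (H s has_real_derivative l) (at z) \<and> l > 0" by blast
next
  show "continuous_on {x..y} (H s)"
    using y ord[OF s] by (intro H_cont_y s) auto
qed

lemma M_mid:
  assumes "s \<in> I" shows "M s (mid s) = m s (mid s) / 2"
proof -
  have "((\<lambda>\<sigma>::real. \<sigma>) has_integral (1\<^sup>2 / 2 - 0\<^sup>2 / 2)) {0..1}"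
    by (rule fundamental_theorem_of_calculus)
       (auto intro!: derivative_eq_intros simp: has_real_derivative_iff_has_vector_derivative[symmetric])
  from integral_unique[OF has_integral_mult_left[OF this, of "m s (mid s)"]]
  show ?thesis by (simp add: M_def)
qed

lemma M_pos:
  assumes s: "s \<in> I" and y: "lo s \<le> y" "y \<le> hi s"
  shows "0 < M s y"
proof (cases "y = mid s")
  case True
  then show ?thesis using M_mid[OF s] m_pos[OF s, of "mid s"] ord[OF s] by simp
next
  case False
  then have "H s y - H s (mid s) > 0"
    using H_less_lo[OF s, of y "mid s"] H_less_hi[OF s, of "mid s" y] y by force
  then have "(y - mid s)\<^sup>2 * M s y > 0" using M_eq[OF s, of y] ord[OF s] y by simp
  then show ?thesis using False by (simp add: zero_less_mult_iff)
qed

lemma G_cont: "continuous_on (I \<times> {0<..}) (\<lambda>(s, y). G s y)"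
proof -
  have "continuous_on (I \<times> {0<..}) (\<lambda>p. mid (fst p))"
    by (auto intro!: continuous_on_compose2[OF cont_mid] continuous_intros)
  then show ?thesis using M_cont unfolding G_def case_prod_unfold by (intro continuous_intros) auto
qed

lemma G_cont_y: "s \<in> I \<Longrightarrow> X \<subseteq> {0<..} \<Longrightarrow> continuous_on X (G s)"
  by (rule continuous_on_slice[OF G_cont]) auto

lemma G_sq:
  assumes "s \<in> I" "lo s \<le> y" "y \<le> hi s"
  shows "(G s y)\<^sup>2 = H s y - H s (mid s)"
  using M_eq[of s y] M_pos[OF assms] ord[OF assms(1)] assms by (simp add: G_def power_mult_distrib)

lemma dG_cont: "continuous_on {(s, y). s \<in> I \<and> lo s < y \<and> y < hi s} (\<lambda>(s, y). dG s y)"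
proof -
  let ?D = "{(s, y). s \<in> I \<and> lo s < y \<and> y < hi s}"
  have sub: "?D \<subseteq> I \<times> {0<..}" using ord(1) by force
  have "sqrt (M s y) \<noteq> 0" if "(s, y) \<in> ?D" for s y using M_pos[of s y] that by auto
  then show ?thesis
    using continuous_on_subset[OF m_cont sub] continuous_on_subset[OF M_cont sub]
    unfolding dG_def case_prod_unfold by (intro continuous_intros) auto
qed

lemma dG_pos: "s \<in> I \<Longrightarrow> lo s < y \<Longrightarrow> y < hi s \<Longrightarrow> 0 < dG s y"
  using m_pos[of s y] M_pos[of s y] by (simp add: dG_def)

text \<open>Away from the centre \<open>G\<close> is a square root of \<open>H s y - H s (mid s)\<close>. At the centre it is
\<open>y - mid s\<close> times a continuous function, whose value there is the derivative.\<close>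

lemma G_deriv:
  assumes s: "s \<in> I" and y: "lo s < y" "y < hi s"
  shows "(G s has_real_derivative dG s y) (at y)"
proof -
  note o = ord[OF s]
  have Mp: "M s y > 0" using M_pos[OF s] y by simp
  have y0: "0 < y" using o y by simp
  consider "y < mid s" | "y = mid s" | "y > mid s" by linarith
  then show ?thesis
  proof cases
    case 1
    have sq: "sqrt (H s x - H s (mid s)) = - G s x" if "lo s < x" "x < mid s" for x
      using G_sq[OF s, of x] that o M_pos[OF s, of x]
      by (auto simp: G_def mult_le_0_iff intro!: real_sqrt_unique)
    have Hp: "H s y - H s (mid s) > 0" using H_less_lo[OF s, of y "mid s"] 1 y by simp
    have "((\<lambda>x. - sqrt (H s x - H s (mid s))) has_real_derivative
        - ((y - mid s) * m s y * (inverse (sqrt (H s y - H s (mid s))) / 2))) (at y)"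
      using Hp H_deriv[OF s y0] by (auto intro!: derivative_eq_intros simp: m_def)
    also have "- ((y - mid s) * m s y * (inverse (sqrt (H s y - H s (mid s))) / 2)) = dG s y"
    proof -
      have R: "sqrt (H s y - H s (mid s)) = (mid s - y) * sqrt (M s y)"
        using sq[OF y(1) 1] by (simp add: G_def algebra_simps)
      show ?thesis unfolding R dG_def using 1 Mp by (simp add: field_simps)
    qed
    finally show ?thesis
      by (rule has_field_derivative_transform_within_open[where S = "{lo s<..<mid s}"])
        (use 1 y sq in auto)
  next
    case 2
    have "isCont (\<lambda>x. M s x) (mid s)"
    proof -
      have "continuous_on {0<..} (M s)"
        by (rule continuous_on_slice[OF M_cont]) (use s in auto)
      then show ?thesis using y0 2 by (simp add: continuous_on_eq_continuous_at)
    qed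
    then have "isCont (\<lambda>x. sqrt (M s x)) (mid s)" by (intro continuous_intros)
    moreover have "sqrt (M s (mid s)) = dG s (mid s)"
    proof -
      have "sqrt (M s (mid s)) * sqrt (M s (mid s)) = M s (mid s)" "sqrt (M s (mid s)) > 0"
        using Mp 2 by auto
      then show ?thesis using M_mid[OF s] unfolding dG_def
        by (simp add: nonzero_eq_divide_eq mult.left_commute[of _ 2])
    qed
    ultimately show ?thesis
      unfolding CARAT_DERIV by (intro exI[of _ "\<lambda>x. sqrt (M s x)"]) (auto simp: G_def 2)
  next
    case 3
    have sq: "sqrt (H s x - H s (mid s)) = G s x" if "mid s < x" "x < hi s" for x
      using G_sq[OF s, of x] that o M_pos[OF s, of x]
      by (auto simp: G_def intro!: real_sqrt_unique)
    have Hp: "H s y - H s (mid s) > 0" using H_less_hi[OF s, of "mid s" y] 3 y by simp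
    have "((\<lambda>x. sqrt (H s x - H s (mid s))) has_real_derivative
        ((y - mid s) * m s y * (inverse (sqrt (H s y - H s (mid s))) / 2))) (at y)"
      using Hp H_deriv[OF s y0] by (auto intro!: derivative_eq_intros simp: m_def)
    also have "((y - mid s) * m s y * (inverse (sqrt (H s y - H s (mid s))) / 2)) = dG s y"
    proof -
      have R: "sqrt (H s y - H s (mid s)) = (y - mid s) * sqrt (M s y)"
        using sq[OF 3 y(2)] by (simp add: G_def algebra_simps)
      show ?thesis unfolding R dG_def using 3 Mp by (simp add: field_simps)
    qed
    finally show ?thesis
      by (rule has_field_derivative_transform_within_open[where S = "{mid s<..<hi s}"])
        (use 3 y sq in auto)
  qed
qed

lemma G_less:
  assumes s: "s \<in> I" and y: "lo s \<le> x" "x < y" "y \<le> hi s"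
  shows "G s x < G s y"
proof (rule DERIV_pos_imp_increasing_open[OF y(2)])
  fix z assume "x < z" "z < y"
  then show "\<exists>l. (G s has_real_derivative l) (at z) \<and> l > 0"
    using G_deriv[OF s, of z] dG_pos[OF s, of z] y by auto
next
  show "continuous_on {x..y} (G s)" using y ord[OF s] s by (intro G_cont_y) auto
qed

lemma G_less_iff:
  assumes "s \<in> I" "lo s \<le> x" "x \<le> hi s" "lo s \<le> y" "y \<le> hi s"
  shows "G s x < G s y \<longleftrightarrow> x < y"
  using G_less[OF assms(1), of x y] G_less[OF assms(1), of y x] assms
  by (cases x y rule: linorder_cases) auto

lemma G_mid [simp]: "G s (mid s) = 0" by (simp add: G_def)

text \<open>The inverse of \<open>G s\<close> on the closed interval between the saddles.\<close>

definition Y :: "real \<Rightarrow> real \<Rightarrow> real" where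
  "Y s x = (THE y. lo s \<le> y \<and> y \<le> hi s \<and> G s y = x)"

lemma Y_unique:
  assumes "s \<in> I" "lo s \<le> y" "y \<le> hi s"
  shows "Y s (G s y) = y"
  unfolding Y_def
proof (rule the_equality)
  show "lo s \<le> y \<and> y \<le> hi s \<and> G s y = G s y" using assms by simp
  fix x assume "lo s \<le> x \<and> x \<le> hi s \<and> G s x = G s y"
  then show "x = y" using G_less_iff[OF assms(1), of x y] G_less_iff[OF assms(1), of y x] assms by force
qed

lemma Y_props:
  assumes s: "s \<in> I" and x: "G s (lo s) \<le> x" "x \<le> G s (hi s)"
  shows "lo s \<le> Y s x" "Y s x \<le> hi s" "G s (Y s x) = x"
proof -
  have "continuous_on {lo s..hi s} (G s)" using ord[OF s] s by (intro G_cont_y) auto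
  then obtain y where "lo s \<le> y" "y \<le> hi s" "G s y = x"
    using IVT'[of "G s" "lo s" x "hi s"] x ord[OF s] by auto
  then show "lo s \<le> Y s x" "Y s x \<le> hi s" "G s (Y s x) = x" using Y_unique[OF s] by auto
qed

lemma Y_props_strict:
  assumes s: "s \<in> I" and x: "G s (lo s) < x" "x < G s (hi s)"
  shows "lo s < Y s x" "Y s x < hi s"
  using Y_props[OF s, of x] x by (auto simp: order_less_le)

lemma Y_0: "s \<in> I \<Longrightarrow> Y s 0 = mid s"
  using Y_unique[of s "mid s"] ord[of s] by simp

text \<open>An inverse of a strictly increasing function depends continuously on parameters: a strict inequality
\<open>G s b < x\<close> is stable, and at the two end points the continuity of \<open>lo\<close> and \<open>hi\<close> takes over.\<close>

lemma Y_cont: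
  "continuous_on {(s, x). s \<in> I \<and> G s (lo s) \<le> x \<and> x \<le> G s (hi s)} (\<lambda>(s, x). Y s x)"
  (is "continuous_on ?V _")
  unfolding continuous_on_def
proof (rule ballI)
  fix p assume p: "p \<in> ?V"
  obtain s0 x0 where p_eq: "p = (s0, x0)" and s0: "s0 \<in> I" and x0: "G s0 (lo s0) \<le> x0" "x0 \<le> G s0 (hi s0)"
    using p by auto
  let ?F = "at p within ?V"
  have tf: "(fst \<longlongrightarrow> s0) ?F" "(snd \<longlongrightarrow> x0) ?F"
    using tendsto_fst[OF tendsto_ident_at[of p ?V]] tendsto_snd[OF tendsto_ident_at[of p ?V]] p_eq by auto
  have evV: "eventually (\<lambda>q. q \<in> ?V) ?F" by (auto simp: eventually_at_filter)
  then have evI: "eventually (\<lambda>q. fst q \<in> I) ?F" by (rule eventually_mono) auto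
  have tlo: "((\<lambda>q. lo (fst q)) \<longlongrightarrow> lo s0) ?F" and thi: "((\<lambda>q. hi (fst q)) \<longlongrightarrow> hi s0) ?F"
    using continuous_on_tendsto_compose[OF cont_lo tf(1) s0 evI]
      continuous_on_tendsto_compose[OF cont_hi tf(1) s0 evI] by auto
  have tG: "((\<lambda>q. G (fst q) y) \<longlongrightarrow> G s0 y) ?F" if "0 < y" for y
  proof -
    have "((\<lambda>q. (fst q, y)) \<longlongrightarrow> (s0, y)) ?F" using tf by (intro tendsto_intros)
    moreover have "eventually (\<lambda>q. (fst q, y) \<in> I \<times> {0<..}) ?F"
      using evI by eventually_elim (use that in auto)
    ultimately show ?thesis
      using continuous_on_tendsto_compose[OF G_cont, of "\<lambda>q. (fst q, y)" "(s0, y)" ?F] s0 that by auto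
  qed
  note P0 = Y_props[OF s0 x0]
  have pos0: "0 < Y s0 x0" using P0 ord[OF s0] by linarith
  show "((\<lambda>(s, x). Y s x) \<longlongrightarrow> (\<lambda>(s, x). Y s x) p) ?F"
  proof (rule order_tendstoI)
    fix a assume a: "a < (\<lambda>(s, x). Y s x) p"
    then have a: "a < Y s0 x0" by (simp add: p_eq)
    show "eventually (\<lambda>q. a < (\<lambda>(s, x). Y s x) q) ?F"
    proof (cases "a < lo s0")
      case True
      have "eventually (\<lambda>q. a < lo (fst q)) ?F" by (rule order_tendstoD(1)[OF tlo True])
      then show ?thesis using evV
        by eventually_elim (use Y_props(1) in \<open>force simp: case_prod_unfold\<close>)
    next
      case False
      obtain b where b: "a < b" "b < Y s0 x0" using a dense by blast
      have b': "lo s0 < b" "b < hi s0" "0 < b" using False b ord[OF s0] P0 by auto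
      have "G s0 b < x0" using G_less_iff[OF s0, of b "Y s0 x0"] b b' P0 by simp
      then have "eventually (\<lambda>q. 0 < snd q - G (fst q) b) ?F"
        using b' by (intro order_tendstoD(1)[OF tendsto_diff[OF tf(2) tG]]) auto
      moreover have "eventually (\<lambda>q. lo (fst q) < b) ?F" "eventually (\<lambda>q. b < hi (fst q)) ?F"
        by (rule order_tendstoD(2)[OF tlo b'(1)], rule order_tendstoD(1)[OF thi b'(2)])
      ultimately show ?thesis using evV
      proof eventually_elim
        case (elim q)
        obtain s x where q: "q = (s, x)" by fastforce
        have "s \<in> I" "G s (lo s) \<le> x" "x \<le> G s (hi s)" using elim(4) q by auto
        note P = Y_props[OF this]
        have "b < Y s x" using G_less_iff[OF \<open>s \<in> I\<close>, of b "Y s x"] P elim q by auto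
        then show ?case using b q by simp
      qed
    qed
  next
    fix a assume a: "(\<lambda>(s, x). Y s x) p < a"
    then have a: "Y s0 x0 < a" by (simp add: p_eq)
    show "eventually (\<lambda>q. (\<lambda>(s, x). Y s x) q < a) ?F"
    proof (cases "hi s0 < a")
      case True
      have "eventually (\<lambda>q. hi (fst q) < a) ?F" by (rule order_tendstoD(2)[OF thi True])
      then show ?thesis using evV
        by eventually_elim (use Y_props(2) in \<open>force simp: case_prod_unfold\<close>)
    next
      case False
      obtain b where b: "b < a" "Y s0 x0 < b" using a dense by blast
      have b': "lo s0 < b" "b < hi s0" "0 < b" using False b ord[OF s0] P0 by auto
      have "x0 < G s0 b" using G_less_iff[OF s0, of "Y s0 x0" b] b b' P0 by simp
      then have "eventually (\<lambda>q. 0 < G (fst q) b - snd q) ?F"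
        using b' by (intro order_tendstoD(1)[OF tendsto_diff[OF tG tf(2)]]) auto
      moreover have "eventually (\<lambda>q. lo (fst q) < b) ?F" "eventually (\<lambda>q. b < hi (fst q)) ?F"
        by (rule order_tendstoD(2)[OF tlo b'(1)], rule order_tendstoD(1)[OF thi b'(2)])
      ultimately show ?thesis using evV
      proof eventually_elim
        case (elim q)
        obtain s x where q: "q = (s, x)" by fastforce
        have "s \<in> I" "G s (lo s) \<le> x" "x \<le> G s (hi s)" using elim(4) q by auto
        note P = Y_props[OF this]
        have "Y s x < b" using G_less_iff[OF \<open>s \<in> I\<close>, of "Y s x" b] P elim q by auto
        then show ?case using b q by simp
      qed
    qed
  qed
qed

lemma Y_deriv:
  assumes s: "s \<in> I" and x: "G s (lo s) < x" "x < G s (hi s)"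
  shows "(Y s has_real_derivative 1 / dG s (Y s x)) (at x)"
proof -
  note S = Y_props_strict[OF s x]
  have "continuous_on {G s (lo s)<..<G s (hi s)} (Y s)"
    by (rule continuous_on_slice[OF Y_cont]) (use s in auto)
  then have "isCont (Y s) x" using x by (simp add: continuous_on_eq_continuous_at)
  then have "(Y s has_real_derivative inverse (dG s (Y s x))) (at x)"
    using x S dG_pos[OF s S] Y_props(3)[OF s]
    by (intro DERIV_inverse_function[where f = "G s" and g = "Y s" and a = "G s (lo s)" and b = "G s (hi s)"]
        G_deriv[OF s S]) auto
  then show ?thesis by (simp add: inverse_eq_divide)
qed

section \<open>Orbits, half periods and the phase\<close>

text \<open>The amplitude at which the orbit reaches the lower one of the two saddles.\<close>

definition amax :: "real \<Rightarrow> real" where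
  "amax s = min (- G s (lo s)) (G s (hi s))"

definition \<Omega> :: "(real \<times> real) set" where
  "\<Omega> = {(s, A). s \<in> I \<and> \<bar>A\<bar> < amax s}"

lemma amax_pos: "s \<in> I \<Longrightarrow> 0 < amax s"
  using G_less[of s "lo s" "mid s"] G_less[of s "mid s" "hi s"] ord[of s] by (auto simp: amax_def)

lemma amax_cont: "continuous_on I amax"
proof -
  have "continuous_on I (\<lambda>s. G s (lo s))" "continuous_on I (\<lambda>s. G s (hi s))"
    using continuous_on_compose2[OF G_cont, of I "\<lambda>s. (s, lo s)"] cont_lo
      continuous_on_compose2[OF G_cont, of I "\<lambda>s. (s, hi s)"] cont_hi ord
    by (force intro!: continuous_intros)+
  then show ?thesis unfolding amax_def[abs_def] by (intro continuous_intros)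
qed

text \<open>The orbit \<open>G = - A cos \<alpha>\<close> for \<open>w = (s, A)\<close>. It increases for \<open>0 < \<alpha> < pi\<close> if \<open>A > 0\<close>.\<close>

definition orb :: "real \<times> real \<Rightarrow> real \<Rightarrow> real" where
  "orb w \<alpha> = Y (fst w) (- snd w * cos \<alpha>)"

lemma abs_Acos: "\<bar>A * cos \<alpha>\<bar> \<le> \<bar>A :: real\<bar>"
  by (simp add: abs_mult mult_left_le)

lemma Acos_range:
  assumes "w \<in> \<Omega>"
  shows "G (fst w) (lo (fst w)) < - snd w * cos \<alpha>" "- snd w * cos \<alpha> < G (fst w) (hi (fst w))"
proof -
  have "\<bar>snd w * cos \<alpha>\<bar> < amax (fst w)"
    using abs_Acos[of "snd w" \<alpha>] assms by (auto simp: \<Omega>_def)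
  then show "G (fst w) (lo (fst w)) < - snd w * cos \<alpha>" "- snd w * cos \<alpha> < G (fst w) (hi (fst w))"
    unfolding amax_def by auto
qed

lemma \<Omega>_I: "w \<in> \<Omega> \<Longrightarrow> fst w \<in> I" by (auto simp: \<Omega>_def)

lemma orb_range:
  assumes "w \<in> \<Omega>"
  shows "lo (fst w) < orb w \<alpha>" "orb w \<alpha> < hi (fst w)" "0 < orb w \<alpha>"
    "G (fst w) (orb w \<alpha>) = - snd w * cos \<alpha>"
proof -
  have s: "fst w \<in> I" using assms by (rule \<Omega>_I)
  show "lo (fst w) < orb w \<alpha>" "orb w \<alpha> < hi (fst w)"
    using Y_props_strict[OF s Acos_range[OF assms, of \<alpha>]] by (auto simp: orb_def)
  then show "0 < orb w \<alpha>" using ord[OF s] by linarith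
  show "G (fst w) (orb w \<alpha>) = - snd w * cos \<alpha>"
    using Y_props(3)[OF s] Acos_range[OF assms, of \<alpha>] by (simp add: orb_def)
qed

lemma orb_cont: "continuous_on (\<Omega> \<times> UNIV) (\<lambda>(w, \<alpha>). orb w \<alpha>)"
proof -
  have "continuous_on (\<Omega> \<times> UNIV) (\<lambda>z. (\<lambda>(s, x). Y s x) (fst (fst z), - snd (fst z) * cos (snd z)))"
    using Acos_range \<Omega>_I
    by (intro continuous_on_compose2[OF Y_cont] continuous_intros) (auto intro: less_imp_le)
  then show ?thesis by (simp add: orb_def case_prod_unfold)
qed

lemma orb_deriv:
  assumes "w \<in> \<Omega>"
  shows "(orb w has_real_derivative snd w * sin \<alpha> / dG (fst w) (orb w \<alpha>)) (at \<alpha>)"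
proof -
  have s: "fst w \<in> I" using assms by (rule \<Omega>_I)
  have "((\<lambda>\<alpha>. - snd w * cos \<alpha>) has_real_derivative snd w * sin \<alpha>) (at \<alpha>)"
    by (auto intro!: derivative_eq_intros)
  from DERIV_chain2[OF Y_deriv[OF s Acos_range[OF assms]] this]
  show ?thesis by (simp add: orb_def[abs_def])
qed

lemma orb_symm:
  "orb w (- \<alpha>) = orb w \<alpha>" "orb w (2 * pi + \<alpha>) = orb w \<alpha>" "orb (s, A) (pi + \<alpha>) = orb (s, - A) \<alpha>"
  "orb (s, A) (pi - \<alpha>) = orb (s, - A) \<alpha>"
  by (simp_all add: orb_def cos_add cos_diff)

text \<open>The density of time with respect to \<open>\<alpha>\<close>. Energy conservation gives \<open>dt = dz / (A sin \<alpha>)\<close> up to a constant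
factor, and the factor \<open>A sin \<alpha>\<close> cancels against the derivative of \<open>- A cos \<alpha>\<close>.\<close>

definition kap :: "real \<times> real \<Rightarrow> real \<Rightarrow> real" where
  "kap w \<alpha> = zp (orb w \<alpha>) / dG (fst w) (orb w \<alpha>)"

lemma kap_pos: "w \<in> \<Omega> \<Longrightarrow> 0 < kap w \<alpha>"
  unfolding kap_def by (intro divide_pos_pos zp_pos dG_pos orb_range \<Omega>_I)

lemma kap_symm:
  "kap w (- \<alpha>) = kap w \<alpha>" "kap w (2 * pi + \<alpha>) = kap w \<alpha>" "kap (s, A) (pi + \<alpha>) = kap (s, - A) \<alpha>"
  "kap (s, A) (pi - \<alpha>) = kap (s, - A) \<alpha>"
  by (simp_all add: kap_def orb_symm)

lemma orb_comp_cont: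
  assumes "continuous_on {(s, y). s \<in> I \<and> lo s < y \<and> y < hi s} (\<lambda>(s, y). g s y)"
  shows "continuous_on (\<Omega> \<times> UNIV) (\<lambda>(w, \<alpha>). g (fst w) (orb w \<alpha>))"
proof -
  have "continuous_on (\<Omega> \<times> UNIV) (\<lambda>z. (\<lambda>(s, y). g s y) (fst (fst z), (\<lambda>(w, \<alpha>). orb w \<alpha>) z))"
    using orb_range \<Omega>_I
    by (intro continuous_on_compose2[OF assms] continuous_intros orb_cont) auto
  then show ?thesis by (simp add: case_prod_unfold)
qed

lemma kap_cont: "continuous_on (\<Omega> \<times> UNIV) (\<lambda>(w, \<alpha>). kap w \<alpha>)"
proof -
  let ?D = "{(s, y). s \<in> I \<and> lo s < y \<and> y < hi s}"
  have "continuous_on ?D (\<lambda>p. zp (snd p))"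
    using ord(1) by (intro continuous_on_compose2[OF zp_cont] continuous_intros) force
  then have "continuous_on ?D (\<lambda>(s, y). zp y / dG s y)"
    using dG_cont dG_pos unfolding case_prod_unfold by (intro continuous_intros) force+
  from orb_comp_cont[OF this] show ?thesis by (simp add: kap_def)
qed

lemma kap_cont1: "w \<in> \<Omega> \<Longrightarrow> continuous_on UNIV (kap w)"
  by (rule continuous_on_slice[OF kap_cont]) simp

definition per :: "real \<times> real \<Rightarrow> real" where
  "per w = prim (kap w) pi"

lemma prim_kap_less:
  assumes w: "w \<in> \<Omega>" and "\<alpha> < \<beta>"
  shows "prim (kap w) \<alpha> < prim (kap w) \<beta>"
proof (rule DERIV_pos_imp_increasing[OF assms(2)])
  fix x
  show "\<exists>l. (prim (kap w) has_real_derivative l) (at x) \<and> l > 0"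
    by (rule exI[of _ "kap w x"]) (simp add: DERIV_prim[OF kap_cont1[OF w]] kap_pos[OF w])
qed

lemma per_pos: "w \<in> \<Omega> \<Longrightarrow> 0 < per w"
  using prim_kap_less[of w 0 pi] pi_gt_zero by (simp add: per_def)

lemma per_cont: "continuous_on \<Omega> per"
proof -
  have "continuous_on \<Omega> (\<lambda>w. (\<lambda>(w, \<alpha>). prim (kap w) \<alpha>) (w, pi))"
    by (rule continuous_on_compose2[OF continuous_on_prim[OF kap_cont]]) (auto intro!: continuous_intros)
  then show ?thesis by (simp add: per_def[abs_def])
qed

lemma \<Omega>_uminus: "(s, A) \<in> \<Omega> \<Longrightarrow> (s, - A) \<in> \<Omega>" by (simp add: \<Omega>_def)

lemma per_uminus:
  assumes "(s, A) \<in> \<Omega>" shows "per (s, - A) = per (s, A)"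
proof -
  have "prim (kap (s, A)) (pi - pi) = prim (kap (s, A)) pi - prim (kap (s, - A)) pi"
    by (intro prim_reflect kap_cont1 \<Omega>_uminus assms kap_symm(4)[symmetric])
  then show ?thesis by (simp add: per_def)
qed

lemma prim_kap_pi_add:
  assumes "(s, A) \<in> \<Omega>" shows "prim (kap (s, A)) (pi + \<alpha>) = per (s, A) + prim (kap (s, - A)) \<alpha>"
  unfolding per_def by (intro prim_shift kap_cont1 \<Omega>_uminus assms kap_symm(3)[symmetric])

lemma \<Omega>_center: "s \<in> I \<Longrightarrow> (s, 0) \<in> \<Omega>" using amax_pos by (simp add: \<Omega>_def)

lemma orb_center: "s \<in> I \<Longrightarrow> orb (s, 0) \<alpha> = mid s" by (simp add: orb_def Y_0)

text \<open>The half period of the linearised oscillation.\<close>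

lemma per_center:
  assumes s: "s \<in> I"
  shows "per (s, 0) = pi * zp (mid s) * sqrt (2 / m s (mid s))"
proof -
  have "prim (kap (s, 0)) pi = pi * (zp (mid s) / dG s (mid s))"
    by (simp add: prim_def kap_def orb_center s)
  moreover have "1 / dG s (mid s) = sqrt (2 / m s (mid s))"
  proof -
    have mp: "m s (mid s) > 0" using m_pos[OF s] ord[OF s] by simp
    have "1 / dG s (mid s) = 2 * sqrt (m s (mid s) / 2) / m s (mid s)"
      by (simp add: dG_def M_mid s)
    also have "\<dots> = sqrt (2 / m s (mid s))"
      using mp by (intro real_sqrt_unique[symmetric]) (auto simp: power_divide power_mult_distrib power2_eq_square field_simps)
    finally show ?thesis .
  qed
  ultimately show ?thesis by (metis per_def mult.assoc times_divide_eq_right mult.right_neutral)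
qed

text \<open>The phase at a given time. Since the primitive of \<open>kap w\<close> is a bijection of the real line, the phase is
defined for all times, which takes care of all reflections of an orbit at once.\<close>

definition ang :: "real \<times> real \<Rightarrow> real \<Rightarrow> real" where
  "ang w \<xi> = (THE \<alpha>. prim (kap w) \<alpha> = \<xi>)"

lemma prim_kap_less_iff:
  assumes "w \<in> \<Omega>" shows "prim (kap w) \<alpha> < prim (kap w) \<beta> \<longleftrightarrow> \<alpha> < \<beta>"
  using prim_kap_less[OF assms, of \<alpha> \<beta>] prim_kap_less[OF assms, of \<beta> \<alpha>]
  by (cases \<alpha> \<beta> rule: linorder_cases) auto

lemma ang_unique: "w \<in> \<Omega> \<Longrightarrow> ang w (prim (kap w) \<alpha>) = \<alpha>"
  unfolding ang_def
proof (rule the_equality)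
  fix \<beta> assume "w \<in> \<Omega>" "prim (kap w) \<beta> = prim (kap w) \<alpha>"
  then show "\<beta> = \<alpha>"
    using prim_kap_less_iff[of w \<alpha> \<beta>] prim_kap_less_iff[of w \<beta> \<alpha>] by simp
qed simp

lemma prim_kap_npi: "w \<in> \<Omega> \<Longrightarrow> prim (kap w) (real N * pi) = real N * per w"
  unfolding per_def by (intro prim_even_periodic(2) kap_cont1 kap_symm)

lemma prim_kap_minus: "w \<in> \<Omega> \<Longrightarrow> prim (kap w) (- \<alpha>) = - prim (kap w) \<alpha>"
  by (intro prim_even_periodic(3) kap_cont1 kap_symm)

text \<open>The primitive grows by \<open>per w\<close> over each half turn and hence takes arbitrarily large and small values.\<close>

lemma prim_kap_ang:
  assumes w: "w \<in> \<Omega>" shows "prim (kap w) (ang w \<xi>) = \<xi>"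
proof -
  obtain N where N: "\<bar>\<xi>\<bar> < real N * per w"
    using reals_Archimedean3[OF per_pos[OF w]] by blast
  have c: "continuous_on {- (real N * pi)..real N * pi} (prim (kap w))"
    by (rule DERIV_continuous_on, rule has_field_derivative_at_within, rule DERIV_prim[OF kap_cont1[OF w]])
  have le: "- (real N * pi) \<le> real N * pi" by simp
  have ends: "prim (kap w) (- (real N * pi)) \<le> \<xi>" "\<xi> \<le> prim (kap w) (real N * pi)"
    using N by (simp_all add: prim_kap_minus[OF w] prim_kap_npi[OF w])
  obtain \<alpha> where "prim (kap w) \<alpha> = \<xi>" using IVT'[OF ends le c] by auto
  then show ?thesis using ang_unique[OF w] by metis
qed

lemma ang_cont: "continuous_on (\<Omega> \<times> UNIV) (\<lambda>(w, \<xi>). ang w \<xi>)"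
  unfolding continuous_on_def
proof (rule ballI)
  fix p assume p: "p \<in> \<Omega> \<times> (UNIV :: real set)"
  obtain w0 \<xi>0 where p_eq: "p = (w0, \<xi>0)" and w0: "w0 \<in> \<Omega>" using p by auto
  let ?F = "at p within \<Omega> \<times> UNIV"
  have tf: "(fst \<longlongrightarrow> w0) ?F" "(snd \<longlongrightarrow> \<xi>0) ?F"
    using tendsto_fst[OF tendsto_ident_at[of p]] tendsto_snd[OF tendsto_ident_at[of p]] p_eq by auto
  have "eventually (\<lambda>q. q \<in> \<Omega> \<times> UNIV) ?F" unfolding eventually_at_filter by simp
  then have ev: "eventually (\<lambda>q. fst q \<in> \<Omega>) ?F" by (rule eventually_mono) auto
  have tP: "((\<lambda>q. snd q - prim (kap (fst q)) a) \<longlongrightarrow> \<xi>0 - prim (kap w0) a) ?F" for a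
  proof -
    have "((\<lambda>q. (fst q, a)) \<longlongrightarrow> (w0, a)) ?F" using tf by (intro tendsto_intros)
    moreover have "eventually (\<lambda>q. (fst q, a) \<in> \<Omega> \<times> UNIV) ?F"
      using ev by eventually_elim auto
    ultimately have "((\<lambda>q. prim (kap (fst q)) a) \<longlongrightarrow> prim (kap w0) a) ?F"
      using continuous_on_tendsto_compose[OF continuous_on_prim[OF kap_cont], of "\<lambda>q. (fst q, a)" "(w0, a)" ?F]
        w0 by auto
    then show ?thesis using tf by (intro tendsto_intros)
  qed
  show "((\<lambda>(w, \<xi>). ang w \<xi>) \<longlongrightarrow> (\<lambda>(w, \<xi>). ang w \<xi>) p) ?F"
  proof (rule order_tendstoI)
    fix a assume "a < (\<lambda>(w, \<xi>). ang w \<xi>) p"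
    then have "0 < \<xi>0 - prim (kap w0) a"
      using prim_kap_less_iff[OF w0, of a "ang w0 \<xi>0"] prim_kap_ang[OF w0] by (simp add: p_eq)
    from order_tendstoD(1)[OF tP this] ev
    show "eventually (\<lambda>q. a < (\<lambda>(w, \<xi>). ang w \<xi>) q) ?F"
      by eventually_elim
        (use prim_kap_less_iff[of _ a] prim_kap_ang in \<open>force simp: case_prod_unfold\<close>)
  next
    fix a assume "(\<lambda>(w, \<xi>). ang w \<xi>) p < a"
    then have "\<xi>0 - prim (kap w0) a < 0"
      using prim_kap_less_iff[OF w0, of "ang w0 \<xi>0" a] prim_kap_ang[OF w0] by (simp add: p_eq)
    from order_tendstoD(2)[OF tP this] ev
    show "eventually (\<lambda>q. (\<lambda>(w, \<xi>). ang w \<xi>) q < a) ?F"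
      by eventually_elim
        (use prim_kap_less_iff[of _ _ a] prim_kap_ang in \<open>force simp: case_prod_unfold\<close>)
  qed
qed

lemma ang_deriv:
  assumes w: "w \<in> \<Omega>"
  shows "(ang w has_real_derivative 1 / kap w (ang w \<xi>)) (at \<xi>)"
proof -
  have "continuous_on UNIV (ang w)" by (rule continuous_on_slice[OF ang_cont]) (use w in auto)
  then have "isCont (ang w) \<xi>" by (simp add: continuous_on_eq_continuous_at)
  then have "(ang w has_real_derivative inverse (kap w (ang w \<xi>))) (at \<xi>)"
    using kap_pos[OF w, of "ang w \<xi>"] prim_kap_ang[OF w]
    by (intro DERIV_inverse_function[where f = "prim (kap w)" and g = "ang w" and a = "\<xi> - 1" and b = "\<xi> + 1"]
        DERIV_prim kap_cont1 w) auto
  then show ?thesis by (simp add: inverse_eq_divide)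
qed

lemma ang_less: "w \<in> \<Omega> \<Longrightarrow> \<xi> < \<eta> \<Longrightarrow> ang w \<xi> < ang w \<eta>"
  using prim_kap_less_iff[of w "ang w \<xi>" "ang w \<eta>"] by (simp add: prim_kap_ang)

lemma ang_npi: "w \<in> \<Omega> \<Longrightarrow> ang w (real i * per w) = real i * pi"
  using ang_unique[of w "real i * pi"] by (simp add: prim_kap_npi)

lemma ang_minus: "w \<in> \<Omega> \<Longrightarrow> ang w (- \<xi>) = - ang w \<xi>"
  using ang_unique[of w "- ang w \<xi>"] by (simp add: prim_kap_minus prim_kap_ang)

lemma kap_2npi: "kap w (real (2 * i) * pi + \<alpha>) = kap w \<alpha>"
proof -
  have "cos (real (2 * i) * pi + \<alpha>) = cos \<alpha>"
    using cos_npi[of "2 * i"] sin_npi[of "2 * i"] by (simp add: cos_add)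
  then show ?thesis by (simp only: kap_def orb_def)
qed

lemma orb_2npi: "orb w (real (2 * i) * pi + \<alpha>) = orb w \<alpha>"
proof -
  have "cos (real (2 * i) * pi + \<alpha>) = cos \<alpha>"
    using cos_npi[of "2 * i"] sin_npi[of "2 * i"] by (simp add: cos_add)
  then show ?thesis by (simp only: orb_def)
qed

lemma ang_2npi:
  assumes w: "w \<in> \<Omega>" shows "ang w (real (2 * i) * per w + \<xi>) = real (2 * i) * pi + ang w \<xi>"
proof -
  have "prim (kap w) (real (2 * i) * pi + ang w \<xi>) = prim (kap w) (real (2 * i) * pi) + prim (kap w) (ang w \<xi>)"
    by (intro prim_shift kap_cont1 w) (simp only: kap_2npi)
  then have "prim (kap w) (real (2 * i) * pi + ang w \<xi>) = real (2 * i) * per w + \<xi>"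
    by (simp only: prim_kap_npi[OF w] prim_kap_ang[OF w])
  then show ?thesis using ang_unique[OF w, of "real (2 * i) * pi + ang w \<xi>"] by simp
qed

lemma ang_half:
  assumes w: "(s, A) \<in> \<Omega>" shows "ang (s, A) (per (s, A) + \<xi>) = pi + ang (s, - A) \<xi>"
proof -
  have "prim (kap (s, A)) (pi + ang (s, - A) \<xi>) = per (s, A) + \<xi>"
    by (simp add: prim_kap_pi_add[OF w] prim_kap_ang[OF \<Omega>_uminus[OF w]])
  then show ?thesis using ang_unique[OF w, of "pi + ang (s, - A) \<xi>"] by simp
qed

section \<open>Orbits as functions of the space variable\<close>

definition phase :: "nat \<Rightarrow> real \<times> real \<Rightarrow> real \<Rightarrow> real" where
  "phase j w x = ang w (real j * per w * x)"

text \<open>The orbit as a function of the space variable, scaled such that the unit interval covers \<open>j\<close> half periods.\<close>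

definition prof :: "nat \<Rightarrow> real \<times> real \<Rightarrow> real \<Rightarrow> real" where
  "prof j w x = orb w (phase j w x)"

text \<open>The derivative of the profile. Since \<open>kap = zp / dG\<close>, the factor \<open>dG\<close> of the orbit cancels against the phase
velocity, and the formula shows that the sign of the derivative is that of \<open>A sin\<close> of the phase.\<close>

definition dprof :: "nat \<Rightarrow> real \<times> real \<Rightarrow> real \<Rightarrow> real" where
  "dprof j w x = real j * per w * snd w * sin (phase j w x) / zp (prof j w x)"

lemma phase_deriv:
  assumes w: "w \<in> \<Omega>"
  shows "(phase j w has_real_derivative real j * per w / kap w (phase j w x)) (at x)"
proof -
  have "((\<lambda>x. real j * per w * x) has_real_derivative real j * per w) (at x)"
    by (auto intro!: derivative_eq_intros)
  from DERIV_chain2[OF ang_deriv[OF w] this] show ?thesis by (simp add: phase_def[abs_def])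
qed

lemma prof_range:
  assumes "w \<in> \<Omega>"
  shows "lo (fst w) < prof j w x" "prof j w x < hi (fst w)" "0 < prof j w x"
  using orb_range[OF assms] by (simp_all add: prof_def)

lemma prof_deriv:
  assumes w: "w \<in> \<Omega>"
  shows "(prof j w has_real_derivative dprof j w x) (at x)"
proof -
  have "dG (fst w) (prof j w x) > 0"
    using w by (intro dG_pos \<Omega>_I prof_range)
  then show ?thesis
    using DERIV_chain2[OF orb_deriv[OF w] phase_deriv[OF w], of j x] zp_pos[OF prof_range(3)[OF w, of j x]]
    by (simp add: prof_def[abs_def] dprof_def kap_def mult_ac)
qed

lemma phase_cont: "continuous_on (\<Omega> \<times> UNIV) (\<lambda>(w, x). phase j w x)"
proof -
  have "continuous_on (\<Omega> \<times> UNIV) (\<lambda>z. (\<lambda>(w, \<xi>). ang w \<xi>) (fst z, real j * per (fst z) * snd z))"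
    by (intro continuous_on_compose2[OF ang_cont] continuous_intros continuous_on_compose2[OF per_cont]) auto
  then show ?thesis by (simp add: phase_def case_prod_unfold)
qed

lemma prof_cont: "continuous_on (\<Omega> \<times> UNIV) (\<lambda>(w, x). prof j w x)"
proof -
  have "continuous_on (\<Omega> \<times> UNIV) (\<lambda>z. (\<lambda>(w, \<alpha>). orb w \<alpha>) (fst z, (\<lambda>(w, x). phase j w x) z))"
    by (intro continuous_on_compose2[OF orb_cont] continuous_intros phase_cont) auto
  then show ?thesis by (simp add: prof_def case_prod_unfold)
qed

lemma dprof_cont: "continuous_on (\<Omega> \<times> UNIV) (\<lambda>(w, x). dprof j w x)"
proof -
  have 1: "continuous_on (\<Omega> \<times> UNIV) (\<lambda>z :: (real \<times> real) \<times> real. zp ((\<lambda>(w, x). prof j w x) z))"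
    using prof_range by (intro continuous_on_compose2[OF zp_cont prof_cont]) auto
  have 2: "continuous_on (\<Omega> \<times> UNIV) (\<lambda>z :: (real \<times> real) \<times> real. per (fst z))"
    by (intro continuous_on_compose2[OF per_cont] continuous_intros) auto
  have 3: "zp (prof j w x) \<noteq> 0" if "w \<in> \<Omega>" for w x using zp_pos[OF prof_range(3)[OF that, of j x]] by simp
  show ?thesis
    using 1 2 phase_cont[of j] 3 unfolding dprof_def case_prod_unfold
    by (intro continuous_intros) auto
qed

lemma phase_npi:
  assumes "w \<in> \<Omega>" "1 \<le> j" shows "phase j w (real i / real j) = real i * pi"
  using assms ang_npi[of w i] by (simp add: phase_def mult.commute)

lemma dprof_sign:
  assumes w: "w \<in> \<Omega>" and j: "1 \<le> j" and i: "1 \<le> i"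
    and x: "real (i - 1) / real j < x" "x < real i / real j"
  shows "0 < snd w \<Longrightarrow> 0 < (-1) ^ (i - 1) * dprof j w x"
    and "snd w < 0 \<Longrightarrow> (-1) ^ (i - 1) * dprof j w x < 0"
proof -
  have less: "phase j w x < phase j w y" if "x < y" for x y
    unfolding phase_def using that j per_pos[OF w] by (intro ang_less w) auto
  have "0 < (-1) ^ (i - 1) * sin (phase j w x)"
    using less[OF x(1)] less[OF x(2)] i unfolding phase_npi[OF w j] by (intro sin_sign_half_period)
  moreover have "0 < real j * per w / zp (prof j w x)"
    using per_pos[OF w] j zp_pos[OF prof_range(3)[OF w]] by (intro mult_pos_pos divide_pos_pos) auto
  ultimately have *: "0 < real j * per w / zp (prof j w x) * ((-1) ^ (i - 1) * sin (phase j w x))"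
    by (metis mult_pos_pos)
  have eq: "(-1) ^ (i - 1) * dprof j w x
      = snd w * (real j * per w / zp (prof j w x) * ((-1) ^ (i - 1) * sin (phase j w x)))"
    by (simp add: dprof_def)
  show "0 < snd w \<Longrightarrow> 0 < (-1) ^ (i - 1) * dprof j w x" unfolding eq by (rule mult_pos_pos[OF _ *])
  show "snd w < 0 \<Longrightarrow> (-1) ^ (i - 1) * dprof j w x < 0" unfolding eq by (rule mult_neg_pos[OF _ *])
qed

text \<open>Over an interval of length \<open>2\<close> the phase advances by \<open>2 j\<close> half turns, and the orbit is even in the phase.\<close>

lemma prof_reflect_2:
  assumes w: "w \<in> \<Omega>" shows "prof j w (2 - x) = prof j w x"
proof -
  have "phase j w (2 - x) = ang w (real (2 * j) * per w + - (real j * per w * x))"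
    by (simp add: phase_def algebra_simps)
  also have "\<dots> = real (2 * j) * pi + - phase j w x"
    using w by (simp only: ang_2npi ang_minus phase_def)
  finally show ?thesis by (simp only: prof_def orb_2npi orb_symm(1))
qed

text \<open>After half a period \<open>cos \<alpha>\<close> has changed its sign, which is the same as a change of sign of \<open>A\<close>.\<close>

lemma prof_half_period:
  assumes w: "(s, A) \<in> \<Omega>" and j: "1 \<le> j"
  shows "prof j (s, A) (x + 1 / real j) = prof j (s, - A) x"
proof -
  have "phase j (s, A) (x + 1 / real j) = ang (s, A) (per (s, A) + real j * per (s, - A) * x)"
    using j by (simp add: phase_def per_uminus[OF w] distrib_left add.commute)
  also have "\<dots> = pi + phase j (s, - A) x" by (simp only: ang_half[OF w] phase_def)
  finally show ?thesis by (simp only: prof_def orb_symm)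
qed

text \<open>Newton's equation: differentiating \<open>G\<^sup>2 = H - H (mid s)\<close> expresses \<open>H'\<close> by \<open>2 G G'\<close>.\<close>

lemma restoring_force:
  assumes w: "w \<in> \<Omega>"
  shows "2 * (snd w * cos \<alpha>) / kap w \<alpha>
    = - ((orb w \<alpha> - mid (fst w)) * m (fst w) (orb w \<alpha>)) / zp (orb w \<alpha>)"
proof -
  let ?s = "fst w" and ?y = "orb w \<alpha>"
  note r = orb_range[OF w, of \<alpha>]
  have "sqrt (M ?s ?y) > 0" using M_pos[OF \<Omega>_I[OF w], of ?y] r by simp
  moreover have "snd w * cos \<alpha> = - ((?y - mid ?s) * sqrt (M ?s ?y))"
    using r(4) unfolding G_def by simp
  ultimately show ?thesis by (simp add: kap_def dG_def)
qed

lemma phase_0: "w \<in> \<Omega> \<Longrightarrow> phase j w 0 = 0"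
  using ang_npi[of w 0] by (simp add: phase_def)

text \<open>Space averages along the profile are averages over the phase with density \<open>kap\<close>.\<close>

lemma has_integral_prof:
  assumes w: "w \<in> \<Omega>" and j: "1 \<le> j" and g: "continuous_on {0<..} g"
  shows "((\<lambda>x. g (prof j w x)) has_integral prim (\<lambda>\<alpha>. g (orb w \<alpha>) * kap w \<alpha>) pi / per w) {0..1}"
proof -
  let ?k = "\<lambda>\<alpha>. g (orb w \<alpha>) * kap w \<alpha>"
  have "continuous_on UNIV (orb w)" by (rule continuous_on_slice[OF orb_cont]) (use w in auto)
  then have c: "continuous_on UNIV ?k"
    using orb_range(3)[OF w] by (intro continuous_intros continuous_on_compose2[OF g] kap_cont1 w) auto
  let ?P = "\<lambda>x. prim ?k (phase j w x) / (real j * per w)"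
  have "((\<lambda>x. g (prof j w x)) has_integral ?P 1 - ?P 0) {0..1}"
  proof (rule fundamental_theorem_of_calculus)
    fix x :: real
    have "(?P has_real_derivative g (prof j w x)) (at x)"
      using DERIV_cdivide[OF DERIV_chain2[OF DERIV_prim[OF c] phase_deriv[OF w, of j x]], of "real j * per w"]
        kap_pos[OF w, of "phase j w x"] per_pos[OF w] j
      by (simp add: prof_def)
    then show "(?P has_vector_derivative g (prof j w x)) (at x within {0..1})"
      by (simp add: has_real_derivative_iff_has_vector_derivative has_vector_derivative_at_within)
  qed simp
  moreover have "?P 1 = prim ?k pi / per w"
  proof -
    have "phase j w 1 = real j * pi" using phase_npi[OF w j, of j] j by simp
    moreover have "prim ?k (real j * pi) = real j * prim ?k pi"
      using c by (intro prim_even_periodic(2)) (simp_all add: orb_symm kap_symm)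
    ultimately show ?thesis using j by simp
  qed
  ultimately show ?thesis by (simp add: phase_0[OF w])
qed

section \<open>Blow-up of the half period\<close>

text \<open>Near a saddle an orbit slows down: if \<open>H\<close> falls off at most quadratically from the saddle, the velocity is
at most \<open>L\<close> times the distance to the saddle, and so the logarithm of the distance changes at a
bounded rate. The time from the turning point to the centre is therefore at least
\<open>c / L\<close> times the change of that logarithm.\<close>

lemma per_ge_log_lo:
  assumes s: "s \<in> I" and A: "0 < A" "A < amax s" and cL: "0 < c" "0 < L"
    and zp: "\<And>y. lo s \<le> y \<Longrightarrow> y \<le> mid s \<Longrightarrow> c \<le> zp y"
    and H: "\<And>y. lo s \<le> y \<Longrightarrow> y \<le> mid s \<Longrightarrow> H s (lo s) - H s y \<le> (L * (y - lo s))\<^sup>2"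
  shows "c / L * (ln (mid s - lo s) - ln (Y s (- A) - lo s)) \<le> per (s, A)"
proof -
  define w where "w = (s, A)"
  have w: "w \<in> \<Omega>" using s A by (simp add: w_def \<Omega>_def)
  note r = orb_range[OF w, unfolded w_def fst_conv snd_conv, folded w_def]
  define f where "f = (\<lambda>\<alpha>. prim (kap w) \<alpha> - c / L * ln (orb w \<alpha> - lo s))"
  have "f 0 \<le> f (pi / 2)"
  proof (rule DERIV_nonneg_imp_nondecreasing[where f = f])
    fix \<alpha> assume \<alpha>: "0 \<le> \<alpha>" "\<alpha> \<le> pi / 2"
    let ?y = "orb w \<alpha>"
    have cs: "0 \<le> cos \<alpha>" "0 \<le> sin \<alpha>" using \<alpha> by (auto intro: cos_ge_zero sin_ge_zero)
    have dGp: "0 < dG s ?y" using r s by (intro dG_pos) auto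
    have "\<not> G s (mid s) < G s ?y" using r(4)[of \<alpha>] mult_nonneg_nonneg[OF less_imp_le[OF A(1)] cs(1)] by simp
    then have le: "?y \<le> mid s" using G_less_iff[OF s, of "mid s" ?y] r(1,2)[of \<alpha>] ord[OF s] by force
    have "A\<^sup>2 \<le> (- G s (lo s))\<^sup>2" using A by (intro power_mono) (auto simp: amax_def)
    then have "A\<^sup>2 \<le> H s (lo s) - H s (mid s)" using G_sq[OF s, of "lo s"] ord[OF s] by simp
    moreover have "(A * cos \<alpha>)\<^sup>2 = H s ?y - H s (mid s)"
      using G_sq[OF s, of ?y] r(1,2,4)[of \<alpha>] by simp
    moreover have "(A * sin \<alpha>)\<^sup>2 = A\<^sup>2 - (A * cos \<alpha>)\<^sup>2"
      by (simp add: power_mult_distrib sin_squared_eq algebra_simps)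
    ultimately have "(A * sin \<alpha>)\<^sup>2 \<le> (L * (?y - lo s))\<^sup>2"
      using H[of ?y] le r(1)[of \<alpha>] by simp
    moreover have "0 \<le> L * (?y - lo s)"
      by (rule mult_nonneg_nonneg) (use r(1)[of \<alpha>] cL in simp_all)
    ultimately have sl: "A * sin \<alpha> \<le> L * (?y - lo s)" by (rule power2_le_imp_le)
    have "(f has_real_derivative kap w \<alpha> - c / L * (A * sin \<alpha> / dG s ?y / (?y - lo s))) (at \<alpha>)"
    proof -
      have "(orb w has_real_derivative A * sin \<alpha> / dG s ?y) (at \<alpha>)"
        using orb_deriv[OF w, of \<alpha>] by (simp add: w_def)
      then have "((\<lambda>\<alpha>. orb w \<alpha> - lo s) has_real_derivative A * sin \<alpha> / dG s ?y) (at \<alpha>)"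
        using DERIV_diff[OF _ DERIV_const, of "orb w"] by fastforce
      from DERIV_chain2[OF DERIV_ln_divide this] r(1)[of \<alpha>]
      have "((\<lambda>\<alpha>. ln (orb w \<alpha> - lo s)) has_real_derivative A * sin \<alpha> / dG s ?y / (?y - lo s)) (at \<alpha>)"
        by (simp add: mult.commute)
      from DERIV_diff[OF DERIV_prim[OF kap_cont1[OF w]] DERIV_cmult[OF this]]
      show ?thesis unfolding f_def .
    qed
    moreover have "0 \<le> kap w \<alpha> - c / L * (A * sin \<alpha> / dG s ?y / (?y - lo s))"
    proof -
      have "c / L * (A * sin \<alpha> / dG s ?y / (?y - lo s)) = c / dG s ?y * (A * sin \<alpha> / (L * (?y - lo s)))"
        by simp
      also have "\<dots> \<le> c / dG s ?y * 1"
        using sl cL dGp r(1)[of \<alpha>] by (intro mult_left_mono) (auto simp: divide_le_eq)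
      also have "\<dots> \<le> kap w \<alpha>"
        using zp[of ?y] le r(1)[of \<alpha>] dGp by (auto simp: kap_def w_def intro!: divide_right_mono)
      finally show ?thesis by simp
    qed
    ultimately show "\<exists>d. (f has_real_derivative d) (at \<alpha>) \<and> 0 \<le> d" by blast
  qed simp
  moreover have "orb w 0 = Y s (- A)" "orb w (pi / 2) = mid s" by (simp_all add: orb_def w_def Y_0[OF s])
  moreover have "prim (kap w) (pi / 2) < per w" unfolding per_def by (rule prim_kap_less[OF w]) simp
  ultimately show ?thesis by (simp add: f_def w_def algebra_simps)
qed

text \<open>The mirror image for the second half of the piece, from the centre to the upper turning point.\<close>

lemma per_ge_log_hi:
  assumes s: "s \<in> I" and A: "0 < A" "A < amax s" and cL: "0 < c" "0 < L"
    and zp: "\<And>y. mid s \<le> y \<Longrightarrow> y \<le> hi s \<Longrightarrow> c \<le> zp y"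
    and H: "\<And>y. mid s \<le> y \<Longrightarrow> y \<le> hi s \<Longrightarrow> H s (hi s) - H s y \<le> (L * (hi s - y))\<^sup>2"
  shows "c / L * (ln (hi s - mid s) - ln (hi s - Y s A)) \<le> per (s, A)"
proof -
  define w where "w = (s, A)"
  have w: "w \<in> \<Omega>" using s A by (simp add: w_def \<Omega>_def)
  note r = orb_range[OF w, unfolded w_def fst_conv snd_conv, folded w_def]
  define f where "f = (\<lambda>\<alpha>. prim (kap w) \<alpha> + c / L * ln (hi s - orb w \<alpha>))"
  have "f (pi / 2) \<le> f pi"
  proof (rule DERIV_nonneg_imp_nondecreasing[where f = f])
    fix \<alpha> assume \<alpha>: "pi / 2 \<le> \<alpha>" "\<alpha> \<le> pi"
    let ?y = "orb w \<alpha>"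
    have cs: "cos \<alpha> \<le> 0" "0 \<le> sin \<alpha>"
      using \<alpha> cos_monotone_0_pi_le[of "pi / 2" \<alpha>] by (auto intro: sin_ge_zero)
    have dGp: "0 < dG s ?y" using r s by (intro dG_pos) auto
    have "\<not> G s ?y < G s (mid s)" using r(4)[of \<alpha>] cs A by (simp add: mult_le_0_iff not_less)
    then have le: "mid s \<le> ?y" using G_less_iff[OF s, of ?y "mid s"] r(1,2)[of \<alpha>] ord[OF s] by force
    have "A\<^sup>2 \<le> (G s (hi s))\<^sup>2" using A by (intro power_mono) (auto simp: amax_def)
    then have "A\<^sup>2 \<le> H s (hi s) - H s (mid s)" using G_sq[OF s, of "hi s"] ord[OF s] by simp
    moreover have "(A * cos \<alpha>)\<^sup>2 = H s ?y - H s (mid s)"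
      using G_sq[OF s, of ?y] r(1,2,4)[of \<alpha>] by simp
    moreover have "(A * sin \<alpha>)\<^sup>2 = A\<^sup>2 - (A * cos \<alpha>)\<^sup>2"
      by (simp add: power_mult_distrib sin_squared_eq algebra_simps)
    ultimately have "(A * sin \<alpha>)\<^sup>2 \<le> (L * (hi s - ?y))\<^sup>2"
      using H[of ?y] le r(2)[of \<alpha>] by simp
    moreover have "0 \<le> L * (hi s - ?y)"
      by (rule mult_nonneg_nonneg) (use r(2)[of \<alpha>] cL in simp_all)
    ultimately have sl: "A * sin \<alpha> \<le> L * (hi s - ?y)" by (rule power2_le_imp_le)
    have "(f has_real_derivative kap w \<alpha> - c / L * (A * sin \<alpha> / dG s ?y / (hi s - ?y))) (at \<alpha>)"
    proof -
      have "(orb w has_real_derivative A * sin \<alpha> / dG s ?y) (at \<alpha>)"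
        using orb_deriv[OF w, of \<alpha>] by (simp add: w_def)
      then have "((\<lambda>\<alpha>. hi s - orb w \<alpha>) has_real_derivative - (A * sin \<alpha> / dG s ?y)) (at \<alpha>)"
        using DERIV_diff[OF DERIV_const, of "orb w"] by fastforce
      from DERIV_chain2[OF DERIV_ln_divide this] r(2)[of \<alpha>]
      have "((\<lambda>\<alpha>. ln (hi s - orb w \<alpha>)) has_real_derivative - (A * sin \<alpha> / dG s ?y / (hi s - ?y))) (at \<alpha>)"
        by (simp add: mult.commute)
      from DERIV_add[OF DERIV_prim[OF kap_cont1[OF w]] DERIV_cmult[OF this, of "c / L"]]
      show ?thesis unfolding f_def by simp
    qed
    moreover have "0 \<le> kap w \<alpha> - c / L * (A * sin \<alpha> / dG s ?y / (hi s - ?y))"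
    proof -
      have "c / L * (A * sin \<alpha> / dG s ?y / (hi s - ?y)) = c / dG s ?y * (A * sin \<alpha> / (L * (hi s - ?y)))"
        by simp
      also have "\<dots> \<le> c / dG s ?y * 1"
        using sl cL dGp r(2)[of \<alpha>] by (intro mult_left_mono) (auto simp: divide_le_eq)
      also have "\<dots> \<le> kap w \<alpha>"
        using zp[of ?y] le r(2)[of \<alpha>] dGp by (auto simp: kap_def w_def intro!: divide_right_mono)
      finally show ?thesis by simp
    qed
    ultimately show "\<exists>d. (f has_real_derivative d) (at \<alpha>) \<and> 0 \<le> d" by blast
  qed simp
  moreover have "orb w pi = Y s A" "orb w (pi / 2) = mid s" by (simp_all add: orb_def w_def Y_0[OF s])
  moreover have "0 < prim (kap w) (pi / 2)" using prim_kap_less[OF w, of 0 "pi / 2"] by simp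
  ultimately show ?thesis by (simp add: f_def per_def w_def algebra_simps)
qed

text \<open>The derivative vanishes at the saddle, with slope bounded in terms of \<open>N\<close> and \<open>R\<close>. The factor \<open>N + 1\<close> avoids a
square root, by \<open>N \<le> (N + 1)\<^sup>2\<close>.\<close>

lemma H_quadratic_lo:
  assumes s: "s \<in> I" and N: "\<And>y. lo s \<le> y \<Longrightarrow> y \<le> hi s \<Longrightarrow> n s y \<le> N" and R: "hi s \<le> R"
    and y: "lo s \<le> y" "y \<le> mid s"
  shows "H s (lo s) - H s y \<le> (R * (N + 1) * (y - lo s))\<^sup>2"
proof (cases "y = lo s")
  case False
  then have less: "lo s < y" using y by simp
  note o = ord[OF s]
  have N0: "0 < N" using N[of "mid s"] n_pos[OF s, of "mid s"] o by linarith
  obtain \<xi> where \<xi>: "lo s < \<xi>" "\<xi> < y"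
    "H s y - H s (lo s) = (y - lo s) * ((\<xi> - mid s) * ((\<xi> - lo s) * (hi s - \<xi>) * n s \<xi>))"
  proof (rule MVT2[OF less, THEN exE])
    fix x assume "lo s \<le> x" "x \<le> y"
    then show "(H s has_real_derivative (x - mid s) * ((x - lo s) * (hi s - x) * n s x)) (at x)"
      using o by (intro H_deriv s) linarith
  qed (use that in blast)
  have "H s (lo s) - H s y = (y - lo s) * ((\<xi> - lo s) * (((mid s - \<xi>) * (hi s - \<xi>)) * n s \<xi>))"
    using \<xi>(3) by (simp add: algebra_simps)
  also have "\<dots> \<le> (y - lo s) * ((y - lo s) * ((R * R) * N))"
    using \<xi> o y R N[of \<xi>] n_pos[OF s, of \<xi>] N0
    by (intro mult_left_mono mult_mono mult_nonneg_nonneg) auto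
  also have "\<dots> = (y - lo s)\<^sup>2 * R\<^sup>2 * N" by (simp add: power2_eq_square)
  also have "\<dots> \<le> (y - lo s)\<^sup>2 * R\<^sup>2 * (N + 1)\<^sup>2"
  proof (rule mult_left_mono)
    show "N \<le> (N + 1)\<^sup>2" using N0 by (simp add: power2_eq_square algebra_simps)
  qed simp
  finally show ?thesis by (simp add: power_mult_distrib mult_ac)
qed simp

lemma H_quadratic_hi:
  assumes s: "s \<in> I" and N: "\<And>y. lo s \<le> y \<Longrightarrow> y \<le> hi s \<Longrightarrow> n s y \<le> N" and R: "hi s \<le> R"
    and y: "mid s \<le> y" "y \<le> hi s"
  shows "H s (hi s) - H s y \<le> (R * (N + 1) * (hi s - y))\<^sup>2"
proof (cases "y = hi s")
  case False
  then have less: "y < hi s" using y by simp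
  note o = ord[OF s]
  have N0: "0 < N" using N[of "mid s"] n_pos[OF s, of "mid s"] o by linarith
  obtain \<xi> where \<xi>: "y < \<xi>" "\<xi> < hi s"
    "H s (hi s) - H s y = (hi s - y) * ((\<xi> - mid s) * ((\<xi> - lo s) * (hi s - \<xi>) * n s \<xi>))"
  proof (rule MVT2[OF less, THEN exE])
    fix x assume "y \<le> x" "x \<le> hi s"
    then show "(H s has_real_derivative (x - mid s) * ((x - lo s) * (hi s - x) * n s x)) (at x)"
      using o y by (intro H_deriv s) linarith
  qed (use that in blast)
  have "H s (hi s) - H s y = (hi s - y) * ((hi s - \<xi>) * (((\<xi> - mid s) * (\<xi> - lo s)) * n s \<xi>))"
    using \<xi>(3) by (simp add: algebra_simps)
  also have "\<dots> \<le> (hi s - y) * ((hi s - y) * ((R * R) * N))"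
    using \<xi> o y R N[of \<xi>] n_pos[OF s, of \<xi>] N0
    by (intro mult_left_mono mult_mono mult_nonneg_nonneg) auto
  also have "\<dots> = (hi s - y)\<^sup>2 * R\<^sup>2 * N" by (simp add: power2_eq_square)
  also have "\<dots> \<le> (hi s - y)\<^sup>2 * R\<^sup>2 * (N + 1)\<^sup>2"
  proof (rule mult_left_mono)
    show "N \<le> (N + 1)\<^sup>2" using N0 by (simp add: power2_eq_square algebra_simps)
  qed simp
  finally show ?thesis by (simp add: power_mult_distrib mult_ac)
qed simp

text \<open>The region is the image of \<open>J \<times> [0, 1]\<close> under a fibrewise affine map.\<close>

lemma compact_between:
  fixes p q :: "real \<Rightarrow> real"
  assumes J: "compact J" and pq: "continuous_on J p" "continuous_on J q" "\<And>s. s \<in> J \<Longrightarrow> p s \<le> q s"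
  shows "compact {(s, y). s \<in> J \<and> p s \<le> y \<and> y \<le> q s}"
proof -
  let ?f = "\<lambda>z. (fst z, p (fst z) + snd z * (q (fst z) - p (fst z)))"
  have "continuous_on (J \<times> {0..1}) ?f"
    by (intro continuous_intros continuous_on_compose2[OF pq(1)] continuous_on_compose2[OF pq(2)]) auto
  then have "compact (?f ` (J \<times> {0..1}))"
    using J by (intro compact_continuous_image compact_Times) auto
  also have "?f ` (J \<times> {0..1}) = {(s, y). s \<in> J \<and> p s \<le> y \<and> y \<le> q s}"
  proof (intro equalityI subsetI)
    fix z assume "z \<in> ?f ` (J \<times> {0..1})"
    then obtain s \<sigma> where z: "s \<in> J" "0 \<le> \<sigma>" "\<sigma> \<le> 1" "z = (s, p s + \<sigma> * (q s - p s))" by auto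
    have "\<sigma> * (q s - p s) \<le> 1 * (q s - p s)" using z pq(3)[of s] by (intro mult_right_mono) auto
    then show "z \<in> {(s, y). s \<in> J \<and> p s \<le> y \<and> y \<le> q s}"
      using z pq(3)[of s] by (auto intro: mult_nonneg_nonneg)
  next
    fix z assume "z \<in> {(s, y). s \<in> J \<and> p s \<le> y \<and> y \<le> q s}"
    then obtain s y where z: "z = (s, y)" "s \<in> J" "p s \<le> y" "y \<le> q s" by auto
    show "z \<in> ?f ` (J \<times> {0..1})"
    proof (cases "p s = q s")
      case True
      then show ?thesis using z by (intro image_eqI[of _ _ "(s, 0)"]) auto
    next
      case False
      then have "p s < q s" using pq(3)[OF z(2)] by simp
      then show ?thesis using z
        by (intro image_eqI[of _ _ "(s, (y - p s) / (q s - p s))"]) (auto simp: divide_simps)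
    qed
  qed
  finally show ?thesis .
qed

text \<open>If \<open>A\<close> is close to \<open>amax s\<close>, one turning point is close to a saddle, uniformly in \<open>s\<close> because \<open>Y\<close> is
uniformly continuous on compact sets. Then the logarithmic lower bound for the half period is large.\<close>

lemma per_blowup:
  assumes J: "compact J" "J \<subseteq> I"
  obtains \<epsilon> where "0 < \<epsilon>" "\<epsilon> < 1"
    "\<And>s A. s \<in> J \<Longrightarrow> (1 - \<epsilon>) * amax s < A \<Longrightarrow> A < amax s \<Longrightarrow> B < per (s, A)"
proof (cases "J = {}")
  case True
  then show thesis using that[of "1/2"] by auto
next
  case False
  note cJ = continuous_on_subset[OF cont_lo J(2)] continuous_on_subset[OF cont_mid J(2)]
    continuous_on_subset[OF cont_hi J(2)]
  let ?K = "{(s, y). s \<in> J \<and> lo s \<le> y \<and> y \<le> hi s}"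
  have sI: "s \<in> I" if "s \<in> J" for s using that J(2) by blast
  have lohi: "lo s < hi s" if "s \<in> J" for s using ord(2,3)[OF sI[OF that]] by linarith
  have K: "compact ?K" using lohi by (intro compact_between J cJ) (auto intro: less_imp_le)
  have Ksub: "?K \<subseteq> I \<times> {0<..}" using sI ord(1) by force
  obtain s1 where "s1 \<in> J" using False by blast
  then have Kne: "?K \<noteq> {}" using lohi[of s1] \<open>s1 \<in> J\<close> by force
  obtain N where N: "\<And>s y. s \<in> J \<Longrightarrow> lo s \<le> y \<Longrightarrow> y \<le> hi s \<Longrightarrow> n s y \<le> N"
  proof -
    obtain z where "z \<in> ?K" "\<forall>x\<in>?K. (\<lambda>(s, y). n s y) x \<le> (\<lambda>(s, y). n s y) z"
      using continuous_attains_sup[OF K Kne continuous_on_subset[OF n_cont Ksub]] by blast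
    then show thesis using that[of "(\<lambda>(s, y). n s y) z"] by auto
  qed
  obtain R where R: "\<And>s. s \<in> J \<Longrightarrow> hi s \<le> R"
    using continuous_attains_sup[OF J(1) False cJ(3)] by blast
  obtain c where c: "0 < c" "\<And>s y. s \<in> J \<Longrightarrow> lo s \<le> y \<Longrightarrow> y \<le> hi s \<Longrightarrow> c \<le> zp y"
  proof -
    have "continuous_on ?K (\<lambda>p. zp (snd p))"
      using Ksub by (intro continuous_on_compose2[OF zp_cont] continuous_intros) auto
    then obtain z where z: "z \<in> ?K" "\<forall>x\<in>?K. zp (snd z) \<le> zp (snd x)"
      using continuous_attains_inf[OF K Kne, of "\<lambda>p. zp (snd p)"] by blast
    then have "0 < zp (snd z)" using Ksub by (intro zp_pos) auto
    then show thesis using z(2) by (intro that[of "zp (snd z)"]) auto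
  qed
  obtain g where g: "0 < g" "\<And>s. s \<in> J \<Longrightarrow> g \<le> mid s - lo s" "\<And>s. s \<in> J \<Longrightarrow> g \<le> hi s - mid s"
  proof -
    let ?g = "\<lambda>s. min (mid s - lo s) (hi s - mid s)"
    have "continuous_on J ?g" using cJ by (intro continuous_intros)
    then obtain z where z: "z \<in> J" "\<forall>s\<in>J. ?g z \<le> ?g s"
      using continuous_attains_inf[OF J(1) False, of ?g] by blast
    have "0 < ?g z" using ord[OF sI[OF z(1)]] by simp
    then show thesis using z(2) by (intro that[of "?g z"]) auto
  qed
  obtain a where a: "\<And>s. s \<in> J \<Longrightarrow> amax s \<le> a"
    using continuous_attains_sup[OF J(1) False continuous_on_subset[OF amax_cont J(2)]] by blast
  have a0: "0 < a" using a[OF \<open>s1 \<in> J\<close>] amax_pos[OF sI[OF \<open>s1 \<in> J\<close>]] by simp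
  have R0: "0 < R" using R[OF \<open>s1 \<in> J\<close>] ord[OF sI[OF \<open>s1 \<in> J\<close>]] by linarith
  have N0: "0 < N"
    using N[OF \<open>s1 \<in> J\<close>, of "mid s1"] n_pos[OF sI[OF \<open>s1 \<in> J\<close>], of "mid s1"] ord[OF sI[OF \<open>s1 \<in> J\<close>]]
    by linarith
  define L where "L = R * (N + 1)"
  have L: "0 < L" using R0 N0 by (simp add: L_def)
  \<comment> \<open>solves \<open>c / L * (ln g - ln \<rho>) = B + 1\<close>\<close>
  define \<rho> where "\<rho> = g * exp (- ((B + 1) * L / c))"
  have \<rho>: "0 < \<rho>" using g by (simp add: \<rho>_def)
  have ln\<rho>: "c / L * (ln g - ln \<rho>) = B + 1" using g c L by (simp add: \<rho>_def ln_mult)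
  let ?V = "{(s, x). s \<in> J \<and> G s (lo s) \<le> x \<and> x \<le> G s (hi s)}"
  have Gle: "G s (lo s) < G s (hi s)" if "s \<in> J" for s
    using lohi[OF that] by (intro G_less sI that) auto
  have V: "compact ?V"
  proof (rule compact_between[OF J(1)])
    have 1: "continuous_on J (\<lambda>s. (\<lambda>(s, y). G s y) (s, lo s))"
      by (rule continuous_on_compose2[OF G_cont]) (use sI ord(1) cJ(1) in \<open>auto intro!: continuous_on_Pair continuous_on_id\<close>)
    then show "continuous_on J (\<lambda>s. G s (lo s))" by simp
    have hi0: "0 < hi s" if "s \<in> J" for s using lohi[OF that] ord(1)[OF sI[OF that]] by linarith
    have "continuous_on J (\<lambda>s. (\<lambda>(s, y). G s y) (s, hi s))"
      by (rule continuous_on_compose2[OF G_cont]) (use sI hi0 cJ(3) in \<open>auto intro!: continuous_on_Pair continuous_on_id\<close>)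
    then show "continuous_on J (\<lambda>s. G s (hi s))" by simp
    show "G s (lo s) \<le> G s (hi s)" if "s \<in> J" for s using Gle[OF that] by simp
  qed
  have "uniformly_continuous_on ?V (\<lambda>(s, x). Y s x)"
    by (rule compact_uniformly_continuous[OF continuous_on_subset[OF Y_cont] V]) (use sI in auto)
  then obtain \<delta> where \<delta>: "0 < \<delta>"
    "\<forall>z\<in>?V. \<forall>z'\<in>?V. dist z' z < \<delta> \<longrightarrow> dist ((\<lambda>(s, x). Y s x) z') ((\<lambda>(s, x). Y s x) z) < \<rho>"
    unfolding uniformly_continuous_on_def using \<rho> by blast
  have Yd: "\<bar>Y s x' - Y s x\<bar> < \<rho>"
    if "s \<in> J" "G s (lo s) \<le> x" "x \<le> G s (hi s)" "G s (lo s) \<le> x'" "x' \<le> G s (hi s)" "\<bar>x' - x\<bar> < \<delta>"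
    for s x x'
    using \<delta>(2)[rule_format, of "(s, x)" "(s, x')"] that by (simp add: dist_Pair_Pair dist_real_def)
  \<comment> \<open>a relative deficit \<open>\<epsilon>\<close> of the amplitude is an absolute one below \<open>\<delta>\<close>\<close>
  define \<epsilon> where "\<epsilon> = min (\<delta> / (a + 1)) (1 / 2)"
  show thesis
  proof (rule that[of \<epsilon>])
    show "0 < \<epsilon>" "\<epsilon> < 1" using \<delta> a0 by (auto simp: \<epsilon>_def)
    fix s A assume s: "s \<in> J" and A: "(1 - \<epsilon>) * amax s < A" "A < amax s"
    note sI' = sI[OF s]
    note o = ord[OF sI']
    have "0 < (1 - \<epsilon>) * amax s" using \<open>\<epsilon> < 1\<close> amax_pos[OF sI'] by simp
    then have A0: "0 < A" using A by simp
    have "amax s - A < \<epsilon> * amax s" using A by (simp add: algebra_simps)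
    also have "\<dots> \<le> \<delta> / (a + 1) * a"
      using a[OF s] amax_pos[OF sI'] \<delta> a0 by (intro mult_mono) (auto simp: \<epsilon>_def)
    also have "\<dots> < \<delta>" using a0 \<delta>(1) by (simp add: field_simps)
    finally have d: "amax s - A < \<delta>" .
    have Ar: "G s (lo s) < - A" "A < G s (hi s)" "- A < G s (hi s)" "G s (lo s) < A"
      using A A0 by (auto simp: amax_def)
    have "amax s = - G s (lo s) \<or> amax s = G s (hi s)" by (auto simp: amax_def)
    then show "B < per (s, A)"
    proof
      assume eq: "amax s = - G s (lo s)"
      have "\<bar>Y s (- A) - Y s (G s (lo s))\<bar> < \<rho>"
        using Ar Gle[OF s] d eq by (intro Yd s) auto
      moreover have "Y s (G s (lo s)) = lo s" using o by (intro Y_unique sI') auto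
      moreover have p: "lo s < Y s (- A)" by (rule Y_props_strict(1)[OF sI' Ar(1,3)])
      ultimately have "ln (Y s (- A) - lo s) \<le> ln \<rho>" using \<rho> by (subst ln_le_cancel_iff) auto
      moreover have "ln g \<le> ln (mid s - lo s)" using g(1) g(2)[OF s] by (subst ln_le_cancel_iff) auto
      ultimately have "c / L * (ln g - ln \<rho>) \<le> c / L * (ln (mid s - lo s) - ln (Y s (- A) - lo s))"
        using c L by (intro mult_left_mono) auto
      also have "\<dots> \<le> per (s, A)"
      proof (rule per_ge_log_lo[OF sI' A0 A(2) c(1) L])
        fix y assume y: "lo s \<le> y" "y \<le> mid s"
        show "c \<le> zp y" using y o by (intro c(2)[OF s]) auto
        show "H s (lo s) - H s y \<le> (L * (y - lo s))\<^sup>2"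
          unfolding L_def by (rule H_quadratic_lo[OF sI' N[OF s] R[OF s] y])
      qed
      finally show ?thesis using ln\<rho> by simp
    next
      assume eq: "amax s = G s (hi s)"
      have "\<bar>Y s A - Y s (G s (hi s))\<bar> < \<rho>"
        using Ar Gle[OF s] d eq by (intro Yd s) auto
      moreover have "Y s (G s (hi s)) = hi s" using o by (intro Y_unique sI') auto
      moreover have p: "Y s A < hi s" by (rule Y_props_strict(2)[OF sI' Ar(4,2)])
      ultimately have "ln (hi s - Y s A) \<le> ln \<rho>" using \<rho> by (subst ln_le_cancel_iff) auto
      moreover have "ln g \<le> ln (hi s - mid s)" using g(1) g(3)[OF s] by (subst ln_le_cancel_iff) auto
      ultimately have "c / L * (ln g - ln \<rho>) \<le> c / L * (ln (hi s - mid s) - ln (hi s - Y s A))"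
        using c L by (intro mult_left_mono) auto
      also have "\<dots> \<le> per (s, A)"
      proof (rule per_ge_log_hi[OF sI' A0 A(2) c(1) L])
        fix y assume y: "mid s \<le> y" "y \<le> hi s"
        show "c \<le> zp y" using y o by (intro c(2)[OF s]) auto
        show "H s (hi s) - H s y \<le> (L * (hi s - y))\<^sup>2"
          unfolding L_def by (rule H_quadratic_hi[OF sI' N[OF s] R[OF s] y])
      qed
      finally show ?thesis using ln\<rho> by simp
    qed
  qed
qed

end

section \<open>The scaled reaction term and its three zeros\<close>

text \<open>Throughout, \<open>y = sqrt (u / v)\<close> and \<open>s = sqrt (u v)\<close>, so that \<open>u = s y\<close>, \<open>v = s / y\<close> and \<open>\<tau> = s\<^sup>2\<close>.\<close>

locale skt_limit =
  fixes a1 a2 b1 b2 c1 c2 \<gamma> \<delta> :: real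
  assumes pos: "a1 > 0" "a2 > 0" "b1 > 0" "b2 > 0" "c1 > 0" "c2 > 0" "\<gamma> > 0" "\<delta> > 0"
begin

text \<open>The part of the reaction \<open>f - \<gamma> g\<close> that is quadratic in \<open>(u, v)\<close>, divided by \<open>- s\<^sup>2\<close>.\<close>

definition k :: "real \<Rightarrow> real" where
  "k y = b1 * y\<^sup>2 + c1 - \<gamma> * b2 - \<gamma> * c2 / y\<^sup>2"

text \<open>The reaction \<open>f - \<gamma> g\<close>, divided by \<open>s\<close>.\<close>

definition h :: "real \<Rightarrow> real \<Rightarrow> real" where
  "h s y = a1 * y - \<gamma> * a2 / y - s * k y"

text \<open>The reaction \<open>f\<close>, divided by \<open>s\<close>.\<close>

definition fh :: "real \<Rightarrow> real \<Rightarrow> real" where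
  "fh s y = a1 * y - s * (b1 * y\<^sup>2 + c1)"

text \<open>The derivative of \<open>w / s = \<delta> y - \<gamma> / y\<close>.\<close>

definition zp :: "real \<Rightarrow> real" where
  "zp y = \<delta> + \<gamma> / y\<^sup>2"

text \<open>A primitive of \<open>h s y * zp y\<close>, that is of \<open>h s\<close> with respect to \<open>\<delta> y - \<gamma> / y\<close>.\<close>

definition H :: "real \<Rightarrow> real \<Rightarrow> real" where
  "H s y = \<delta> * a1 * y\<^sup>2 / 2 + (\<gamma> * a1 - \<delta> * \<gamma> * a2) * ln y + \<gamma>\<^sup>2 * a2 / (2 * y\<^sup>2)
    - s * (\<delta> * b1 * y ^ 3 / 3 + (\<delta> * (c1 - \<gamma> * b2) + \<gamma> * b1) * y
           + (\<delta> * \<gamma> * c2 - \<gamma> * (c1 - \<gamma> * b2)) / y + \<gamma>\<^sup>2 * c2 / (3 * y ^ 3))"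

lemma zp_pos: "0 < y \<Longrightarrow> 0 < zp y"
  using pos by (auto simp: zp_def intro!: add_pos_pos)

lemma zp_cont: "continuous_on {0<..} zp"
  unfolding zp_def[abs_def] by (intro continuous_intros) auto

lemma H_deriv: "0 < y \<Longrightarrow> (H s has_real_derivative h s y * zp y) (at y)"
  unfolding H_def[abs_def] h_def k_def zp_def
  by (auto intro!: derivative_eq_intros)
     (simp add: field_simps power_numeral_reduce power2_eq_square)

lemma h_cont: "continuous_on (UNIV \<times> {0<..}) (\<lambda>(s, y). h s y)"
  unfolding h_def k_def case_prod_unfold by (intro continuous_intros) auto

lemma fh_cont: "continuous_on (UNIV \<times> {0<..}) (\<lambda>(s, y). fh s y)"
  unfolding fh_def case_prod_unfold by (intro continuous_intros)

lemma H_cont: "continuous_on (UNIV \<times> {0<..}) (\<lambda>(s, y). H s y)"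
  unfolding H_def case_prod_unfold by (intro continuous_intros) auto

lemma h_cont_y: "X \<subseteq> {0<..} \<Longrightarrow> continuous_on X (h s)"
  by (rule continuous_on_slice[OF h_cont]) auto

definition three :: "real \<Rightarrow> real \<Rightarrow> real \<Rightarrow> real \<Rightarrow> bool" where
  "three s p q r \<longleftrightarrow> 0 < p \<and> p < q \<and> q < r \<and> h s p = 0 \<and> h s q = 0 \<and> h s r = 0"

text \<open>Minus the fourth zero of the quartic \<open>y\<^sup>2 h s y\<close>, read off from its constant coefficient. It is positive, so
there is no fourth positive zero.\<close>

definition eta :: "real \<Rightarrow> real \<Rightarrow> real \<Rightarrow> real" where
  "eta p q r = \<gamma> * c2 / (b1 * p * q * r)"

lemma quadratic_three_roots:
  fixes \<alpha> \<beta> \<kappa> p q r :: real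
  assumes "\<alpha> * p\<^sup>2 + \<beta> * p + \<kappa> = 0" "\<alpha> * q\<^sup>2 + \<beta> * q + \<kappa> = 0" "\<alpha> * r\<^sup>2 + \<beta> * r + \<kappa> = 0"
    and "p \<noteq> q" "q \<noteq> r" "p \<noteq> r"
  shows "\<alpha> = 0 \<and> \<beta> = 0 \<and> \<kappa> = 0"
proof -
  have "(q - p) * (\<alpha> * (p + q) + \<beta>) = 0" "(r - p) * (\<alpha> * (p + r) + \<beta>) = 0"
    using assms(1-3) by (auto simp: algebra_simps power2_eq_square)
  then have 1: "\<alpha> * (p + q) + \<beta> = 0" "\<alpha> * (p + r) + \<beta> = 0" using assms(4-6) by auto
  have "\<alpha> * (q - r) = (\<alpha> * (p + q) + \<beta>) - (\<alpha> * (p + r) + \<beta>)" by (simp add: algebra_simps)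
  then have "\<alpha> * (q - r) = 0" unfolding 1 by simp
  then have "\<alpha> = 0" using assms(5) by simp
  then show ?thesis using 1 assms(1) by simp
qed

text \<open>The quartic \<open>y\<^sup>2 h s y\<close> and the product agree in the leading and in the constant coefficient. Their
difference is \<open>y\<close> times a quadratic polynomial with the three zeros \<open>p\<close>, \<open>q\<close>, \<open>r\<close>, hence zero.\<close>

lemma h_factor:
  assumes t: "three s p q r" and y: "0 < y"
  shows "h s y = s * b1 * (y + eta p q r) / y\<^sup>2 * ((y - p) * (y - q) * (r - y))"
proof -
  let ?\<eta> = "eta p q r"
  have pqr: "0 < p" "0 < q" "0 < r" "p \<noteq> q" "q \<noteq> r" "p \<noteq> r" using t by (auto simp: three_def)
  have \<eta>: "b1 * p * q * r * ?\<eta> = \<gamma> * c2" using pqr pos by (simp add: eta_def)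
  define \<alpha> where "\<alpha> = a1 - s * b1 * (p + q + r - ?\<eta>)"
  define \<beta> where "\<beta> = - s * (c1 - \<gamma> * b2) + s * b1 * (p * q + p * r + q * r - ?\<eta> * (p + q + r))"
  define \<kappa> where "\<kappa> = - \<gamma> * a2 - s * b1 * (p * q * r - ?\<eta> * (p * q + p * r + q * r))"
  have key: "x\<^sup>2 * h s x = s * b1 * (x + ?\<eta>) * ((x - p) * (x - q) * (r - x)) + x * (\<alpha> * x\<^sup>2 + \<beta> * x + \<kappa>)"
    if "0 < x" for x
  proof -
    have "x\<^sup>2 * h s x = - s * b1 * x ^ 4 + a1 * x ^ 3 - s * (c1 - \<gamma> * b2) * x\<^sup>2 - \<gamma> * a2 * x + s * (\<gamma> * c2)"
      using that by (simp add: h_def k_def field_simps power2_eq_square power4_eq_xxxx power3_eq_cube)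
    also have "\<dots> = s * b1 * (x + ?\<eta>) * ((x - p) * (x - q) * (r - x)) + x * (\<alpha> * x\<^sup>2 + \<beta> * x + \<kappa>)"
      unfolding \<eta>[symmetric] \<alpha>_def \<beta>_def \<kappa>_def
      by (simp add: algebra_simps power2_eq_square power4_eq_xxxx power3_eq_cube)
    finally show ?thesis .
  qed
  have "\<alpha> * p\<^sup>2 + \<beta> * p + \<kappa> = 0" "\<alpha> * q\<^sup>2 + \<beta> * q + \<kappa> = 0" "\<alpha> * r\<^sup>2 + \<beta> * r + \<kappa> = 0"
    using key[of p] key[of q] key[of r] pqr t by (simp_all add: three_def)
  then have "\<alpha> = 0 \<and> \<beta> = 0 \<and> \<kappa> = 0" using pqr by (intro quadratic_three_roots)
  then show ?thesis using key[OF y] y by (simp add: field_simps)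
qed

lemma h_sign:
  assumes t: "three s p q r" and s: "0 < s" and y: "0 < y"
  shows "y < p \<Longrightarrow> 0 < h s y" "p < y \<Longrightarrow> y < q \<Longrightarrow> h s y < 0" "q < y \<Longrightarrow> y < r \<Longrightarrow> 0 < h s y"
    "r < y \<Longrightarrow> h s y < 0" "h s y = 0 \<Longrightarrow> y = p \<or> y = q \<or> y = r"
proof -
  have o: "0 < p" "p < q" "q < r" using t by (auto simp: three_def)
  then have "0 < eta p q r" using pos by (simp add: eta_def)
  then have C: "0 < s * b1 * (y + eta p q r) / y\<^sup>2" using s y pos by (intro divide_pos_pos mult_pos_pos) auto
  note f = h_factor[OF t y]
  show "0 < h s y" if "y < p"
  proof -
    have "0 < (y - p) * (y - q)" "0 < r - y" using that o by (auto intro: mult_neg_neg)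
    then show ?thesis unfolding f by (rule mult_pos_pos[OF C mult_pos_pos])
  qed
  show "h s y < 0" if "p < y" "y < q"
  proof -
    have "(y - p) * (y - q) < 0" "0 < r - y" using that o by (auto intro: mult_pos_neg)
    then show ?thesis unfolding f by (rule mult_pos_neg[OF C mult_neg_pos])
  qed
  show "0 < h s y" if "q < y" "y < r"
  proof -
    have "0 < (y - p) * (y - q)" "0 < r - y" using that o by auto
    then show ?thesis unfolding f by (rule mult_pos_pos[OF C mult_pos_pos])
  qed
  show "h s y < 0" if "r < y"
  proof -
    have "0 < (y - p) * (y - q)" "r - y < 0" using that o by auto
    then show ?thesis unfolding f by (rule mult_pos_neg[OF C mult_pos_neg])
  qed
  show "y = p \<or> y = q \<or> y = r" if "h s y = 0" using that f C by auto
qed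

lemma three_unique:
  assumes "three s p q r" "three s p' q' r'" "0 < s"
  shows "p' = p \<and> q' = q \<and> r' = r"
  using h_sign(5)[OF assms(1,3), of p'] h_sign(5)[OF assms(1,3), of q'] h_sign(5)[OF assms(1,3), of r'] assms
  unfolding three_def by auto

definition T :: "real set" where
  "T = {s. 0 < s \<and> (\<exists>p q r. three s p q r)}"

definition y1 :: "real \<Rightarrow> real" where "y1 s = (THE p. \<exists>q r. three s p q r)"
definition y2 :: "real \<Rightarrow> real" where "y2 s = (THE q. \<exists>p r. three s p q r)"
definition y3 :: "real \<Rightarrow> real" where "y3 s = (THE r. \<exists>p q. three s p q r)"

lemma y_eq:
  assumes "three s p q r" "0 < s" shows "y1 s = p" "y2 s = q" "y3 s = r"
  unfolding y1_def y2_def y3_def using three_unique[OF assms(1) _ assms(2)] assms(1) by blast+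

lemma three_y: "s \<in> T \<Longrightarrow> three s (y1 s) (y2 s) (y3 s)"
  using y_eq unfolding T_def by fastforce

lemma T_pos: "s \<in> T \<Longrightarrow> 0 < s" by (simp add: T_def)

lemma y_ord: "s \<in> T \<Longrightarrow> 0 < y1 s" "s \<in> T \<Longrightarrow> y1 s < y2 s" "s \<in> T \<Longrightarrow> y2 s < y3 s"
  using three_y[of s] by (simp_all add: three_def)

lemma h_IVT_down:
  assumes "0 < x" "x < y" "0 < h s x" "h s y < 0" obtains z where "x < z" "z < y" "h s z = 0"
proof -
  have "continuous_on {x..y} (h s)" using assms by (intro h_cont_y) auto
  then obtain z where "x \<le> z" "z \<le> y" "h s z = 0"
    using IVT2'[of "h s" y 0 x] assms by auto
  then show thesis using assms that[of z] by (metis order_less_le less_irrefl)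
qed

lemma h_IVT_up:
  assumes "0 < x" "x < y" "h s x < 0" "0 < h s y" obtains z where "x < z" "z < y" "h s z = 0"
proof -
  have "continuous_on {x..y} (h s)" using assms by (intro h_cont_y) auto
  then obtain z where "x \<le> z" "z \<le> y" "h s z = 0"
    using IVT'[of "h s" x 0 y] assms by auto
  then show thesis using assms that[of z] by (metis order_less_le less_irrefl)
qed

text \<open>The three zeros are sign changes, so each of them persists in a small interval around it; there are
no further zeros, so the ordered zeros stay close to the original ones.\<close>

lemma y_perturb:
  assumes s0: "s0 \<in> T" and e: "0 < e"
  shows "\<forall>\<^sub>F s in at s0. s \<in> T \<and> \<bar>y1 s - y1 s0\<bar> < e \<and> \<bar>y2 s - y2 s0\<bar> < e \<and> \<bar>y3 s - y3 s0\<bar> < e"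
proof -
  let ?p = "y1 s0" and ?q = "y2 s0" and ?r = "y3 s0"
  note o = y_ord[OF s0]
  \<comment> \<open>a third of the gaps keeps the three intervals of radius \<open>\<rho>\<close> disjoint and positive\<close>
  define \<rho> where "\<rho> = min e (min ?p (min (?q - ?p) (?r - ?q))) / 3"
  have \<rho>: "0 < \<rho>" "\<rho> < e" "3 * \<rho> \<le> ?p" "3 * \<rho> \<le> ?q - ?p" "3 * \<rho> \<le> ?r - ?q"
    using o e by (auto simp: \<rho>_def)
  note sg = h_sign[OF three_y[OF s0] T_pos[OF s0]]
  have t: "((\<lambda>s. h s x) \<longlongrightarrow> h s0 x) (at s0)" for x
    unfolding h_def by (intro tendsto_intros)
  have "\<forall>\<^sub>F s in at s0. 0 < h s (?p - \<rho>)" "\<forall>\<^sub>F s in at s0. 0 < h s (?q + \<rho>)"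
     "\<forall>\<^sub>F s in at s0. 0 < h s (?r - \<rho>)"
    using sg(1)[of "?p - \<rho>"] sg(3)[of "?q + \<rho>"] sg(3)[of "?r - \<rho>"] \<rho> o
    by (auto intro!: order_tendstoD(1)[OF t])
  moreover have "\<forall>\<^sub>F s in at s0. h s (?p + \<rho>) < 0" "\<forall>\<^sub>F s in at s0. h s (?q - \<rho>) < 0"
     "\<forall>\<^sub>F s in at s0. h s (?r + \<rho>) < 0"
    using sg(2)[of "?p + \<rho>"] sg(2)[of "?q - \<rho>"] sg(4)[of "?r + \<rho>"] \<rho> o
    by (auto intro!: order_tendstoD(2)[OF t])
  moreover have "\<forall>\<^sub>F s in at s0. 0 < s" using T_pos[OF s0] by (intro order_tendstoD(1)[OF tendsto_ident_at])
  ultimately show ?thesis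
  proof eventually_elim
    case (elim s)
    obtain p where p: "?p - \<rho> < p" "p < ?p + \<rho>" "h s p = 0"
      using h_IVT_down[of "?p - \<rho>" "?p + \<rho>" s] elim \<rho> by auto
    obtain q where q: "?q - \<rho> < q" "q < ?q + \<rho>" "h s q = 0"
      using h_IVT_up[of "?q - \<rho>" "?q + \<rho>" s] elim \<rho> o by auto
    obtain r where r: "?r - \<rho> < r" "r < ?r + \<rho>" "h s r = 0"
      using h_IVT_down[of "?r - \<rho>" "?r + \<rho>" s] elim \<rho> o by auto
    have th: "three s p q r" using p q r \<rho> by (auto simp: three_def)
    then have "s \<in> T" using elim by (auto simp: T_def)
    then show ?case using y_eq[OF th] elim p q r \<rho> by auto
  qed
qed

lemma T_open: "open T"
  unfolding open_contains_ball
proof (rule ballI)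
  fix s assume s: "s \<in> T"
  have "\<forall>\<^sub>F x in at s. x \<in> T" using y_perturb[OF s zero_less_one] by (rule eventually_mono) simp
  then obtain d where "0 < d" "\<And>x. x \<noteq> s \<Longrightarrow> dist x s < d \<Longrightarrow> x \<in> T"
    unfolding eventually_at by auto
  then show "\<exists>e>0. ball s e \<subseteq> T" using s by (metis dist_commute mem_ball subsetI)
qed

lemma y_cont: "continuous_on T y1" "continuous_on T y2" "continuous_on T y3"
proof -
  have "isCont y1 s \<and> isCont y2 s \<and> isCont y3 s" if s: "s \<in> T" for s
    unfolding isCont_def tendsto_iff dist_real_def
  proof (intro conjI allI impI)
    fix e :: real assume "0 < e"
    note ev = y_perturb[OF s this]
    show "\<forall>\<^sub>F x in at s. \<bar>y1 x - y1 s\<bar> < e" "\<forall>\<^sub>F x in at s. \<bar>y2 x - y2 s\<bar> < e"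
      "\<forall>\<^sub>F x in at s. \<bar>y3 x - y3 s\<bar> < e"
      by (rule eventually_mono[OF ev], simp)+
  qed
  then show "continuous_on T y1" "continuous_on T y2" "continuous_on T y3"
    by (auto intro: continuous_at_imp_continuous_on)
qed

lemma abs_coeff_bound:
  fixes e s s2 x :: real
  assumes "0 \<le> s" "s \<le> s2" "0 < x" "x \<le> 1"
  shows "s * e * x\<^sup>2 \<le> s2 * \<bar>e\<bar> * x"
proof -
  have "s * e * x\<^sup>2 \<le> s * \<bar>e\<bar> * x\<^sup>2" using assms by (intro mult_right_mono mult_left_mono) auto
  also have "\<dots> \<le> s2 * \<bar>e\<bar> * x"
    using power_decreasing[of 1 2 x] assms by (intro mult_mono) auto
  finally show ?thesis .
qed

lemma h_pos_near_0:
  assumes "0 < s" "0 < b" obtains x where "0 < x" "x < b" "0 < h s x"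
proof -
  define C where "C = \<gamma> * a2 + s * \<bar>c1 - \<gamma> * b2\<bar> + s * b1"
  have C: "0 < C" using pos assms by (auto simp: C_def intro!: add_pos_nonneg)
  define x where "x = min (b / 2) (min 1 (s * \<gamma> * c2 / (2 * C)))"
  have x: "0 < x" "x < b" "x \<le> 1" "x \<le> s * \<gamma> * c2 / (2 * C)" using assms C pos by (auto simp: x_def)
  have "x * C < s * \<gamma> * c2"
  proof -
    have "x * C \<le> s * \<gamma> * c2 / (2 * C) * C" using x C by (intro mult_right_mono) auto
    also have "\<dots> = s * \<gamma> * c2 / 2" using C by simp
    also have "\<dots> < s * \<gamma> * c2" using assms pos by simp
    finally show ?thesis .
  qed
  have eq: "x\<^sup>2 * h s x = s * \<gamma> * c2 + a1 * x ^ 3 - (\<gamma> * a2 * x + s * (c1 - \<gamma> * b2) * x\<^sup>2 + s * b1 * x ^ 4)"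
    using x by (simp add: h_def k_def field_simps power2_eq_square power4_eq_xxxx power3_eq_cube)
  have "\<gamma> * a2 * x + s * (c1 - \<gamma> * b2) * x\<^sup>2 + s * b1 * x ^ 4 \<le> \<gamma> * a2 * x + s * \<bar>c1 - \<gamma> * b2\<bar> * x + s * b1 * x"
  proof (intro add_mono order_refl abs_coeff_bound mult_left_mono)
    show "x ^ 4 \<le> x" using power_decreasing[of 1 4 x] x by simp
  qed (use pos assms x in auto)
  also have "\<dots> = x * C" by (simp add: C_def algebra_simps)
  finally have "0 < x\<^sup>2 * h s x" using eq \<open>x * C < s * \<gamma> * c2\<close> pos x by (smt (verit) mult_pos_pos zero_less_power)
  then have "0 < h s x" using x by (simp add: zero_less_mult_iff)
  then show thesis using that x by blast
qed

lemma root_upper_bound: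
  assumes s: "s1 \<le> s" "s \<le> s2" "0 < s1" and y: "1 \<le> y" "0 \<le> h s y"
  shows "y \<le> (a1 + s2 * (\<bar>c1 - \<gamma> * b2\<bar> + \<gamma> * c2)) / (s1 * b1)"
proof -
  have "0 \<le> y * h s y" using y by simp
  also have "y * h s y = a1 * y\<^sup>2 - \<gamma> * a2 - s * b1 * y ^ 3 - s * (c1 - \<gamma> * b2) * y + s * \<gamma> * c2 / y"
    using y by (simp add: h_def k_def field_simps power2_eq_square power3_eq_cube)
  also have "\<dots> \<le> a1 * y\<^sup>2 - s1 * b1 * y ^ 3 + s2 * \<bar>c1 - \<gamma> * b2\<bar> * y\<^sup>2 + s2 * \<gamma> * c2 * y\<^sup>2"
  proof -
    have y2: "y \<le> y\<^sup>2" "1 \<le> y\<^sup>2" using y by (auto simp: power2_eq_square intro: order_trans[OF y(1)])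
    have 1: "s1 * b1 * y ^ 3 \<le> s * b1 * y ^ 3" using s pos y by (intro mult_right_mono) auto
    have "- (s * (c1 - \<gamma> * b2)) * y \<le> (s2 * \<bar>c1 - \<gamma> * b2\<bar>) * y\<^sup>2"
    proof (rule mult_mono)
      have "- (s * (c1 - \<gamma> * b2)) \<le> s * \<bar>c1 - \<gamma> * b2\<bar>" using s by (metis abs_ge_minus_self less_le_trans less_imp_le minus_mult_right mult_left_mono)
      also have "\<dots> \<le> s2 * \<bar>c1 - \<gamma> * b2\<bar>" using s by (intro mult_right_mono) auto
      finally show "- (s * (c1 - \<gamma> * b2)) \<le> s2 * \<bar>c1 - \<gamma> * b2\<bar>" .
    qed (use y y2 s in auto)
    moreover have "s * \<gamma> * c2 / y \<le> s2 * \<gamma> * c2 * y\<^sup>2"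
    proof -
      have "s * \<gamma> * c2 / y \<le> s * \<gamma> * c2 / 1" using y s pos by (intro divide_left_mono) auto
      also have "\<dots> \<le> s2 * \<gamma> * c2 * 1" using s pos by (simp add: mult_right_mono)
      also have "\<dots> \<le> s2 * \<gamma> * c2 * y\<^sup>2" using y2 s pos by (intro mult_left_mono) auto
      finally show ?thesis .
    qed
    moreover have "0 < \<gamma> * a2" using pos by simp
    ultimately show ?thesis using 1 by (simp add: algebra_simps)
  qed
  also have "\<dots> = y\<^sup>2 * (a1 + s2 * (\<bar>c1 - \<gamma> * b2\<bar> + \<gamma> * c2) - s1 * b1 * y)"
    by (simp add: algebra_simps power2_eq_square power3_eq_cube)
  finally have "s1 * b1 * y \<le> a1 + s2 * (\<bar>c1 - \<gamma> * b2\<bar> + \<gamma> * c2)"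
    using y by (simp add: zero_le_mult_iff)
  then show ?thesis using s pos by (simp add: field_simps)
qed

lemma root_lower_bound:
  assumes s: "s1 \<le> s" "s \<le> s2" "0 < s1" and y: "0 < y" "y \<le> 1" "h s y \<le> 0"
  shows "s1 * \<gamma> * c2 / (\<gamma> * a2 + s2 * (\<bar>c1 - \<gamma> * b2\<bar> + b1)) \<le> y"
proof -
  have eq: "y\<^sup>2 * h s y = s * \<gamma> * c2 + a1 * y ^ 3 - (\<gamma> * a2 * y + s * (c1 - \<gamma> * b2) * y\<^sup>2 + s * b1 * y ^ 4)"
    using y by (simp add: h_def k_def field_simps power2_eq_square power4_eq_xxxx power3_eq_cube)
  have le0: "y\<^sup>2 * h s y \<le> 0" using y by (simp add: mult_le_0_iff)
  have "\<gamma> * a2 * y + s * (c1 - \<gamma> * b2) * y\<^sup>2 + s * b1 * y ^ 4 \<le> \<gamma> * a2 * y + s2 * \<bar>c1 - \<gamma> * b2\<bar> * y + s2 * b1 * y"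
  proof (intro add_mono order_refl abs_coeff_bound mult_mono)
    show "y ^ 4 \<le> y" using power_decreasing[of 1 4 y] y by simp
  qed (use pos s y in auto)
  moreover have "0 \<le> a1 * y ^ 3" "s1 * (\<gamma> * c2) \<le> s * (\<gamma> * c2)" using pos s y by (auto intro: mult_right_mono)
  ultimately have "s1 * \<gamma> * c2 \<le> y * (\<gamma> * a2 + s2 * (\<bar>c1 - \<gamma> * b2\<bar> + b1))"
    using eq le0 by (simp add: algebra_simps)
  moreover have "0 < \<gamma> * a2 + s2 * (\<bar>c1 - \<gamma> * b2\<bar> + b1)" using pos s by (intro add_pos_nonneg) auto
  ultimately show ?thesis by (simp add: pos_divide_le_eq)
qed

lemma h_neg_far:
  assumes "0 < s" obtains x where "b < x" "0 < x" "h s x < 0"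
proof -
  define x where "x = max (max b 1) ((a1 + s * (\<bar>c1 - \<gamma> * b2\<bar> + \<gamma> * c2)) / (s * b1)) + 1"
  have x: "b < x" "1 \<le> x" "(a1 + s * (\<bar>c1 - \<gamma> * b2\<bar> + \<gamma> * c2)) / (s * b1) < x" by (auto simp: x_def)
  then have "h s x < 0" using root_upper_bound[of s s s x] assms by force
  then show thesis using that x by auto
qed

text \<open>Subtracting the equations \<open>h s p = 0\<close> and \<open>h s r = 0\<close> and dividing by \<open>r - p\<close> leaves
\<open>s (p + r) (b1 + \<gamma> c2 / (p r)\<^sup>2) = a1 + \<gamma> a2 / (p r)\<close>. By the inequality of the means \<open>p + r\<close> is at
least \<open>2 R\<close> with \<open>R\<^sup>2 = p r\<close>, and then the equation bounds \<open>s\<close> independently of \<open>R\<close>.\<close>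

lemma T_bounded:
  assumes "s \<in> T" shows "s \<le> (a1 + \<gamma> * a2) / (2 * min b1 (\<gamma> * c2))"
proof -
  let ?p = "y1 s" and ?r = "y3 s"
  have t: "0 < ?p" "?p < ?r" "h s ?p = 0" "h s ?r = 0"
    using three_y[OF assms] by (auto simp: three_def)
  define R where "R = sqrt (?p * ?r)"
  define \<mu> where "\<mu> = min b1 (\<gamma> * c2)"
  have \<mu>: "0 < \<mu>" "\<mu> \<le> b1" "\<mu> \<le> \<gamma> * c2" using pos by (auto simp: \<mu>_def)
  have R: "0 < R" "R\<^sup>2 = ?p * ?r" using t by (auto simp: R_def)
  have AG: "2 * R \<le> ?p + ?r"
    using arith_geo_mean_sqrt[of ?p ?r] t by (simp add: R_def)
  have "(r - p) * (a1 + \<gamma> * a2 / (p * r) - s * (p + r) * (b1 + \<gamma> * c2 / (p * r)\<^sup>2)) = h s r - h s p"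
    if "0 < p" "0 < r" for p r
    using that by (simp add: h_def k_def field_simps power2_eq_square)
  from this[of ?p ?r] have eq: "s * (?p + ?r) * (b1 + \<gamma> * c2 / (R\<^sup>2)\<^sup>2) = a1 + \<gamma> * a2 / R\<^sup>2"
    using t unfolding R(2) by simp
  have "s * (2 * R) * (b1 + \<gamma> * c2 / (R\<^sup>2)\<^sup>2) \<le> s * (?p + ?r) * (b1 + \<gamma> * c2 / (R\<^sup>2)\<^sup>2)"
    using AG T_pos[OF assms] pos by (intro mult_right_mono mult_left_mono) auto
  then have "s * (2 * R) * (b1 + \<gamma> * c2 / (R\<^sup>2)\<^sup>2) * R ^ 3 \<le> (a1 + \<gamma> * a2 / R\<^sup>2) * R ^ 3"
    unfolding eq using R by (intro mult_right_mono) auto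
  moreover have "s * (2 * R) * (b1 + \<gamma> * c2 / (R\<^sup>2)\<^sup>2) * R ^ 3 = s * (2 * (b1 * R ^ 4 + \<gamma> * c2))"
    using R(1) by (simp add: field_simps power2_eq_square power4_eq_xxxx power3_eq_cube)
  moreover have "(a1 + \<gamma> * a2 / R\<^sup>2) * R ^ 3 = a1 * R ^ 3 + \<gamma> * a2 * R"
    using R(1) by (simp add: field_simps power2_eq_square power3_eq_cube)
  ultimately have 1: "s * (2 * (b1 * R ^ 4 + \<gamma> * c2)) \<le> a1 * R ^ 3 + \<gamma> * a2 * R" by (simp only:)
  have le: "R ^ i \<le> 1 + R ^ 4" if "i \<le> 4" for i
  proof (cases "R \<le> 1")
    case True
    then have "R ^ i \<le> 1" using R by (intro power_le_one) auto
    then show ?thesis using R zero_le_power[of R 4] by linarith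
  next
    case False
    then have "R ^ i \<le> R ^ 4" using that by (intro power_increasing) auto
    then show ?thesis by linarith
  qed
  have "s * (2 * (\<mu> * (1 + R ^ 4))) \<le> s * (2 * (b1 * R ^ 4 + \<gamma> * c2))"
    using T_pos[OF assms] \<mu> R by (intro mult_left_mono) (auto simp: algebra_simps intro!: add_mono mult_right_mono)
  also have "\<dots> \<le> a1 * (1 + R ^ 4) + \<gamma> * a2 * (1 + R ^ 4)"
    using 1 le[of 3] le[of 1] pos by (smt (verit) mult_left_mono mult_pos_pos one_le_numeral power_one_right numeral_le_iff semiring_norm)
  finally have "(1 + R ^ 4) * (s * (2 * \<mu>)) \<le> (1 + R ^ 4) * (a1 + \<gamma> * a2)" by (simp add: algebra_simps)
  then have "s * (2 * \<mu>) \<le> a1 + \<gamma> * a2"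
    using R(1) zero_less_power[OF R(1), of 4] by (simp only: mult_le_cancel_left_pos add_pos_pos zero_less_one)
  then show ?thesis using \<mu>(1) unfolding \<mu>_def[symmetric] by (simp add: field_simps)
qed

lemma root_bounds:
  assumes "0 < s1" "s1 \<le> s2"
  obtains l u where "0 < l" "\<And>s y. s1 \<le> s \<Longrightarrow> s \<le> s2 \<Longrightarrow> 0 < y \<Longrightarrow> h s y = 0 \<Longrightarrow> l \<le> y \<and> y \<le> u"
proof -
  let ?l = "s1 * \<gamma> * c2 / (\<gamma> * a2 + s2 * (\<bar>c1 - \<gamma> * b2\<bar> + b1))"
  let ?u = "(a1 + s2 * (\<bar>c1 - \<gamma> * b2\<bar> + \<gamma> * c2)) / (s1 * b1)"
  have "0 < ?l" using assms pos by (intro divide_pos_pos mult_pos_pos add_pos_nonneg) auto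
  show thesis
  proof (rule that[of "min 1 ?l" "max 1 ?u"])
    show "0 < min 1 ?l" using \<open>0 < ?l\<close> by simp
    fix s y assume s: "s1 \<le> s" "s \<le> s2" and y: "0 < y" "h s y = 0"
    have "min 1 ?l \<le> y"
    proof (cases "y \<le> 1")
      case True
      then show ?thesis using root_lower_bound[OF s assms(1) y(1) True] y(2) by (intro min.coboundedI2) simp
    qed simp
    moreover have "y \<le> max 1 ?u"
    proof (cases "1 \<le> y")
      case True
      then show ?thesis using root_upper_bound[OF s assms(1) True] y(2) by (intro max.coboundedI2) simp
    qed simp
    ultimately show "min 1 ?l \<le> y \<and> y \<le> max 1 ?u" by blast
  qed
qed

text \<open>At a positive end point of the interval of bistability two of the limits of the three zeros coincide, since
otherwise there would still be three zeros. Then the limit potential is strictly monotone between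
\<open>y2\<close> and the remaining saddle, so a point below both saddle levels can only converge to the limit of
\<open>y2\<close>: the orbits collapse to a point.\<close>

lemma saddle_centre_merge:
  fixes S X :: "nat \<Rightarrow> real"
  assumes S: "\<And>n. S n \<in> T" "S \<longlonglongrightarrow> e" "0 < e" "e \<notin> T" "\<And>n. e / 2 \<le> S n" "\<And>n. S n \<le> 2 * e"
    and X: "\<And>n. y1 (S n) \<le> X n" "\<And>n. X n \<le> y3 (S n)"
      "\<And>n. H (S n) (X n) \<le> H (S n) (y1 (S n))" "\<And>n. H (S n) (X n) \<le> H (S n) (y3 (S n))"
  obtains \<rho> x where "strict_mono \<rho>" "0 < x" "h e x = 0"
    "(\<lambda>n. X (\<rho> n)) \<longlonglongrightarrow> x" "(\<lambda>n. y2 (S (\<rho> n))) \<longlonglongrightarrow> x"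
proof -
  obtain l u where l: "0 < l"
    and lu: "\<And>s y. e / 2 \<le> s \<Longrightarrow> s \<le> 2 * e \<Longrightarrow> 0 < y \<Longrightarrow> h s y = 0 \<Longrightarrow> l \<le> y \<and> y \<le> u"
    using root_bounds[of "e / 2" "2 * e"] S(3) by auto
  have t: "three (S n) (y1 (S n)) (y2 (S n)) (y3 (S n))" for n by (rule three_y[OF S(1)])
  have b: "y1 (S n) \<in> {l..u}" "y2 (S n) \<in> {l..u}" "y3 (S n) \<in> {l..u}" for n
    using lu[OF S(5,6)] t[of n] by (auto simp: three_def)
  let ?f = "\<lambda>n. (y1 (S n), y2 (S n), y3 (S n), X n)"
  have mem: "\<forall>n. ?f n \<in> {l..u} \<times> {l..u} \<times> {l..u} \<times> {l..u}"
  proof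
    fix n
    have "l \<le> X n" "X n \<le> u" using b(1,3)[of n] X(1,2)[of n] by auto
    then show "?f n \<in> {l..u} \<times> {l..u} \<times> {l..u} \<times> {l..u}" using b[of n] by simp
  qed
  have "compact ({l..u} \<times> {l..u} \<times> {l..u} \<times> {l..u})" by (intro compact_Times) auto
  from this[unfolded compact_def, rule_format, OF mem[rule_format]]
  obtain z where z1: "z \<in> {l..u} \<times> {l..u} \<times> {l..u} \<times> {l..u}"
    and ex: "\<exists>\<rho>. strict_mono \<rho> \<and> (?f \<circ> \<rho>) \<longlonglongrightarrow> z" by (rule bexE)
  from ex obtain \<rho> where "strict_mono \<rho> \<and> (?f \<circ> \<rho>) \<longlonglongrightarrow> z" by (rule exE)
  note z = z1 conjunct1[OF this] conjunct2[OF this]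
  obtain p q r x where z_eq: "z = (p, q, r, x)" by (cases z)
  have lim: "(\<lambda>n. y1 (S (\<rho> n))) \<longlonglongrightarrow> p" "(\<lambda>n. y2 (S (\<rho> n))) \<longlonglongrightarrow> q" "(\<lambda>n. y3 (S (\<rho> n))) \<longlonglongrightarrow> r"
      "(\<lambda>n. X (\<rho> n)) \<longlonglongrightarrow> x"
    using tendsto_fst[OF z(3)] tendsto_fst[OF tendsto_snd[OF z(3)]]
      tendsto_fst[OF tendsto_snd[OF tendsto_snd[OF z(3)]]] tendsto_snd[OF tendsto_snd[OF tendsto_snd[OF z(3)]]]
    by (simp_all add: z_eq o_def)
  have limS: "(\<lambda>n. S (\<rho> n)) \<longlonglongrightarrow> e" using LIMSEQ_subseq_LIMSEQ[OF S(2) z(2)] by (simp add: o_def)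
  have pp: "0 < p" "0 < q" "0 < r" "0 < x" using z(1) l by (auto simp: z_eq)
  have o: "p \<le> q" "q \<le> r" "p \<le> x" "x \<le> r"
  proof -
    have le: "y1 (S n) \<le> y2 (S n)" "y2 (S n) \<le> y3 (S n)" for n
      using y_ord(2,3)[OF S(1)[of n]] by simp_all
    show "p \<le> q" by (rule LIMSEQ_le[OF lim(1,2)]) (simp add: le)
    show "q \<le> r" by (rule LIMSEQ_le[OF lim(2,3)]) (simp add: le)
    show "p \<le> x" by (rule LIMSEQ_le[OF lim(1,4)]) (simp add: X)
    show "x \<le> r" by (rule LIMSEQ_le[OF lim(4,3)]) (simp add: X)
  qed
  have cmp: "(\<lambda>n. g (S (\<rho> n)) (v n)) \<longlonglongrightarrow> g e w"
    if "continuous_on (UNIV \<times> {0<..}) (\<lambda>(s, y). g s y)" "v \<longlonglongrightarrow> w" "0 < w" "\<And>n. 0 < v n"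
    for g :: "real \<Rightarrow> real \<Rightarrow> real" and v w
    using continuous_on_tendsto_compose[OF that(1) tendsto_Pair[OF limS that(2)]] that(3,4) by simp
  have vpos: "0 < y1 (S n)" "0 < y2 (S n)" "0 < y3 (S n)" "0 < X n" for n
    using t[of n] X(1)[of n] by (auto simp: three_def)
  have zero: "h e w = 0" if "v \<longlonglongrightarrow> w" "0 < w" "\<And>n. 0 < v n" "\<And>n. h (S (\<rho> n)) (v n) = 0" for v w
    using cmp[OF h_cont that(1-3)] that(4) by (simp add: LIMSEQ_const_iff)
  have roots: "h e p = 0" "h e q = 0" "h e r = 0"
    using zero[OF lim(1) pp(1) vpos(1)] zero[OF lim(2) pp(2) vpos(2)] zero[OF lim(3) pp(3) vpos(3)] t
    by (simp_all add: three_def)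
  have fac: "h e y = e * b1 * (y + eta p q r) / y\<^sup>2 * ((y - p) * (y - q) * (r - y))" if "0 < y" for y
  proof -
    let ?g = "\<lambda>s p q r. s * b1 * (y + eta p q r) / y\<^sup>2 * ((y - p) * (y - q) * (r - y))"
    have "(\<lambda>n. ?g (S (\<rho> n)) (y1 (S (\<rho> n))) (y2 (S (\<rho> n))) (y3 (S (\<rho> n)))) \<longlonglongrightarrow> ?g e p q r"
      unfolding eta_def using pp pos that by (intro tendsto_intros lim limS) auto
    moreover have "(\<lambda>n. h (S (\<rho> n)) y) \<longlonglongrightarrow> h e y"
      unfolding h_def by (intro tendsto_intros limS)
    ultimately show ?thesis
      using h_factor[OF t that] by (simp add: LIMSEQ_unique)
  qed
  have C: "0 < e * b1 * (y + eta p q r) / y\<^sup>2" if "0 < y" for y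
    using that S(3) pos pp by (intro divide_pos_pos mult_pos_pos add_pos_pos) (auto simp: eta_def)
  have Hle: "H e x \<le> H e p" "H e x \<le> H e r"
  proof -
    note c = cmp[OF H_cont lim(4) pp(4) vpos(4)] cmp[OF H_cont lim(1) pp(1) vpos(1)]
      cmp[OF H_cont lim(3) pp(3) vpos(3)]
    show "H e x \<le> H e p" by (rule LIMSEQ_le[OF c(1,2)]) (simp add: X)
    show "H e x \<le> H e r" by (rule LIMSEQ_le[OF c(1,3)]) (simp add: X)
  qed
  have Hd: "continuous_on {v..w} (H e)" if "0 < v" for v w
    by (rule continuous_on_slice[OF H_cont]) (use that in auto)
  have "p = q \<or> q = r"
  proof (rule ccontr)
    assume "\<not> (p = q \<or> q = r)"
    then have "three e p q r" using o pp roots by (simp add: three_def)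
    then show False using S(3,4) by (auto simp: T_def)
  qed
  then have "x = q"
  proof
    assume pq: "p = q"
    show "x = q"
    proof (rule ccontr)
      assume "x \<noteq> q"
      then have less: "q < x" using o pq by simp
      have "H e q < H e x"
      proof (rule DERIV_pos_imp_increasing_open[OF less _ Hd[OF pp(2)]])
        fix y assume y: "q < y" "y < x"
        then have y0: "0 < y" using pp by simp
        have "0 < (y - p) * (y - q) * (r - y)" using y o pq by simp
        then have "0 < h e y * zp y"
          unfolding fac[OF y0] by (rule mult_pos_pos[OF mult_pos_pos[OF C[OF y0]] zp_pos[OF y0]])
        then show "\<exists>d. (H e has_real_derivative d) (at y) \<and> 0 < d" using H_deriv[OF y0] by blast
      qed
      then show False using Hle pq by simp
    qed
  next
    assume qr: "q = r"
    show "x = q"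
    proof (rule ccontr)
      assume "x \<noteq> q"
      then have less: "x < q" using o qr by simp
      have "H e q < H e x"
      proof (rule DERIV_neg_imp_decreasing_open[OF less _ Hd[OF pp(4)]])
        fix y assume y: "x < y" "y < q"
        then have y0: "0 < y" using pp by simp
        have "(y - p) * (y - q) * (r - y) < 0" using y o qr by (intro mult_neg_pos mult_pos_neg) auto
        then have "h e y * zp y < 0"
          unfolding fac[OF y0] by (rule mult_neg_pos[OF mult_pos_neg[OF C[OF y0]] zp_pos[OF y0]])
        then show "\<exists>d. (H e has_real_derivative d) (at y) \<and> d < 0" using H_deriv[OF y0] by blast
      qed
      then show False using Hle qr by simp
    qed
  qed
  then show thesis using that[OF z(2) pp(2) roots(2)] lim by simp
qed

end

section \<open>The interval of bistability around the constant solution\<close>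

text \<open>The constant solution is \<open>u = ss ys\<close>, \<open>v = ss / ys\<close>. The assumption \<open>unstable\<close> amounts to the positivity of
the discriminant \<open>D\<close>, as its left side is a positive multiple of the numerator of \<open>d\<^sup>(\<^sup>j\<^sup>)\<close>.\<close>

locale skt_equilibrium = skt_limit +
  fixes ss ys :: real
  assumes ss: "0 < ss" and ys: "0 < ys"
    and eq1: "a1 * ys = ss * (b1 * ys\<^sup>2 + c1)" and eq2: "a2 * ys = ss * (b2 * ys\<^sup>2 + c2)"
    and unstable: "0 < c1 + \<gamma> * b2 - b1 * ys\<^sup>2 - \<gamma> * c2 / ys\<^sup>2"
    and nondeg: "a2 * b1 \<noteq> a1 * b2"
begin

text \<open>Positive for weak and negative for strong competition.\<close>

definition \<kappa>0 :: real where "\<kappa>0 = a2 * b1 - a1 * b2"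

text \<open>The continuous extension of \<open>h ss y / (y - ys)\<close> to \<open>y = ys\<close>.\<close>

definition qf :: "real \<Rightarrow> real" where
  "qf y = a1 + \<gamma> * a2 / (y * ys) - ss * (ys + y) * (b1 + \<gamma> * c2 / (y\<^sup>2 * ys\<^sup>2))"

lemma a1_eq: "a1 = ss * (b1 * ys + c1 / ys)" and a2_eq: "a2 = ss * (b2 * ys + c2 / ys)"
  using eq1 eq2 ys by (simp_all add: field_simps power2_eq_square)

lemma \<kappa>0_eq: "\<kappa>0 * ys\<^sup>2 = a1 * c2 - a2 * c1"
proof -
  have "ys * (\<kappa>0 * ys\<^sup>2) = ys * (a1 * c2 - a2 * c1)"
    using eq1 eq2 unfolding \<kappa>0_def by algebra
  then show ?thesis using ys by simp
qed

lemma h_qf: "0 < y \<Longrightarrow> h ss y = (y - ys) * qf y"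
  unfolding h_def k_def qf_def unfolding a1_eq a2_eq using ys
  by (simp add: field_simps power2_eq_square)

text \<open>The slope of \<open>h ss\<close> at the constant solution, which makes that solution a centre.\<close>

lemma qf_ys: "0 < qf ys"
proof -
  have "ys * qf ys = ss * (c1 + \<gamma> * b2 - b1 * ys\<^sup>2 - \<gamma> * c2 / ys\<^sup>2)"
    unfolding qf_def unfolding a1_eq a2_eq using ys by (simp add: field_simps power2_eq_square)
  also have "0 < \<dots>" using unstable ss by simp
  finally show ?thesis using ys by (simp add: zero_less_mult_iff)
qed

lemma qf_cont: "continuous_on {0<..} qf"
  unfolding qf_def[abs_def] using ys by (intro continuous_intros) auto

text \<open>In this combination of \<open>f\<close> and \<open>h\<close> the terms with \<open>s\<close> cancel. At a zero of \<open>h s\<close> it ties the signs of \<open>fh\<close> and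
\<open>k\<close> to the position of \<open>y\<close> relative to \<open>ys\<close>.\<close>

lemma k_fh: "0 < y \<Longrightarrow> k y * fh s y - (b1 * y\<^sup>2 + c1) * h s y = \<gamma> * \<kappa>0 * (y\<^sup>2 - ys\<^sup>2) / y"
proof -
  assume y: "0 < y"
  have "k y * fh s y - (b1 * y\<^sup>2 + c1) * h s y = \<gamma> * (\<kappa>0 * y\<^sup>2 - (a1 * c2 - a2 * c1)) / y"
    using y by (simp add: k_def fh_def h_def \<kappa>0_def field_simps power2_eq_square)
  then show ?thesis unfolding \<kappa>0_eq[symmetric] by (simp add: algebra_simps)
qed

text \<open>The basic identity: at every zero of \<open>h s\<close>, the sign of \<open>fh\<close> is that of \<open>\<kappa>0 (s - ss)\<close> as long as \<open>qf\<close> is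
positive. It results from the two equations \<open>(y - ys) qf y = (s - ss) k y\<close> and
\<open>fh s y = (y - ys) (a1 - ss b1 (y + ys)) - (s - ss) (b1 y\<^sup>2 + c1)\<close> by eliminating \<open>y - ys\<close>; the factor that
remains is a multiple of \<open>\<kappa>0\<close>.\<close>

lemma qf_fh:
  assumes y: "0 < y" and root: "h s y = 0"
  shows "qf y * fh s y = (s - ss) * (\<gamma> * \<kappa>0 * (y + ys) / y)"
proof -
  have h: "(y - ys) * qf y = (s - ss) * k y"
    using root h_qf[OF y] by (simp add: h_def algebra_simps)
  have fh: "fh s y = (y - ys) * (a1 - ss * b1 * (y + ys)) - (s - ss) * (b1 * y\<^sup>2 + c1)"
    using eq1 by (simp add: fh_def algebra_simps power2_eq_square)
  have id: "k y * (a1 - ss * b1 * (y + ys)) - (b1 * y\<^sup>2 + c1) * qf y = \<gamma> * \<kappa>0 * (y + ys) / y"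
    unfolding k_def qf_def \<kappa>0_def unfolding a1_eq a2_eq using y ys
    by (simp add: field_simps power2_eq_square)
  have "qf y * fh s y = ((y - ys) * qf y) * (a1 - ss * b1 * (y + ys)) - (s - ss) * (b1 * y\<^sup>2 + c1) * qf y"
    unfolding fh by (simp add: algebra_simps)
  also have "\<dots> = (s - ss) * (k y * (a1 - ss * b1 * (y + ys)) - (b1 * y\<^sup>2 + c1) * qf y)"
    unfolding h by (simp add: algebra_simps)
  finally show ?thesis unfolding id .
qed

text \<open>Around \<open>ys\<close> the sign changes from minus to plus, while \<open>h ss\<close> is positive near \<open>0\<close> and negative far out.\<close>

lemma three_ss: "\<exists>p r. three ss p ys r"
proof -
  have "isCont qf ys" using qf_cont ys by (simp add: continuous_on_eq_continuous_at)
  then have "\<forall>\<^sub>F y in at ys. 0 < qf y" using qf_ys unfolding isCont_def by (rule order_tendstoD(1))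
  then obtain d where d: "0 < d" "\<And>y. y \<noteq> ys \<Longrightarrow> dist y ys < d \<Longrightarrow> 0 < qf y"
    unfolding eventually_at by auto
  define e where "e = min d ys / 2"
  have e: "0 < e" "e < d" "e < ys" using d ys by (auto simp: e_def)
  have q: "0 < qf (ys - e)" "0 < qf (ys + e)" using e by (auto intro!: d(2) simp: dist_real_def)
  have m: "h ss (ys - e) < 0" "0 < h ss (ys + e)"
    using h_qf[of "ys - e"] h_qf[of "ys + e"] e q ys by (simp_all add: mult_neg_pos)
  obtain x0 where x0: "0 < x0" "x0 < ys - e" "0 < h ss x0"
    using h_pos_near_0[OF ss, of "ys - e"] e by auto
  obtain x3 where x3: "ys + e < x3" "h ss x3 < 0" using h_neg_far[OF ss, of "ys + e"] by auto
  obtain p where "x0 < p" "p < ys - e" "h ss p = 0" using h_IVT_down[OF x0(1,2,3) m(1)] .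
  moreover obtain r where "ys + e < r" "r < x3" "h ss r = 0"
    using h_IVT_down[of "ys + e" x3 ss] e ys x3 m by auto
  moreover have "h ss ys = 0" using h_qf[OF ys] by simp
  ultimately show ?thesis using e x0 ys by (intro exI[of _ p] exI[of _ r]) (auto simp: three_def)
qed

lemma ss_T: "ss \<in> T" using three_ss ss by (auto simp: T_def)

lemma y2_ss: "y2 ss = ys" using three_ss y_eq ss by blast

text \<open>A maximal interval of bistability around \<open>ss\<close>.\<close>

definition interv :: "real \<Rightarrow> real \<Rightarrow> bool" where
  "interv sa sb \<longleftrightarrow> 0 \<le> sa \<and> sa < ss \<and> ss < sb \<and> {sa<..<sb} \<subseteq> T \<and> sa \<notin> T \<and> sb \<notin> T"

lemma interv_exists: "\<exists>sa sb. interv sa sb"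
  using open_interval_component[OF T_open ss_T less_imp_le[OF T_pos] T_bounded]
  unfolding interv_def by metis

text \<open>A common zero of \<open>h s\<close> and \<open>fh s\<close> is a constant solution, and \<open>ss\<close> is the only value of \<open>s\<close> with one.\<close>

lemma root_not_fh:
  assumes "0 < y" "h s y = 0" "s \<noteq> ss" shows "fh s y \<noteq> 0" "qf y \<noteq> 0"
proof -
  have "\<gamma> * \<kappa>0 * (y + ys) / y \<noteq> 0" using pos nondeg assms ys by (simp add: \<kappa>0_def)
  then have "qf y * fh s y \<noteq> 0" using qf_fh[OF assms(1,2)] assms(3) by simp
  then show "fh s y \<noteq> 0" "qf y \<noteq> 0" by auto
qed

text \<open>Along the branch of centres \<open>qf\<close> cannot vanish, by \<open>qf_fh\<close>, and it is positive at \<open>s = ss\<close>.\<close>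

lemma qf_y2:
  assumes iv: "interv sa sb" and s: "s \<in> {sa<..<sb}"
  shows "0 < qf (y2 s)"
proof (rule nonvanishing_same_sign[OF _ _ _ _ s])
  have T: "{sa<..<sb} \<subseteq> T" using iv by (simp add: interv_def)
  have p: "0 < y2 s" if "s \<in> {sa<..<sb}" for s using y_ord[of s] T that by fastforce
  show "continuous_on {sa<..<sb} (\<lambda>s. qf (y2 s))"
    using p by (intro continuous_on_compose2[OF qf_cont continuous_on_subset[OF y_cont(2) T]]) auto
  show "ss \<in> {sa<..<sb}" "0 < qf (y2 ss)" using iv qf_ys by (auto simp: interv_def y2_ss)
  fix s assume s: "s \<in> {sa<..<sb}"
  show "qf (y2 s) \<noteq> 0"
  proof (cases "s = ss")
    case False
    have "h s (y2 s) = 0" using three_y T s by (auto simp: three_def)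
    then show ?thesis using root_not_fh[OF p[OF s] _ False] by simp
  qed (use qf_ys y2_ss in simp)
qed

lemma y2_between:
  assumes iv: "interv sa sb" and s: "s \<in> {sa<..<sb}"
  shows "y1 ss < y2 s" "y2 s < y3 ss"
proof -
  have T: "s \<in> T" using iv s by (auto simp: interv_def)
  have p: "0 < y2 s" using y_ord[OF T] by simp
  note sg = h_sign[OF three_y[OF ss_T] ss p, unfolded y2_ss]
  have q: "0 < qf (y2 s)" by (rule qf_y2[OF iv s])
  show "y1 ss < y2 s"
  proof (rule ccontr)
    assume n: "\<not> y1 ss < y2 s"
    then have "0 \<le> h ss (y2 s)"
      using sg(1) three_y[OF ss_T] by (cases "y2 s = y1 ss") (auto simp: three_def)
    moreover have "y2 s < ys" using n y_ord[OF ss_T] by (simp add: y2_ss)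
    then have "h ss (y2 s) < 0" using h_qf[OF p] q by (simp add: mult_neg_pos)
    ultimately show False by simp
  qed
  show "y2 s < y3 ss"
  proof (rule ccontr)
    assume n: "\<not> y2 s < y3 ss"
    then have "h ss (y2 s) \<le> 0"
      using sg(4) three_y[OF ss_T] by (cases "y2 s = y3 ss") (auto simp: three_def)
    moreover have "ys < y2 s" using n y_ord[OF ss_T] by (simp add: y2_ss)
    then have "0 < h ss (y2 s)" using h_qf[OF p] q by simp
    ultimately show False by simp
  qed
qed

lemma fh_y2_sign:
  assumes iv: "interv sa sb" and s: "s \<in> {sa<..<sb}" "s \<noteq> ss"
  shows "0 < \<kappa>0 * (s - ss) * fh s (y2 s)"
proof -
  have T: "s \<in> T" using iv s by (auto simp: interv_def)
  have p: "0 < y2 s" using y_ord[OF T] by simp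
  have "h s (y2 s) = 0" using three_y[OF T] by (simp add: three_def)
  note id = qf_fh[OF p this]
  have "qf (y2 s) * (\<kappa>0 * (s - ss) * fh s (y2 s)) = (\<kappa>0 * (s - ss))\<^sup>2 * (\<gamma> * (y2 s + ys) / y2 s)"
  proof -
    have "qf (y2 s) * (\<kappa>0 * (s - ss) * fh s (y2 s)) = \<kappa>0 * (s - ss) * (qf (y2 s) * fh s (y2 s))"
      by (simp only: mult_ac)
    then show ?thesis unfolding id by (simp add: power2_eq_square mult_ac)
  qed
  moreover have "0 < (\<kappa>0 * (s - ss))\<^sup>2 * (\<gamma> * (y2 s + ys) / y2 s)"
    using s(2) nondeg pos p ys by (intro mult_pos_pos divide_pos_pos) (auto simp: \<kappa>0_def)
  ultimately show ?thesis using qf_y2[OF iv s(1)] by (metis zero_less_mult_pos)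
qed

text \<open>For \<open>s < ss\<close> the number \<open>fh s (y2 s)\<close> is negative in the weak case, which bounds \<open>s\<close> from below in
terms of \<open>y2 s\<close>; and \<open>y2 s\<close> stays between the saddles for \<open>s = ss\<close>.\<close>

lemma weak_sa_pos:
  assumes iv: "interv sa sb" and weak: "0 < \<kappa>0"
  shows "0 < sa"
proof -
  define m where "m = a1 * y1 ss / (b1 * (y3 ss)\<^sup>2 + c1)"
  have y1p: "0 < y1 ss" using y_ord[OF ss_T] by simp
  have m: "0 < m" using y1p pos by (simp add: m_def add_nonneg_pos)
  have lb: "m \<le> s" if s: "sa < s" "s < ss" for s
  proof -
    have sI: "s \<in> {sa<..<sb}" using s iv by (auto simp: interv_def)
    then have sT: "s \<in> T" using iv by (auto simp: interv_def)
    have "fh s (y2 s) < 0"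
      using fh_y2_sign[OF iv sI] s weak by (simp add: zero_less_mult_iff)
    then have 1: "a1 * y2 s < s * (b1 * (y2 s)\<^sup>2 + c1)" by (simp add: fh_def)
    note b = y2_between[OF iv sI]
    have "a1 * y1 ss \<le> a1 * y2 s" using b pos by simp
    also have "\<dots> \<le> s * (b1 * (y2 s)\<^sup>2 + c1)" using 1 by simp
    also have "\<dots> \<le> s * (b1 * (y3 ss)\<^sup>2 + c1)"
      using b y1p pos T_pos[OF sT] by (intro mult_left_mono add_right_mono power_mono) auto
    finally show ?thesis unfolding m_def using pos by (simp add: divide_le_eq add_nonneg_pos)
  qed
  have "m \<le> sa"
  proof (rule ccontr)
    assume "\<not> m \<le> sa"
    moreover have "sa < ss" using iv by (simp add: interv_def)
    ultimately obtain s where "sa < s" "s < min m ss" using dense[of sa "min m ss"] by auto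
    then show False using lb[of s] by simp
  qed
  then show ?thesis using m by simp
qed

text \<open>If \<open>k (y1 ss) < 0\<close> failed, \<open>k\<close> would vanish somewhere below \<open>y1 ss\<close>; there \<open>h ss\<close> is positive, but \<open>k_fh\<close>
makes it negative. The upper saddle is treated in the same way, and the signs of \<open>fh\<close> follow from
\<open>k_fh\<close> at the saddles.\<close>

lemma strong_k:
  assumes strong: "\<kappa>0 < 0"
  shows "k (y1 ss) < 0" "0 < k (y3 ss)" "fh ss (y1 ss) < 0" "fh ss (y3 ss) < 0"
proof -
  let ?p = "y1 ss" and ?r = "y3 ss"
  have o: "0 < ?p" "?p < ys" "ys < ?r" using y_ord[OF ss_T] by (auto simp: y2_ss)
  have r: "h ss ?p = 0" "h ss ?r = 0" using three_y[OF ss_T] by (auto simp: three_def)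
  note sg = h_sign[OF three_y[OF ss_T] ss]
  have sgn: "0 < \<gamma> * \<kappa>0 * (y\<^sup>2 - ys\<^sup>2) / y" if "0 < y" "y < ys" for y
  proof -
    have "y\<^sup>2 < ys\<^sup>2" using that by (intro power_strict_mono) auto
    then show ?thesis using that strong pos by (intro divide_pos_pos mult_neg_neg mult_pos_neg) auto
  qed
  have sgn': "\<gamma> * \<kappa>0 * (y\<^sup>2 - ys\<^sup>2) / y < 0" if "ys < y" for y
  proof -
    have "ys\<^sup>2 < y\<^sup>2" using that ys by (intro power_strict_mono) auto
    then show ?thesis using that strong pos ys by (intro divide_neg_pos mult_neg_pos mult_pos_neg) auto
  qed
  have kc: "continuous_on {0<..} k" unfolding k_def[abs_def] by (intro continuous_intros) auto
  have kfp: "0 < k ?p * fh ss ?p" using k_fh[OF o(1), of ss] r(1) sgn[OF o(1,2)] by simp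
  have kfr: "k ?r * fh ss ?r < 0" using k_fh[of ?r ss] r(2) sgn'[OF o(3)] o by simp
  show kp: "k ?p < 0"
  proof (rule ccontr)
    assume "\<not> k ?p < 0"
    have "\<exists>x. 0 < x \<and> x < ?p \<and> k x < 0"
    proof -
      define x where "x = min (?p / 2) (min 1 (\<gamma> * c2 / (2 * (b1 + c1))))"
      have x: "0 < x" "x < ?p" "x \<le> 1" "x \<le> \<gamma> * c2 / (2 * (b1 + c1))" using o pos by (auto simp: x_def)
      have "x\<^sup>2 * k x = b1 * x ^ 4 + c1 * x\<^sup>2 - \<gamma> * b2 * x\<^sup>2 - \<gamma> * c2"
        using x by (simp add: k_def field_simps power2_eq_square power4_eq_xxxx)
      also have "\<dots> \<le> b1 * x + c1 * x - \<gamma> * c2"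
      proof -
        have "x ^ 4 \<le> x" "x\<^sup>2 \<le> x"
          using power_decreasing[of 1 2 x] power_decreasing[of 1 4 x] x by simp_all
        then have "b1 * x ^ 4 \<le> b1 * x" "c1 * x\<^sup>2 \<le> c1 * x"
          using pos by (simp_all only: mult_left_mono less_imp_le)
        moreover have "0 \<le> \<gamma> * b2 * x\<^sup>2" using pos by simp
        ultimately show ?thesis by linarith
      qed
      also have "\<dots> = x * (b1 + c1) - \<gamma> * c2" by (simp add: algebra_simps)
      also have "\<dots> \<le> \<gamma> * c2 / (2 * (b1 + c1)) * (b1 + c1) - \<gamma> * c2"
        using x pos by (intro diff_right_mono mult_right_mono) auto
      also have "\<dots> = \<gamma> * c2 / 2 - \<gamma> * c2" using pos by (simp add: field_simps)
      also have "\<dots> < 0" using pos by simp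
      finally have "x\<^sup>2 * k x < 0" .
      then show ?thesis using x by (auto simp: mult_less_0_iff)
    qed
    then obtain x where x: "0 < x" "x < ?p" "k x < 0" by blast
    \<comment> \<open>\<open>k\<close> vanishes below \<open>y1 ss\<close>\<close>
  have "continuous_on {x..?p} k" using x by (intro continuous_on_subset[OF kc]) auto
    then obtain y where y: "x \<le> y" "y \<le> ?p" "k y = 0"
      using IVT'[of k x 0 ?p] x \<open>\<not> k ?p < 0\<close> by auto
    have "y \<noteq> ?p" using y(3) kfp by auto
    then have y': "0 < y" "y < ?p" using x y by auto
    have "0 < h ss y" by (rule sg(1)[OF y'])
    moreover have "0 < - ((b1 * y\<^sup>2 + c1) * h ss y)"
      using k_fh[OF y'(1), of ss] y(3) sgn[of y] y' o by simp
    moreover have "0 < b1 * y\<^sup>2 + c1" using pos by (intro add_nonneg_pos) auto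
    ultimately show False using mult_pos_pos[of "b1 * y\<^sup>2 + c1" "h ss y"] by linarith
  qed
  show kr: "0 < k ?r"
  proof (rule ccontr)
    assume "\<not> 0 < k ?r"
    define x where "x = ?r + 1 + (\<gamma> * b2 + \<gamma> * c2) / b1"
    have x: "?r < x" "1 \<le> x" "(\<gamma> * b2 + \<gamma> * c2) / b1 \<le> x"
      using o pos by (auto simp: x_def add_pos_pos intro!: add_pos_nonneg)
    have "0 < k x"
    proof -
      have "\<gamma> * b2 + \<gamma> * c2 \<le> b1 * x" using x(3) pos by (simp add: field_simps)
      also have "\<dots> \<le> b1 * x\<^sup>2" using x pos by (simp add: power2_eq_square)
      finally have 1: "\<gamma> * b2 + \<gamma> * c2 \<le> b1 * x\<^sup>2" .
      have "1 \<le> x\<^sup>2" using x(2) by simp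
      then have "\<gamma> * c2 / x\<^sup>2 \<le> \<gamma> * c2 / 1" using pos by (intro divide_left_mono) auto
      then show ?thesis using 1 pos unfolding k_def by simp
    qed
    have "continuous_on {?r..x} k" using o by (intro continuous_on_subset[OF kc]) auto
    then obtain y where y: "?r \<le> y" "y \<le> x" "k y = 0"
      using IVT'[of k ?r 0 x] x \<open>0 < k x\<close> \<open>\<not> 0 < k ?r\<close> by auto
    have "y \<noteq> ?r" using y(3) kfr by auto
    then have y': "0 < y" "?r < y" using y o by auto
    have "h ss y < 0" by (rule sg(4)[OF y'])
    moreover have "- ((b1 * y\<^sup>2 + c1) * h ss y) < 0"
      using k_fh[OF y'(1), of ss] y(3) sgn'[of y] y' o by simp
    moreover have "0 < b1 * y\<^sup>2 + c1" using pos by (intro add_nonneg_pos) auto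
    ultimately show False using mult_pos_neg[of "b1 * y\<^sup>2 + c1" "h ss y"] by linarith
  qed
  show "fh ss ?p < 0" using kp kfp by (simp add: zero_less_mult_iff)
  show "fh ss ?r < 0" using kr kfr by (simp add: mult_less_0_iff)
qed

text \<open>Decreasing \<open>s\<close> lowers \<open>h\<close> at \<open>y1 ss\<close> and raises it at \<open>y3 ss\<close>, so the four alternating signs remain.\<close>

lemma strong_T:
  assumes strong: "\<kappa>0 < 0" and s: "0 < s" "s < ss"
  shows "s \<in> T"
proof -
  let ?p = "y1 ss" and ?r = "y3 ss"
  have o: "0 < ?p" "?p < ?r" using y_ord[OF ss_T] by auto
  have eq: "h s y = h ss y + (ss - s) * k y" for y by (simp add: h_def algebra_simps)
  have r: "h ss ?p = 0" "h ss ?r = 0" using three_y[OF ss_T] by (auto simp: three_def)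
  have m: "h s ?p < 0" "0 < h s ?r"
    using strong_k(1,2)[OF strong] s by (simp_all add: eq r mult_pos_neg)
  obtain x0 where x0: "0 < x0" "x0 < ?p" "0 < h s x0" using h_pos_near_0[OF s(1) o(1)] .
  obtain x3 where x3: "?r < x3" "h s x3 < 0" using h_neg_far[OF s(1), of ?r] by auto
  obtain p where p: "x0 < p" "p < ?p" "h s p = 0" using h_IVT_down[OF x0(1,2,3) m(1)] .
  obtain q where q: "?p < q" "q < ?r" "h s q = 0" using h_IVT_up[OF o m] .
  obtain r where r: "?r < r" "r < x3" "h s r = 0" using h_IVT_down[of ?r x3 s] o x3 m by auto
  have "three s p q r" using p q r x0 by (auto simp: three_def)
  then show ?thesis using s by (auto simp: T_def)
qed

lemma strong_sa:
  assumes iv: "interv sa sb" and strong: "\<kappa>0 < 0" shows "sa = 0"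
  using strong_T[OF strong, of sa] iv unfolding interv_def by linarith

lemma strong_fh_saddles:
  assumes iv: "interv sa sb" and strong: "\<kappa>0 < 0" and s: "s \<in> {sa<..<sb}"
  shows "fh s (y1 s) < 0" "fh s (y3 s) < 0"
proof -
  have T: "{sa<..<sb} \<subseteq> T" and ssI: "ss \<in> {sa<..<sb}" using iv by (auto simp: interv_def)
  have *: "0 < - fh s (y s)"
    if c: "continuous_on T y" and y: "\<And>s. s \<in> T \<Longrightarrow> 0 < y s \<and> h s (y s) = 0" and n: "fh ss (y ss) < 0" for y
  proof (rule nonvanishing_same_sign[OF _ _ ssI _ s])
    show "continuous_on {sa<..<sb} (\<lambda>s. - fh s (y s))"
      using continuous_on_subset[OF c T] unfolding fh_def by (intro continuous_intros)
    show "0 < - fh ss (y ss)" using n by simp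
    fix s assume "s \<in> {sa<..<sb}"
    then have "s \<in> T" using T by blast
    then show "- fh s (y s) \<noteq> 0"
      using n root_not_fh(1)[of "y s" s] y[of s] by (cases "s = ss") auto
  qed
  have r: "0 < y1 s \<and> h s (y1 s) = 0" "0 < y3 s \<and> h s (y3 s) = 0" if "s \<in> T" for s
    using three_y[OF that] by (auto simp: three_def)
  show "fh s (y1 s) < 0" using *[OF y_cont(1) r(1) strong_k(3)[OF strong]] by simp
  show "fh s (y3 s) < 0" using *[OF y_cont(3) r(2) strong_k(4)[OF strong]] by simp
qed

end

section \<open>From orbits to solutions of the limiting system\<close>

text \<open>From here on \<open>s\<close> ranges over the interval of bistability, where the family of potentials is of the
form treated above.\<close>

locale skt_interval = skt_equilibrium +
  fixes sa sb :: real
  assumes iv: "interv sa sb"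
begin

text \<open>The positive factor that is left of the derivative of \<open>H s\<close> after splitting off its three zeros.\<close>

definition nn :: "real \<Rightarrow> real \<Rightarrow> real" where
  "nn s y = s * b1 * (y + eta (y1 s) (y2 s) (y3 s)) / y\<^sup>2 * zp y"

lemma I_T: "s \<in> {sa<..<sb} \<Longrightarrow> s \<in> T" using iv by (auto simp: interv_def)

lemma I_sub: "{sa<..<sb} \<subseteq> T" using I_T by blast

lemma I_pos: "s \<in> {sa<..<sb} \<Longrightarrow> 0 < s" using I_T T_pos by blast

lemma ss_I: "ss \<in> {sa<..<sb}" using iv by (simp add: interv_def)

lemma eta_pos: "s \<in> T \<Longrightarrow> 0 < eta (y1 s) (y2 s) (y3 s)"
  using y_ord[of s] pos by (simp add: eta_def)

lemma eta_cont: "continuous_on T (\<lambda>s. eta (y1 s) (y2 s) (y3 s))"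
  unfolding eta_def using y_ord pos by (intro continuous_intros y_cont) force+

lemma force_factor:
  assumes "s \<in> {sa<..<sb}" "0 < y"
  shows "(y - y2 s) * ((y - y1 s) * (y3 s - y) * nn s y) = h s y * zp y"
  unfolding h_factor[OF three_y[OF I_T[OF assms(1)]] assms(2)] nn_def by (simp add: mult_ac)

sublocale B: bistable_family "{sa<..<sb}" y1 y2 y3 nn H zp
proof
  show "open {sa<..<sb}" by simp
  show "continuous_on {sa<..<sb} y1" "continuous_on {sa<..<sb} y2" "continuous_on {sa<..<sb} y3"
    by (rule continuous_on_subset[OF y_cont(1) I_sub], rule continuous_on_subset[OF y_cont(2) I_sub],
        rule continuous_on_subset[OF y_cont(3) I_sub])
  show "0 < y1 s" "y1 s < y2 s" "y2 s < y3 s" if "s \<in> {sa<..<sb}" for s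
    using y_ord[OF I_T[OF that]] by auto
  show "continuous_on ({sa<..<sb} \<times> {0<..}) (\<lambda>(s, y). nn s y)"
  proof -
    have "continuous_on ({sa<..<sb} \<times> {0<..}) (\<lambda>p :: real \<times> real. eta (y1 (fst p)) (y2 (fst p)) (y3 (fst p)))"
      by (intro continuous_on_compose2[OF eta_cont] continuous_intros) (use I_sub in auto)
    moreover have "continuous_on ({sa<..<sb} \<times> {0<..}) (\<lambda>p :: real \<times> real. zp (snd p))"
      by (intro continuous_on_compose2[OF zp_cont] continuous_intros) auto
    ultimately show ?thesis unfolding nn_def case_prod_unfold by (intro continuous_intros) auto
  qed
  show "0 < nn s y" if "s \<in> {sa<..<sb}" "0 < y" for s y
    unfolding nn_def using that I_pos eta_pos[OF I_T] pos zp_pos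
    by (intro mult_pos_pos divide_pos_pos add_pos_pos) auto
  show "(H s has_real_derivative (y - y2 s) * ((y - y1 s) * (y3 s - y) * nn s y)) (at y)"
    if "s \<in> {sa<..<sb}" "0 < y" for s y
    unfolding force_factor[OF that] by (rule H_deriv[OF that(2)])
qed (rule zp_cont, rule zp_pos)

lemma force_m: "s \<in> {sa<..<sb} \<Longrightarrow> 0 < y \<Longrightarrow> (y - y2 s) * B.m s y = h s y * zp y"
  unfolding B.m_def by (rule force_factor)

text \<open>The integral of \<open>f\<close> over one monotone piece, up to a positive factor.\<close>

definition \<Phi> :: "real \<times> real \<Rightarrow> real" where
  "\<Phi> w = prim (\<lambda>\<alpha>. fh (fst w) (B.orb w \<alpha>) * B.kap w \<alpha>) pi"

lemma fh_orb_cont: "continuous_on (B.\<Omega> \<times> UNIV) (\<lambda>(w, \<alpha>). fh (fst w) (B.orb w \<alpha>) * B.kap w \<alpha>)"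
proof -
  have "continuous_on (B.\<Omega> \<times> UNIV) (\<lambda>(w, \<alpha>). fh (fst w) (B.orb w \<alpha>))"
    by (rule B.orb_comp_cont[OF continuous_on_subset[OF fh_cont]]) (use y_ord I_T in force)
  then show ?thesis using B.kap_cont unfolding case_prod_unfold by (intro continuous_intros)
qed

lemma fh_orb_cont1: "w \<in> B.\<Omega> \<Longrightarrow> continuous_on UNIV (\<lambda>\<alpha>. fh (fst w) (B.orb w \<alpha>) * B.kap w \<alpha>)"
  using continuous_on_slice[OF fh_orb_cont, of UNIV w] by simp

lemma \<Phi>_cont: "continuous_on B.\<Omega> \<Phi>"
proof -
  have "continuous_on B.\<Omega> (\<lambda>w. (\<lambda>(w, \<alpha>). prim (\<lambda>\<alpha>. fh (fst w) (B.orb w \<alpha>) * B.kap w \<alpha>) \<alpha>) (w, pi))"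
    by (rule continuous_on_compose2[OF continuous_on_prim[OF fh_orb_cont]]) (auto intro!: continuous_intros)
  then show ?thesis by (simp add: \<Phi>_def[abs_def])
qed

lemma \<Phi>_uminus:
  assumes "(s, A) \<in> B.\<Omega>" shows "\<Phi> (s, - A) = \<Phi> (s, A)"
proof -
  let ?f = "\<lambda>A \<alpha>. fh s (B.orb (s, A) \<alpha>) * B.kap (s, A) \<alpha>"
  have "prim (?f A) (pi - pi) = prim (?f A) pi - prim (?f (- A)) pi"
    using fh_orb_cont1[OF assms] fh_orb_cont1[OF B.\<Omega>_uminus[OF assms]]
    by (intro prim_reflect) (simp_all add: B.orb_symm(4) B.kap_symm(4))
  then show ?thesis by (simp add: \<Phi>_def)
qed

definition sol :: "nat \<Rightarrow> real \<times> real \<Rightarrow> C1_01" where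
  "sol j w = mk_C1 (\<lambda>x. fst w * B.prof j w x)"

text \<open>The diffusion coefficient for which the half period is stretched to the length \<open>1 / j\<close>.\<close>

definition diff :: "nat \<Rightarrow> real \<times> real \<Rightarrow> real" where
  "diff j w = 2 / (real j * B.per w)\<^sup>2"

definition \<Theta> :: "nat \<Rightarrow> real \<times> real \<Rightarrow> real \<times> C1_01 \<times> real" where
  "\<Theta> j w = (diff j w, sol j w, (fst w)\<^sup>2)"

lemma sol_props:
  shows sol_cont: "continuous_on B.\<Omega> (sol j)"
    and apply_sol: "w \<in> B.\<Omega> \<Longrightarrow> x \<in> {0..1} \<Longrightarrow> apply_C1 (sol j w) x = fst w * B.prof j w x"
    and dC1_sol: "w \<in> B.\<Omega> \<Longrightarrow> x \<in> {0..1} \<Longrightarrow> dC1 (sol j w) x = fst w * B.dprof j w x"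
proof -
  have d: "((\<lambda>x. fst w * B.prof j w x) has_real_derivative fst w * B.dprof j w x) (at x)"
    if "w \<in> B.\<Omega>" "x \<in> {0..1}" for w x
    by (rule DERIV_cmult[OF B.prof_deriv[OF that(1)]])
  have sub: "B.\<Omega> \<times> {0..1} \<subseteq> B.\<Omega> \<times> (UNIV :: real set)" by auto
  have c: "continuous_on (B.\<Omega> \<times> {0..1}) (\<lambda>(w, x). fst w * B.prof j w x)"
    using continuous_on_subset[OF B.prof_cont sub] unfolding case_prod_unfold by (intro continuous_intros)
  have c': "continuous_on (B.\<Omega> \<times> {0..1}) (\<lambda>(w, x). fst w * B.dprof j w x)"
    using continuous_on_subset[OF B.dprof_cont sub] unfolding case_prod_unfold by (intro continuous_intros)
  show "continuous_on B.\<Omega> (sol j)"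
    using continuous_on_mk_C1(1)[OF d c c'] by (simp add: sol_def[abs_def])
  show "w \<in> B.\<Omega> \<Longrightarrow> x \<in> {0..1} \<Longrightarrow> apply_C1 (sol j w) x = fst w * B.prof j w x"
    unfolding sol_def by (rule continuous_on_mk_C1(2)[OF d c c'])
  show "w \<in> B.\<Omega> \<Longrightarrow> x \<in> {0..1} \<Longrightarrow> dC1 (sol j w) x = fst w * B.dprof j w x"
    unfolding sol_def by (rule continuous_on_mk_C1(3)[OF d c c'])
qed

lemma \<Theta>_cont: "1 \<le> j \<Longrightarrow> continuous_on B.\<Omega> (\<Theta> j)"
proof -
  assume j: "1 \<le> j"
  have "real j * B.per w \<noteq> 0" if "w \<in> B.\<Omega>" for w using j B.per_pos[OF that] by simp
  then have "continuous_on B.\<Omega> (diff j)"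
    unfolding diff_def[abs_def] by (intro continuous_intros B.per_cont) auto
  then show ?thesis unfolding \<Theta>_def[abs_def] by (intro continuous_intros sol_cont)
qed

lemma diff_pos: "1 \<le> j \<Longrightarrow> w \<in> B.\<Omega> \<Longrightarrow> 0 < diff j w"
  using B.per_pos[of w] by (simp add: diff_def)

text \<open>The function \<open>w = s (\<delta> y - \<gamma> / y)\<close> has derivative \<open>s R A sin\<close> of the phase, where \<open>R\<close> is the rate
\<open>j per\<close>. This vanishes at both end points, and its derivative is given by the restoring force.\<close>

lemma sol_solves:
  assumes j: "1 \<le> j" and w: "w \<in> B.\<Omega>" and zero: "\<Phi> w = 0"
  shows "limiting_system a1 a2 b1 b2 c1 c2 \<gamma> \<delta> (diff j w) (apply_C1 (sol j w)) ((fst w)\<^sup>2)"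
proof -
  define s where "s = fst w"
  define y where "y = B.prof j w"
  define \<phi> where "\<phi> = B.phase j w"
  define R where "R = real j * B.per w"
  let ?u = "apply_C1 (sol j w)"
  have sI: "s \<in> {sa<..<sb}" using B.\<Omega>_I[OF w] by (simp add: s_def)
  have s0: "0 < s" by (rule I_pos[OF sI])
  have y0: "0 < y x" for x using B.prof_range(3)[OF w] by (simp add: y_def)
  have R0: "0 < R" using j B.per_pos[OF w] by (simp add: R_def)
  have u: "?u x = s * y x" if "x \<in> {0..1}" for x using apply_sol[OF w that] by (simp add: s_def y_def)
  have kp: "0 < B.kap w (\<phi> x)" for x by (rule B.kap_pos[OF w])
  define W where "W = (\<lambda>x. \<delta> * ?u x - \<gamma> * s\<^sup>2 / ?u x)"
  define z where "z = (\<lambda>x. s * (\<delta> * y x - \<gamma> / y x))"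
  define z1 where "z1 = (\<lambda>x. s * R * snd w * sin (\<phi> x))"
  define z2 where "z2 = (\<lambda>x. s * R * snd w * (cos (\<phi> x) * (R / B.kap w (\<phi> x))))"
  have Wz: "W x = z x" if "x \<in> {0..1}" for x
    using u[OF that] y0[of x] s0 by (simp add: W_def z_def field_simps power2_eq_square)
  have y': "(y has_real_derivative R * snd w * sin (\<phi> x) / zp (y x)) (at x)" for x
    using B.prof_deriv[OF w, of j x] by (simp add: y_def \<phi>_def R_def B.dprof_def)
  have \<phi>': "(\<phi> has_real_derivative R / B.kap w (\<phi> x)) (at x)" for x
    using B.phase_deriv[OF w, of j x] by (simp add: \<phi>_def R_def)
  have z': "(z has_real_derivative z1 x) (at x)" for x
  proof -
    have 1: "(z has_real_derivative s * ((\<delta> + \<gamma> / (y x)\<^sup>2) * (R * snd w * sin (\<phi> x) / zp (y x)))) (at x)"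
      unfolding z_def using y'[of x] y0[of x] zp_pos[OF y0[of x]]
      by (auto intro!: derivative_eq_intros simp: field_simps power2_eq_square)
    have 2: "(\<delta> + \<gamma> / (y x)\<^sup>2) * (R * snd w * sin (\<phi> x) / zp (y x)) = R * snd w * sin (\<phi> x)"
      using zp_pos[OF y0[of x]] by (simp add: zp_def)
    show ?thesis using 1 unfolding 2 by (simp add: z1_def mult.assoc)
  qed
  have z1': "(z1 has_real_derivative z2 x) (at x)" for x
    unfolding z1_def z2_def using \<phi>'[of x] by (auto intro!: derivative_eq_intros)
  have z1c: "continuous_on {0..1} z1"
    by (rule DERIV_continuous_on, rule has_field_derivative_at_within, rule z1')
  have \<phi>c: "continuous_on UNIV \<phi>"
    by (rule DERIV_continuous_on, rule has_field_derivative_at_within, rule \<phi>')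
  have z2c: "continuous_on {0..1} z2"
  proof -
    have "continuous_on UNIV (\<lambda>x. B.kap w (\<phi> x))"
      by (rule continuous_on_compose2[OF B.kap_cont1[OF w] \<phi>c]) simp
    then have "continuous_on UNIV z2"
      unfolding z2_def using \<phi>c kp by (intro continuous_intros) (auto simp: less_imp_neq[symmetric])
    then show ?thesis by (rule continuous_on_subset) simp
  qed
  have C1z: "C1_on01 z" and dz: "\<And>x. x \<in> {0..1} \<Longrightarrow> deriv01 z x = z1 x"
    using C1_on01I[of z z1] z' z1c by (auto intro: has_field_derivative_at_within)
  have C1z1: "C1_on01 z1" and dz1: "\<And>x. x \<in> {0..1} \<Longrightarrow> deriv01 z1 x = z2 x"
    using C1_on01I[of z1 z2] z1' z2c by (auto intro: has_field_derivative_at_within)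
  have dW: "deriv01 W x = z1 x" if "x \<in> {0..1}" for x
    using deriv01_cong[OF Wz that] dz[OF that] by simp
  have ddW: "deriv01 (deriv01 W) x = z2 x" if "x \<in> {0..1}" for x
    using deriv01_cong[OF dW that] dz1[OF that] by simp
  have C2: "C2_on01 W"
    unfolding C2_on01_def using C1_on01_cong[OF Wz] C1_on01_cong[OF dW] C1z C1z1 by simp
  have ends: "z1 0 = 0" "z1 1 = 0"
  proof -
    have "\<phi> 0 = 0" using B.phase_0[OF w] by (simp add: \<phi>_def)
    then show "z1 0 = 0" by (simp add: z1_def)
    have "\<phi> 1 = real j * pi" using B.phase_npi[OF w j, of j] j by (simp add: \<phi>_def)
    then show "z1 1 = 0" by (simp add: z1_def)
  qed
  have react: "f_react a1 b1 c1 (?u x) (s\<^sup>2 / ?u x) = s * fh s (y x)"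
    "f_react a1 b1 c1 (?u x) (s\<^sup>2 / ?u x) - \<gamma> * g_react a2 b2 c2 (?u x) (s\<^sup>2 / ?u x) = s * h s (y x)"
    if "x \<in> {0..1}" for x
    unfolding u[OF that] f_react_def g_react_def fh_def h_def k_def using s0 y0[of x]
    by (simp_all add: field_simps power2_eq_square)
  have ode: "diff j w * z2 x + s * h s (y x) = 0" for x
  proof -
    have "diff j w * z2 x = s * (2 * (snd w * cos (\<phi> x)) / B.kap w (\<phi> x))"
      using R0 unfolding diff_def z2_def R_def[symmetric] by (simp add: field_simps power2_eq_square)
    also have "2 * (snd w * cos (\<phi> x)) / B.kap w (\<phi> x) = - ((y x - y2 s) * B.m s (y x)) / zp (y x)"
      using B.restoring_force[OF w, of "\<phi> x"] by (simp add: y_def \<phi>_def s_def B.prof_def)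
    also have "\<dots> = - h s (y x)"
      using force_m[OF sI y0[of x]] zp_pos[OF y0[of x]] by simp
    finally show ?thesis by simp
  qed
  have int: "integral {0..1} (\<lambda>x. f_react a1 b1 c1 (?u x) (s\<^sup>2 / ?u x)) = 0"
  proof -
    have g: "continuous_on {0<..} (fh s)" by (rule continuous_on_slice[OF fh_cont]) auto
    have "((\<lambda>x. fh s (y x)) has_integral 0) {0..1}"
      using B.has_integral_prof[OF w j g] zero by (simp add: \<Phi>_def s_def y_def)
    from has_integral_mult_right[OF this, of s]
    have "((\<lambda>x. f_react a1 b1 c1 (?u x) (s\<^sup>2 / ?u x)) has_integral 0) {0..1}"
      by (subst has_integral_cong[OF react(1)]) auto
    then show ?thesis by (rule integral_unique)
  qed
  show ?thesis
    unfolding limiting_system_def Let_def s_def[symmetric] W_def[symmetric]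
  proof (intro conjI ballI)
    show "0 < ?u x" if "x \<in> {0..1}" for x using u[OF that] s0 y0 by simp
    show "0 < s\<^sup>2" using s0 by simp
    show "C2_on01 W" by (rule C2)
    show "deriv01 W 0 = 0" "deriv01 W 1 = 0" using dW ends by auto
    show "integral {0..1} (\<lambda>x. f_react a1 b1 c1 (?u x) (s\<^sup>2 / ?u x)) = 0" by (rule int)
    fix x :: real assume "x \<in> {0<..<1}"
    then have x: "x \<in> {0..1}" by simp
    show "diff j w * deriv01 (deriv01 W) x + f_react a1 b1 c1 (?u x) (s\<^sup>2 / ?u x)
        - \<gamma> * g_react a2 b2 c2 (?u x) (s\<^sup>2 / ?u x) = 0"
      using react(2)[OF x] ode[of x] ddW[OF x] by simp
  qed
qed

lemma \<Theta>_S_plus: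
  assumes j: "1 \<le> j" and w: "w \<in> B.\<Omega>" and zero: "\<Phi> w = 0" and A: "0 < snd w"
  shows "\<Theta> j w \<in> S_plus a1 a2 b1 b2 c1 c2 \<gamma> \<delta> j"
proof -
  have "0 < (-1) ^ (i - 1) * dC1 (sol j w) x"
    if i: "i \<in> {1..j}" and x: "x \<in> {real (i - 1) / real j<..<real i / real j}" for i x
  proof -
    have "0 \<le> real (i - 1) / real j" by (rule divide_nonneg_nonneg) auto
    moreover have "real i / real j \<le> 1" using i j by (auto simp: divide_le_eq)
    ultimately have x01: "x \<in> {0..1}" using x unfolding greaterThanLessThan_iff atLeastAtMost_iff by linarith
    have "0 < (-1) ^ (i - 1) * B.dprof j w x" using i x A by (intro B.dprof_sign(1)[OF w j]) auto
    from mult_pos_pos[OF I_pos[OF B.\<Omega>_I[OF w]] this] show ?thesis using dC1_sol[OF w x01] by (simp add: mult.left_commute)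
  qed
  then show ?thesis using sol_solves[OF j w zero] diff_pos[OF j w] by (simp add: S_plus_def \<Theta>_def)
qed

lemma \<Theta>_S_minus:
  assumes j: "1 \<le> j" and w: "w \<in> B.\<Omega>" and zero: "\<Phi> w = 0" and A: "snd w < 0"
  shows "\<Theta> j w \<in> S_minus a1 a2 b1 b2 c1 c2 \<gamma> \<delta> j"
proof -
  have "(-1) ^ (i - 1) * dC1 (sol j w) x < 0"
    if i: "i \<in> {1..j}" and x: "x \<in> {real (i - 1) / real j<..<real i / real j}" for i x
  proof -
    have "0 \<le> real (i - 1) / real j" by (rule divide_nonneg_nonneg) auto
    moreover have "real i / real j \<le> 1" using i j by (auto simp: divide_le_eq)
    ultimately have x01: "x \<in> {0..1}" using x unfolding greaterThanLessThan_iff atLeastAtMost_iff by linarith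
    have "(-1) ^ (i - 1) * B.dprof j w x < 0" using i x A by (intro B.dprof_sign(2)[OF w j]) auto
    from mult_pos_neg[OF I_pos[OF B.\<Omega>_I[OF w]] this] show ?thesis using dC1_sol[OF w x01] by (simp add: mult.left_commute)
  qed
  then show ?thesis using sol_solves[OF j w zero] diff_pos[OF j w] by (simp add: S_minus_def \<Theta>_def)
qed

text \<open>The reflection at \<open>1\<close> used by the even extension is a symmetry of the periodic profile, so on \<open>[0, 2]\<close> the
extension is the profile itself, and the half period shift applies.\<close>

lemma shift_sol:
  assumes j: "1 \<le> j" and w: "(s, A) \<in> B.\<Omega>"
  shows "shift_C1 j (sol j (s, A)) = sol j (s, - A)"
proof (rule C1_01_eqI)
  fix x :: real assume x: "x \<in> {0..1}"
  let ?h = "1 / real j" and ?u = "apply_C1 (sol j (s, A))"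
  have "B.phase j (s, A) 1 = real j * pi" using B.phase_npi[OF w j, of j] j by simp
  then have "dC1 (sol j (s, A)) 1 = 0" using dC1_sol[OF w, of 1] by (simp add: B.dprof_def)
  note sh = apply_shift_C1[OF j this x]
  have h: "0 < ?h" "?h \<le> 1" using j by (auto simp: divide_le_eq)
  have x01: "0 \<le> x + ?h" "x + ?h \<le> 2" using x h unfolding atLeastAtMost_iff by linarith+
  have "even_ext ?u (x + ?h) = (if x + ?h \<le> 1 then ?u (x + ?h) else ?u (2 - (x + ?h)))"
    using x01 by (intro even_ext_0_2) simp
  also have "\<dots> = s * B.prof j (s, A) (x + ?h)"
    using apply_sol[OF w, of "x + ?h" j] apply_sol[OF w, of "2 - (x + ?h)" j] x h x01 B.prof_reflect_2[OF w, of j "x + ?h"]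
    by auto
  also have "\<dots> = s * B.prof j (s, - A) x" unfolding B.prof_half_period[OF w j] ..
  also have "\<dots> = apply_C1 (sol j (s, - A)) x" using apply_sol[OF B.\<Omega>_uminus[OF w] x] by simp
  finally show "apply_C1 (shift_C1 j (sol j (s, A))) x = apply_C1 (sol j (s, - A)) x" using sh by simp
qed

lemma shift_\<Theta>:
  assumes "1 \<le> j" "(s, A) \<in> B.\<Omega>"
  shows "(\<lambda>(d, u, \<tau>). (d, shift_C1 j u, \<tau>)) (\<Theta> j (s, A)) = \<Theta> j (s, - A)"
  using shift_sol[OF assms] B.per_uminus[OF assms(2)] by (simp add: \<Theta>_def diff_def)

text \<open>The quotient \<open>B.m ss\<close> and \<open>qf * zp\<close> agree off \<open>ys\<close>, hence at \<open>ys\<close> by continuity. This gives the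
linearised half period at the constant solution, and with it \<open>d = qf ys / (zp ys (j pi)\<^sup>2)\<close>.\<close>

lemma \<Theta>_center:
  assumes j: "1 \<le> j"
  shows "\<Theta> j (ss, 0) = (((\<gamma> * b2 + c1) * ss\<^sup>2 - b1 * (ss * ys)\<^sup>2 - \<gamma> * c2 * (ss / ys)\<^sup>2)
      / ((\<delta> * (ss * ys) + \<gamma> * (ss / ys)) * (real j * pi)\<^sup>2), const_C1 (ss * ys), ss\<^sup>2)"
proof -
  have w: "(ss, 0) \<in> B.\<Omega>" by (rule B.\<Omega>_center[OF ss_I])
  have "sol j (ss, 0) = const_C1 (ss * ys)"
    by (rule C1_01_eqI) (simp add: apply_sol[OF w] apply_const_C1 B.prof_def B.orb_center[OF ss_I] y2_ss)
  moreover have "diff j (ss, 0) = ((\<gamma> * b2 + c1) * ss\<^sup>2 - b1 * (ss * ys)\<^sup>2 - \<gamma> * c2 * (ss / ys)\<^sup>2)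
      / ((\<delta> * (ss * ys) + \<gamma> * (ss / ys)) * (real j * pi)\<^sup>2)"
  proof -
    have m: "B.m ss ys = qf ys * zp ys"
    proof -
      have c1: "isCont (B.m ss) ys"
      proof -
        have "continuous_on {0<..} (B.m ss)" by (rule continuous_on_slice[OF B.m_cont]) (use ss_I in auto)
        then show ?thesis using ys by (simp add: continuous_on_eq_continuous_at)
      qed
      have c2: "isCont (\<lambda>y. qf y * zp y) ys"
        using qf_cont zp_cont ys by (auto intro!: continuous_intros simp: continuous_on_eq_continuous_at)
      have "\<forall>\<^sub>F y in at ys. 0 < y" using ys by (intro order_tendstoD(1)[OF tendsto_ident_at])
      then have "\<forall>\<^sub>F y in at ys. B.m ss y = qf y * zp y"
        using eventually_neq_at_within[of ys]
      proof eventually_elim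
        case (elim y)
        have "(y - ys) * B.m ss y = (y - ys) * (qf y * zp y)"
          using force_m[OF ss_I elim(1)] h_qf[OF elim(1)] by (simp add: y2_ss)
        then show ?case using elim(2) by simp
      qed
      then have "(B.m ss \<longlongrightarrow> qf ys * zp ys) (at ys)"
        using c2 unfolding isCont_def by (simp add: tendsto_cong)
      then show ?thesis using c1 unfolding isCont_def by (intro tendsto_unique[OF at_neq_bot])
    qed
    have zp0: "0 < zp ys" by (rule zp_pos[OF ys])
    have per2: "(B.per (ss, 0))\<^sup>2 = pi\<^sup>2 * (2 * zp ys / qf ys)"
    proof -
      have "(sqrt (2 / (qf ys * zp ys)))\<^sup>2 = 2 / (qf ys * zp ys)"
        using qf_ys zp0 by (intro real_sqrt_pow2) simp
      then show ?thesis
        unfolding B.per_center[OF ss_I] y2_ss m power_mult_distrib using qf_ys zp0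
        by (simp add: field_simps power2_eq_square)
    qed
    have q: "qf ys * ss * ys = (\<gamma> * b2 + c1) * ss\<^sup>2 - b1 * (ss * ys)\<^sup>2 - \<gamma> * c2 * (ss / ys)\<^sup>2"
      unfolding qf_def unfolding a1_eq a2_eq using ys by (simp add: field_simps power2_eq_square)
    have z: "zp ys * ss * ys = \<delta> * (ss * ys) + \<gamma> * (ss / ys)"
      using ys by (simp add: zp_def field_simps power2_eq_square)
    have "diff j (ss, 0) = (qf ys * ss * ys) / ((zp ys * ss * ys) * (real j * pi)\<^sup>2)"
      unfolding diff_def power_mult_distrib per2 using qf_ys zp0 ss ys j
      by (simp add: field_simps)
    then show ?thesis unfolding q z .
  qed
  ultimately show ?thesis by (simp add: \<Theta>_def)
qed

section \<open>The sign of the mean\<close>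

lemma \<kappa>0_nz: "\<kappa>0 \<noteq> 0" using nondeg by (simp add: \<kappa>0_def)

lemma \<Phi>_sign:
  assumes w: "w \<in> B.\<Omega>" and p: "\<And>\<alpha>. 0 < c * fh (fst w) (B.orb w \<alpha>)"
  shows "0 < c * \<Phi> w"
proof -
  have "0 < prim (\<lambda>\<alpha>. c * (fh (fst w) (B.orb w \<alpha>) * B.kap w \<alpha>) + 0) pi"
  proof (rule prim_pos)
    show "continuous_on UNIV (\<lambda>\<alpha>. c * (fh (fst w) (B.orb w \<alpha>) * B.kap w \<alpha>) + 0)"
      by (intro continuous_intros fh_orb_cont1[OF w])
    show "0 < c * (fh (fst w) (B.orb w \<alpha>) * B.kap w \<alpha>) + 0" for \<alpha>
      using mult_pos_pos[OF p B.kap_pos[OF w]] by (simp add: mult.assoc)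
  qed
  then show ?thesis unfolding prim_affine[OF fh_orb_cont1[OF w]] by (simp add: \<Phi>_def)
qed

lemma \<Phi>_center:
  assumes s: "s \<in> {sa<..<sb}" "s \<noteq> ss" shows "0 < \<kappa>0 * (s - ss) * \<Phi> (s, 0)"
  using fh_y2_sign[OF iv s] by (intro \<Phi>_sign B.\<Omega>_center s) (simp add: B.orb_center[OF s(1)])

lemma orb_below_saddles:
  assumes w: "w \<in> B.\<Omega>"
  shows "H (fst w) (B.orb w \<alpha>) \<le> H (fst w) (y1 (fst w))" "H (fst w) (B.orb w \<alpha>) \<le> H (fst w) (y3 (fst w))"
proof -
  let ?s = "fst w"
  have s: "?s \<in> {sa<..<sb}" by (rule B.\<Omega>_I[OF w])
  note r = B.orb_range[OF w, of \<alpha>]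
  note o = y_ord[OF I_T[OF s]]
  have "\<bar>snd w * cos \<alpha>\<bar> < B.amax ?s" using B.abs_Acos[of "snd w" \<alpha>] w by (auto simp: B.\<Omega>_def)
  then have le: "(snd w * cos \<alpha>)\<^sup>2 \<le> (B.G ?s (y1 ?s))\<^sup>2" "(snd w * cos \<alpha>)\<^sup>2 \<le> (B.G ?s (y3 ?s))\<^sup>2"
    by (auto simp: B.amax_def abs_le_square_iff[symmetric])
  have "(snd w * cos \<alpha>)\<^sup>2 = H ?s (B.orb w \<alpha>) - H ?s (y2 ?s)"
    using B.G_sq[OF s, of "B.orb w \<alpha>"] r by simp
  then show "H ?s (B.orb w \<alpha>) \<le> H ?s (y1 ?s)" "H ?s (B.orb w \<alpha>) \<le> H ?s (y3 ?s)"
    using le B.G_sq[OF s, of "y1 ?s"] B.G_sq[OF s, of "y3 ?s"] o by auto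
qed

text \<open>Otherwise there would be orbit points with the wrong sign of \<open>fh\<close> for values of \<open>s\<close> tending to the end.
As the orbits collapse, these points and the centres have a common limit, a zero of \<open>h e\<close>, at which
\<open>fh\<close> would have to vanish.\<close>

lemma \<Phi>_sign_near_end:
  assumes e: "e = sa \<or> e = sb" "0 < e"
  obtains \<eta> where "0 < \<eta>"
    "\<And>s A. s \<in> {sa<..<sb} \<Longrightarrow> \<bar>s - e\<bar> < \<eta> \<Longrightarrow> \<bar>A\<bar> < B.amax s \<Longrightarrow> 0 < \<kappa>0 * (s - ss) * \<Phi> (s, A)"
proof (rule ccontr)
  note found = that
  assume nt: "\<not> thesis"
  have neg: "\<exists>s A. s \<in> {sa<..<sb} \<and> \<bar>s - e\<bar> < \<eta> \<and> \<bar>A\<bar> < B.amax s \<and> \<not> 0 < \<kappa>0 * (s - ss) * \<Phi> (s, A)"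
    if "0 < \<eta>" for \<eta>
  proof (rule ccontr)
    assume n: "\<not> ?thesis"
    have thesis by (rule found[OF that]) (use n in blast)
    then show False using nt by simp
  qed
  have eT: "e \<notin> T" "e \<noteq> ss" using e iv by (auto simp: interv_def)
  have "\<exists>s x. s \<in> {sa<..<sb} \<and> \<bar>s - e\<bar> < min (e / 2) (1 / real (Suc n)) \<and> y1 s \<le> x \<and> x \<le> y3 s
     \<and> H s x \<le> H s (y1 s) \<and> H s x \<le> H s (y3 s) \<and> \<kappa>0 * (s - ss) * fh s x \<le> 0" for n
  proof -
    obtain s A where sA: "s \<in> {sa<..<sb}" "\<bar>s - e\<bar> < min (e / 2) (1 / real (Suc n))" "\<bar>A\<bar> < B.amax s"
      "\<not> 0 < \<kappa>0 * (s - ss) * \<Phi> (s, A)"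
      using neg[of "min (e / 2) (1 / real (Suc n))"] e(2) by auto
    have w: "(s, A) \<in> B.\<Omega>" using sA by (simp add: B.\<Omega>_def)
    obtain \<alpha> where "\<not> 0 < \<kappa>0 * (s - ss) * fh s (B.orb (s, A) \<alpha>)"
      using \<Phi>_sign[OF w, of "\<kappa>0 * (s - ss)"] sA(4) by auto
    then show ?thesis using sA B.orb_range[OF w, of \<alpha>] orb_below_saddles[OF w, of \<alpha>]
      by (intro exI[of _ s] exI[of _ "B.orb (s, A) \<alpha>"]) auto
  qed
  then obtain S X where SX: "\<And>n. S n \<in> {sa<..<sb}" "\<And>n. \<bar>S n - e\<bar> < min (e / 2) (1 / real (Suc n))"
    "\<And>n. y1 (S n) \<le> X n" "\<And>n. X n \<le> y3 (S n)" "\<And>n. H (S n) (X n) \<le> H (S n) (y1 (S n))"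
    "\<And>n. H (S n) (X n) \<le> H (S n) (y3 (S n))" "\<And>n. \<kappa>0 * (S n - ss) * fh (S n) (X n) \<le> 0"
    by metis
  have b: "e / 2 \<le> S n" "S n \<le> 2 * e" for n
  proof -
    have "\<bar>S n - e\<bar> < e / 2" using SX(2)[of n] by simp
    then show "e / 2 \<le> S n" "S n \<le> 2 * e" using e(2) by linarith+
  qed
  have lim: "S \<longlonglongrightarrow> e"
  proof (rule LIM_zero_cancel, rule Lim_null_comparison)
    show "(\<lambda>n. 1 / real (Suc n)) \<longlonglongrightarrow> 0" using LIMSEQ_inverse_real_of_nat by (simp add: inverse_eq_divide)
    show "\<forall>\<^sub>F n in sequentially. norm (S n - e) \<le> 1 / real (Suc n)"
    proof (rule always_eventually, rule allI)
      fix n show "norm (S n - e) \<le> 1 / real (Suc n)" using SX(2)[of n] by simp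
    qed
  qed
  obtain \<rho> x where x: "strict_mono \<rho>" "0 < x" "h e x = 0"
    "(\<lambda>n. X (\<rho> n)) \<longlonglongrightarrow> x" "(\<lambda>n. y2 (S (\<rho> n))) \<longlonglongrightarrow> x"
    using saddle_centre_merge[OF I_T[OF SX(1)] lim e(2) eT(1) b SX(3-6)] by metis
  have limS: "(\<lambda>n. S (\<rho> n)) \<longlonglongrightarrow> e" using LIMSEQ_subseq_LIMSEQ[OF lim x(1)] by (simp add: o_def)
  have l: "(\<lambda>n. \<kappa>0 * (S (\<rho> n) - ss) * fh (S (\<rho> n)) (v n)) \<longlonglongrightarrow> \<kappa>0 * (e - ss) * fh e x"
    if "v \<longlonglongrightarrow> x" for v
    unfolding fh_def by (intro tendsto_intros limS that)
  have "\<kappa>0 * (e - ss) * fh e x \<le> 0"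
    by (rule LIMSEQ_le_const2[OF l[OF x(4)]]) (use SX(7) in auto)
  moreover have "0 \<le> \<kappa>0 * (e - ss) * fh e x"
  proof (rule LIMSEQ_le_const[OF l[OF x(5)]], intro exI allI impI)
    fix n
    show "0 \<le> \<kappa>0 * (S (\<rho> n) - ss) * fh (S (\<rho> n)) (y2 (S (\<rho> n)))"
      using fh_y2_sign[OF iv SX(1)[of "\<rho> n"]] by (cases "S (\<rho> n) = ss") auto
  qed
  ultimately show False using root_not_fh(1)[OF x(2,3) eT(2)] \<kappa>0_nz eT(2) by simp
qed

lemma \<Phi>_amplitude_cont:
  assumes "J \<subseteq> {sa<..<sb}"
  shows "continuous_on (J \<times> {0..<1}) (\<lambda>(s, t). \<Phi> (s, t * B.amax s))"
    and "s \<in> {sa<..<sb} \<Longrightarrow> 0 \<le> t \<Longrightarrow> t < 1 \<Longrightarrow> (s, t * B.amax s) \<in> B.\<Omega>"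
proof -
  show w: "(s, t * B.amax s) \<in> B.\<Omega>" if "s \<in> {sa<..<sb}" "0 \<le> t" "t < 1" for s t
    using that B.amax_pos[OF that(1)] by (auto simp: B.\<Omega>_def abs_mult)
  have "continuous_on (J \<times> {0..<1}) (\<lambda>p. B.amax (fst p))"
    using assms by (intro continuous_on_compose2[OF B.amax_cont] continuous_intros) auto
  then have "continuous_on (J \<times> {0..<1}) (\<lambda>p. \<Phi> (fst p, snd p * B.amax (fst p)))"
    using assms w by (intro continuous_on_compose2[OF \<Phi>_cont] continuous_intros) auto
  then show "continuous_on (J \<times> {0..<1}) (\<lambda>(s, t). \<Phi> (s, t * B.amax s))" by (simp add: case_prod_unfold)
qed

text \<open>For \<open>t = 0\<close> the sign is known, and uniform continuity carries it over to small \<open>t\<close>.\<close>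

lemma \<Phi>_sign_small_amplitude:
  assumes J: "compact J" "J \<subseteq> {sa<..<sb}" "\<And>s. s \<in> J \<Longrightarrow> s < ss"
  obtains \<eta> where "0 < \<eta>" "\<eta> < 1" "\<And>s t. s \<in> J \<Longrightarrow> 0 \<le> t \<Longrightarrow> t \<le> \<eta> \<Longrightarrow> \<kappa>0 * \<Phi> (s, t * B.amax s) < 0"
proof (cases "J = {}")
  case True
  then show thesis using that[of "1 / 2"] by auto
next
  case False
  let ?g = "\<lambda>(s, t). \<kappa>0 * \<Phi> (s, t * B.amax s)"
  have sub: "J \<times> {0..1/2} \<subseteq> J \<times> {0..<1::real}" by auto
  have g: "continuous_on (J \<times> {0..1/2}) ?g"
    using continuous_on_subset[OF \<Phi>_amplitude_cont(1)[OF J(2)] sub] unfolding case_prod_unfold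
    by (intro continuous_intros)
  have cp: "compact (J \<times> {0..1/2::real})" using J(1) by (intro compact_Times) auto
  have "continuous_on J (\<lambda>s. ?g (s, 0))"
    by (rule continuous_on_compose2[OF g]) (auto intro!: continuous_intros)
  then obtain z where z: "z \<in> J" "\<And>s. s \<in> J \<Longrightarrow> ?g (s, 0) \<le> ?g (z, 0)"
    using continuous_attains_sup[OF J(1) False] by blast
  define \<epsilon> where "\<epsilon> = - ?g (z, 0)"
  have "0 < \<kappa>0 * (z - ss) * \<Phi> (z, 0)" using subsetD[OF J(2) z(1)] J(3)[OF z(1)] by (intro \<Phi>_center) auto
  then have "0 < (z - ss) * (\<kappa>0 * \<Phi> (z, 0))" by (simp add: mult_ac)
  then have \<epsilon>: "0 < \<epsilon>" using J(3)[OF z(1)] by (simp add: \<epsilon>_def zero_less_mult_iff)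
  have "uniformly_continuous_on (J \<times> {0..1/2}) ?g" by (rule compact_uniformly_continuous[OF g cp])
  then obtain d where d: "0 < d"
    "\<forall>z\<in>J \<times> {0..1/2}. \<forall>z'\<in>J \<times> {0..1/2}. dist z' z < d \<longrightarrow> dist (?g z') (?g z) < \<epsilon>"
    unfolding uniformly_continuous_on_def using \<epsilon> by blast
  show thesis
  proof (rule that[of "min (d / 2) (1 / 2)"])
    fix s t assume s: "s \<in> J" and t: "0 \<le> t" "t \<le> min (d / 2) (1 / 2)"
    have "dist (?g (s, t)) (?g (s, 0)) < \<epsilon>"
      using d(1) d(2)[rule_format, of "(s, 0)" "(s, t)"] s t by (auto simp: dist_Pair_Pair dist_real_def)
    then show "\<kappa>0 * \<Phi> (s, t * B.amax s) < 0" using z(2)[OF s] by (auto simp: \<epsilon>_def dist_real_def)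
  qed (use d in auto)
qed

text \<open>An orbit with large half period spends most of the time near the saddles, where \<open>fh\<close> is negative; away from
the saddles the time density is bounded.\<close>

lemma per_large_imp_\<Phi>_neg:
  assumes strong: "\<kappa>0 < 0" and J: "compact J" "J \<subseteq> {sa<..<sb}"
  obtains P where "\<And>w. w \<in> B.\<Omega> \<Longrightarrow> fst w \<in> J \<Longrightarrow> P < B.per w \<Longrightarrow> \<Phi> w < 0"
proof (cases "J = {}")
  case True
  then show thesis using that by blast
next
  case False
  note cJ = continuous_on_subset[OF B.cont_lo J(2)] continuous_on_subset[OF B.cont_mid J(2)]
    continuous_on_subset[OF B.cont_hi J(2)]
  have o: "0 < y1 s" "y1 s < y2 s" "y2 s < y3 s" if "s \<in> J" for s using y_ord[OF I_T] that J(2) by auto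
  let ?K = "{(s, y). s \<in> J \<and> y1 s \<le> y \<and> y \<le> y3 s}"
  have K: "compact ?K" using o by (intro B.compact_between J cJ) force
  have Ksub: "?K \<subseteq> UNIV \<times> {0<..}" using o(1) by force
  obtain s0 where "s0 \<in> J" using False by blast
  then have "(s0, y1 s0) \<in> ?K" using o[of s0] by simp
  then have Kne: "?K \<noteq> {}" by blast
  have fK: "continuous_on ?K (\<lambda>(s, y). fh s y)" by (rule continuous_on_subset[OF fh_cont Ksub])
  obtain F where F: "\<And>s y. s \<in> J \<Longrightarrow> y1 s \<le> y \<Longrightarrow> y \<le> y3 s \<Longrightarrow> fh s y \<le> F"
  proof -
    obtain z where "z \<in> ?K" "\<forall>x\<in>?K. (\<lambda>(s, y). fh s y) x \<le> (\<lambda>(s, y). fh s y) z"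
      using continuous_attains_sup[OF K Kne fK] by blast
    then show thesis using that[of "(\<lambda>(s, y). fh s y) z"] by auto
  qed
  obtain \<epsilon> where \<epsilon>: "0 < \<epsilon>" "\<And>s. s \<in> J \<Longrightarrow> fh s (y1 s) \<le> - 2 * \<epsilon>" "\<And>s. s \<in> J \<Longrightarrow> fh s (y3 s) \<le> - 2 * \<epsilon>"
  proof -
    let ?g = "\<lambda>s. max (fh s (y1 s)) (fh s (y3 s))"
    have "continuous_on J ?g" unfolding fh_def using cJ by (intro continuous_intros)
    then obtain z where z: "z \<in> J" "\<forall>s\<in>J. ?g s \<le> ?g z"
      using continuous_attains_sup[OF J(1) False] by blast
    have "?g z < 0" using strong_fh_saddles[OF iv strong, of z] z J(2) by auto
    then show thesis using z(2) by (intro that[of "- ?g z / 2"]) auto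
  qed
  obtain g where g: "0 < g" "\<And>s. s \<in> J \<Longrightarrow> g \<le> y3 s - y1 s"
  proof -
    have "continuous_on J (\<lambda>s. y3 s - y1 s)" using cJ by (intro continuous_intros)
    then obtain z where z: "z \<in> J" "\<forall>s\<in>J. y3 z - y1 z \<le> y3 s - y1 s"
      using continuous_attains_inf[OF J(1) False] by blast
    then show thesis using o[OF z(1)] by (intro that[of "y3 z - y1 z"]) auto
  qed
  have "uniformly_continuous_on ?K (\<lambda>(s, y). fh s y)" by (rule compact_uniformly_continuous[OF fK K])
  then obtain d where d: "0 < d"
    "\<forall>z\<in>?K. \<forall>z'\<in>?K. dist z' z < d \<longrightarrow> dist ((\<lambda>(s, y). fh s y) z') ((\<lambda>(s, y). fh s y) z) < \<epsilon>"
    unfolding uniformly_continuous_on_def using \<epsilon>(1) by blast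
  have near: "\<bar>fh s y' - fh s y\<bar> < \<epsilon>"
    if "s \<in> J" "y1 s \<le> y" "y \<le> y3 s" "y1 s \<le> y'" "y' \<le> y3 s" "\<bar>y' - y\<bar> < d" for s y y'
    using d(2)[rule_format, of "(s, y)" "(s, y')"] that by (simp add: dist_Pair_Pair dist_real_def)
  define \<rho> where "\<rho> = min (d / 2) (g / 2)"
  have \<rho>: "0 < \<rho>" "\<rho> < d" "2 * \<rho> \<le> g" using d(1) g(1) by (auto simp: \<rho>_def)
  let ?L = "{(s, y). s \<in> J \<and> y1 s + \<rho> \<le> y \<and> y \<le> y3 s - \<rho>}"
  have L: "compact ?L" using g(2) \<rho> by (intro B.compact_between J cJ continuous_intros) force
  have Lsub: "?L \<subseteq> {(s, y). s \<in> {sa<..<sb} \<and> y1 s < y \<and> y < y3 s}" using J(2) \<rho> by auto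
  obtain Bk where Bk: "\<And>s y. s \<in> J \<Longrightarrow> y1 s + \<rho> \<le> y \<Longrightarrow> y \<le> y3 s - \<rho> \<Longrightarrow> zp y / B.dG s y \<le> Bk"
  proof -
    have "continuous_on ?L (\<lambda>p. zp (snd p))"
      by (intro continuous_on_compose2[OF zp_cont] continuous_intros) (use o \<rho> in force)
    moreover have "B.dG s y \<noteq> 0" if "(s, y) \<in> ?L" for s y
    proof -
      have "s \<in> {sa<..<sb}" "y1 s < y" "y < y3 s" using that J(2) \<rho>(1) by auto
      from B.dG_pos[OF this] show ?thesis by simp
    qed
    ultimately have c: "continuous_on ?L (\<lambda>(s, y). zp y / B.dG s y)"
      using continuous_on_subset[OF B.dG_cont Lsub] unfolding case_prod_unfold
      by (intro continuous_intros) auto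
    have "(s0, y1 s0 + \<rho>) \<in> ?L" using \<open>s0 \<in> J\<close> g(2)[OF \<open>s0 \<in> J\<close>] \<rho> by simp
    then have "?L \<noteq> {}" by blast
    then obtain z where "z \<in> ?L" "\<forall>x\<in>?L. (\<lambda>(s, y). zp y / B.dG s y) x \<le> (\<lambda>(s, y). zp y / B.dG s y) z"
      using continuous_attains_sup[OF L _ c] by blast
    then show thesis using that[of "(\<lambda>(s, y). zp y / B.dG s y) z"] by auto
  qed
  \<comment> \<open>bounds \<open>(fh + \<epsilon>) * kap\<close> away from the saddles\<close>
  define D where "D = max 0 ((F + \<epsilon>) * Bk)"
  show thesis
  proof (rule that[of "pi * D / \<epsilon>"])
    fix w assume w: "w \<in> B.\<Omega>" and sJ: "fst w \<in> J" and per: "pi * D / \<epsilon> < B.per w"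
    let ?s = "fst w"
    have le: "fh ?s (B.orb w \<alpha>) * B.kap w \<alpha> \<le> - \<epsilon> * B.kap w \<alpha> + D" for \<alpha>
    proof -
      let ?y = "B.orb w \<alpha>"
      note r = B.orb_range[OF w, of \<alpha>]
      have kp: "0 < B.kap w \<alpha>" by (rule B.kap_pos[OF w])
      show ?thesis
      proof (cases "fh ?s ?y \<le> - \<epsilon>")
        case True
        then have "fh ?s ?y * B.kap w \<alpha> \<le> - \<epsilon> * B.kap w \<alpha>" using kp by (intro mult_right_mono) auto
        then show ?thesis by (simp add: D_def)
      next
        case False
        have "\<not> \<bar>?y - y1 ?s\<bar> < d" "\<not> \<bar>?y - y3 ?s\<bar> < d"
          using near[OF sJ, of "y1 ?s" ?y] near[OF sJ, of "y3 ?s" ?y] False \<epsilon>(2,3)[OF sJ] r o[OF sJ] by auto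
        then have "y1 ?s + \<rho> \<le> ?y" "?y \<le> y3 ?s - \<rho>" using r \<rho> by auto
        from Bk[OF sJ this] have "B.kap w \<alpha> \<le> Bk" by (simp add: B.kap_def)
        then have "(fh ?s ?y + \<epsilon>) * B.kap w \<alpha> \<le> (F + \<epsilon>) * Bk"
          using F[OF sJ, of ?y] r kp False by (intro mult_mono) auto
        then show ?thesis by (simp add: D_def algebra_simps)
      qed
    qed
    have "prim (\<lambda>\<alpha>. fh ?s (B.orb w \<alpha>) * B.kap w \<alpha>) pi - prim (\<lambda>\<alpha>. fh ?s (B.orb w \<alpha>) * B.kap w \<alpha>) 0
      \<le> prim (\<lambda>\<alpha>. - \<epsilon> * B.kap w \<alpha> + D) pi - prim (\<lambda>\<alpha>. - \<epsilon> * B.kap w \<alpha> + D) 0"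
      using le by (intro prim_diff_le fh_orb_cont1 w continuous_intros B.kap_cont1) auto
    then have "\<Phi> w \<le> - \<epsilon> * B.per w + D * pi"
      unfolding prim_affine[OF B.kap_cont1[OF w]] by (simp add: \<Phi>_def B.per_def)
    also have "\<dots> < 0" using per \<epsilon>(1) by (simp add: field_simps)
    finally show "\<Phi> w < 0" .
  qed
qed

section \<open>Half periods for vanishing scale\<close>

text \<open>Between the centre and the upper turning point \<open>h s y\<close> is at most \<open>L\<close> times the distance from the centre in the
coordinate \<open>z\<close>, because \<open>s * k\<close> is increasing. An oscillator with such a force is not faster than the
harmonic one.\<close>

lemma half_period_lower_bound:
  assumes w: "(s, A) \<in> B.\<Omega>" and A: "0 < A"
  shows "1 / sqrt ((a1 / \<delta> + a2) / 2) \<le> prim (B.kap (s, A)) pi - prim (B.kap (s, A)) (pi / 2)"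
proof -
  define w where "w = (s, A)"
  have w': "w \<in> B.\<Omega>" using w by (simp add: w_def)
  have s: "s \<in> {sa<..<sb}" using B.\<Omega>_I[OF w] by simp
  have s0: "0 < s" by (rule I_pos[OF s])
  note o = y_ord[OF I_T[OF s]]
  define z where "z = (\<lambda>y. \<delta> * y - \<gamma> / y)"
  define q where "q = B.orb w pi"
  define L where "L = a1 / \<delta> + a2"
  define P where "P = prim (B.kap w) pi - prim (B.kap w) (pi / 2)"
  have L: "0 < L" "a1 \<le> L * \<delta>" "a2 \<le> L" using pos by (simp_all add: L_def add_pos_pos field_simps)
  have z': "(z has_real_derivative zp y) (at y)" if "0 < y" for y
    unfolding z_def zp_def using that by (auto intro!: derivative_eq_intros simp: power2_eq_square)
  have r: "y1 s < B.orb w \<alpha>" "B.orb w \<alpha> < y3 s" "0 < B.orb w \<alpha>" "B.G s (B.orb w \<alpha>) = - A * cos \<alpha>" for \<alpha>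
    using B.orb_range[OF w', of \<alpha>] by (simp_all add: w_def)
  have mid: "B.orb w (pi / 2) = y2 s" by (simp add: B.orb_def w_def B.Y_0[OF s])
  have Gq: "B.G s q = A" using r(4)[of pi] by (simp add: q_def)
  have qr: "y1 s < q" "q < y3 s" using r by (simp_all add: q_def)
  have q: "y2 s < q" using B.G_less_iff[OF s, of "y2 s" q] o qr Gq A by simp
  have hle: "h s y \<le> L * (z y - z (y2 s))" if "y2 s \<le> y" for y
  proof -
    have y0: "0 < y" "0 < y2 s" using that o by linarith+
    have "h s (y2 s) = 0" using three_y[OF I_T[OF s]] by (simp add: three_def)
    then have "h s y = a1 * (y - y2 s) + a2 * (\<gamma> / y2 s - \<gamma> / y) - s * (k y - k (y2 s))"
      by (simp add: h_def algebra_simps)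
    moreover have "k (y2 s) \<le> k y"
    proof -
      have "(y2 s)\<^sup>2 \<le> y\<^sup>2" using that y0 by (intro power_mono) auto
      then have "b1 * (y2 s)\<^sup>2 \<le> b1 * y\<^sup>2" "\<gamma> * c2 / y\<^sup>2 \<le> \<gamma> * c2 / (y2 s)\<^sup>2"
        using pos y0 by (auto intro!: divide_left_mono)
      then show ?thesis by (simp add: k_def)
    qed
    then have "0 \<le> s * (k y - k (y2 s))" using s0 by simp
    moreover have "a1 * (y - y2 s) \<le> L * \<delta> * (y - y2 s)" using L that by (intro mult_right_mono) auto
    moreover have "a2 * (\<gamma> / y2 s - \<gamma> / y) \<le> L * (\<gamma> / y2 s - \<gamma> / y)"
      using L that y0 pos by (intro mult_right_mono) (auto intro!: divide_left_mono)
    ultimately show ?thesis by (simp add: z_def algebra_simps)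
  qed
  \<comment> \<open>energy balance: \<open>A\<^sup>2\<close> is the integral of the force from the centre to the turning point\<close>
  have "A\<^sup>2 \<le> L / 2 * (z q - z (y2 s))\<^sup>2"
  proof -
    let ?D = "\<lambda>y. L / 2 * (z y - z (y2 s))\<^sup>2 - H s y"
    have "?D (y2 s) \<le> ?D q"
    proof (rule DERIV_nonneg_imp_nondecreasing[where f = ?D])
      fix y assume y: "y2 s \<le> y" "y \<le> q"
      then have y0: "0 < y" using o by linarith
      have "(?D has_real_derivative L * (z y - z (y2 s)) * zp y - h s y * zp y) (at y)"
        using z'[OF y0] H_deriv[OF y0, of s] by (auto intro!: derivative_eq_intros)
      moreover have "0 \<le> (L * (z y - z (y2 s)) - h s y) * zp y"
        using hle[OF y(1)] zp_pos[OF y0] by (intro mult_nonneg_nonneg) auto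
      ultimately show "\<exists>d. (?D has_real_derivative d) (at y) \<and> 0 \<le> d"
        by (intro exI[of _ "L * (z y - z (y2 s)) * zp y - h s y * zp y"]) (simp add: algebra_simps)
    qed (use q in simp)
    moreover have "A\<^sup>2 = H s q - H s (y2 s)" using B.G_sq[OF s, of q] qr Gq by simp
    ultimately show ?thesis by simp
  qed
  moreover have z_less: "z (y2 s) < z q"
    using q pos o unfolding z_def by (intro diff_strict_mono divide_strict_left_mono mult_strict_left_mono) auto
  ultimately have "A\<^sup>2 \<le> (sqrt (L / 2) * (z q - z (y2 s)))\<^sup>2"
    using L by (simp add: power_mult_distrib)
  then have Az: "A \<le> sqrt (L / 2) * (z q - z (y2 s))"
    using z_less L by (intro power2_le_imp_le[of A]) auto
  have "z q - z (y2 s) \<le> A * P"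
  proof -
    let ?f = "\<lambda>\<alpha>. A * sin \<alpha> * B.kap w \<alpha>"
    have c: "continuous_on UNIV ?f" by (intro continuous_intros B.kap_cont1 w')
    have "((\<lambda>\<alpha>. z (B.orb w \<alpha>)) has_real_derivative ?f \<alpha>) (at \<alpha>)" for \<alpha>
      using DERIV_chain2[OF z'[OF r(3)] B.orb_deriv[OF w', of \<alpha>]]
      by (simp add: B.kap_def w_def mult_ac)
    note pr = prim_unique[of "\<lambda>\<alpha>. z (B.orb w \<alpha>)", OF this]
    have "prim ?f pi - prim ?f (pi / 2) \<le> prim (\<lambda>\<alpha>. A * B.kap w \<alpha> + 0) pi - prim (\<lambda>\<alpha>. A * B.kap w \<alpha> + 0) (pi / 2)"
    proof (rule prim_diff_le[OF c])
      show "continuous_on UNIV (\<lambda>\<alpha>. A * B.kap w \<alpha> + 0)" by (intro continuous_intros B.kap_cont1 w')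
      fix \<alpha>
      have "sin \<alpha> * (A * B.kap w \<alpha>) \<le> 1 * (A * B.kap w \<alpha>)"
        using A B.kap_pos[OF w', of \<alpha>] by (intro mult_right_mono) auto
      then show "A * sin \<alpha> * B.kap w \<alpha> \<le> A * B.kap w \<alpha> + 0" by (simp add: mult_ac)
    qed simp
    then show ?thesis
      unfolding pr prim_affine[OF B.kap_cont1[OF w']] by (simp add: mid q_def P_def algebra_simps)
  qed
  then have "A \<le> sqrt (L / 2) * (A * P)" using Az L by (smt (verit) mult_left_mono real_sqrt_ge_0_iff divide_nonneg_nonneg)
  then have "A * 1 \<le> A * (sqrt (L / 2) * P)" by (simp add: mult_ac)
  then have "1 \<le> sqrt (L / 2) * P" using A by (simp only: mult_le_cancel_left_pos)
  then have "1 / sqrt (L / 2) \<le> P" using L by (simp add: divide_le_eq mult.commute)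
  then show ?thesis by (simp add: L_def P_def w_def)
qed

text \<open>Suppose that the half period is at most \<open>B0\<close>. For small \<open>s\<close> the upper saddle is near \<open>a1 / (b1 s)\<close> and the
linearisation there is bounded, so by the logarithmic bound the upper turning point \<open>q\<close> stays below
\<open>(1 - \<theta>) y3 s\<close> with \<open>\<theta>\<close> independent of \<open>s\<close>. Then \<open>fh s y \<ge> \<epsilon> y - s c1\<close> on the whole orbit. The time spent
above the centre is bounded from below, so the positive part \<open>\<epsilon> y\<close> contributes a fixed positive
amount to \<open>\<Phi>\<close>, whereas the loss is at most \<open>s c1 B0\<close>. For small \<open>s\<close> the integral cannot vanish.\<close>

lemma per_blowup_small_s:
  assumes strong: "\<kappa>0 < 0" and B0: "0 < B0"
  obtains \<sigma> where "0 < \<sigma>"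
    "\<And>s A. 0 < s \<Longrightarrow> s < \<sigma> \<Longrightarrow> 0 < A \<Longrightarrow> A < B.amax s \<Longrightarrow> \<Phi> (s, A) = 0 \<Longrightarrow> B0 < B.per (s, A)"
proof -
  define m0 where "m0 = y1 ss"
  define M0 where "M0 = y3 ss"
  define E where "E = \<bar>c1 - \<gamma> * b2\<bar> + \<gamma> * c2"
  define L1 where "L1 = (4 * a1 + 1) * (\<delta> + \<gamma> / m0\<^sup>2)"
  define L where "L = L1 + 1"
  \<comment> \<open>the logarithmic bound gives \<open>y3 - q \<ge> 2 \<theta> (y3 - y2)\<close>, and \<open>y2 \<le> y3 / 2\<close>\<close>
  define \<theta> where "\<theta> = exp (- (B0 * L / \<delta>)) / 2"
  define \<epsilon> where "\<epsilon> = \<theta> * a1 / 4"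
  define K where "K = 1 / sqrt ((a1 / \<delta> + a2) / 2)"
  \<comment> \<open>\<open>h s\<close> is positive at \<open>a1 / (2 b1 s)\<close> as soon as this point exceeds \<open>Y0\<close>\<close>
  define Y0 where "Y0 = 2 * M0 + 1 + 2 * (\<gamma> * a2 + ss * E) / a1"
  define \<sigma> where "\<sigma> = min ss (min (a1 / (2 * b1 * Y0)) (min (\<epsilon> / E) (min (m0\<^sup>2 / (2 * \<gamma> * c2)) (\<epsilon> * m0 * K / (c1 * B0)))))"
  have m0: "0 < m0" "m0 < M0" using y_ord[OF ss_T] by (auto simp: m0_def M0_def)
  have E: "0 < E" "\<bar>c1 - \<gamma> * b2\<bar> \<le> E" using pos by (auto simp: E_def intro!: add_nonneg_pos)
  have L1: "0 < L1" using pos m0 by (auto simp: L1_def intro!: mult_pos_pos add_pos_pos)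
  have L: "0 < L" using L1 by (simp add: L_def)
  have "0 \<le> B0 * L / \<delta>" using B0 L pos by simp
  then have ex: "exp (- (B0 * L / \<delta>)) \<le> 1" by simp
  have \<theta>: "0 < \<theta>" "\<theta> \<le> 1" unfolding \<theta>_def using ex exp_gt_zero[of "- (B0 * L / \<delta>)"] by linarith+
  have \<epsilon>: "0 < \<epsilon>" "\<epsilon> \<le> a1" using \<theta> pos by (auto simp: \<epsilon>_def intro: order_trans[OF mult_right_mono[OF \<theta>(2)]])
  have K: "0 < K" using pos by (auto simp: K_def intro!: add_pos_pos)
  have Y0: "0 < Y0" "1 \<le> Y0" "2 * M0 \<le> Y0" "2 * (\<gamma> * a2 + ss * E) / a1 < Y0"
  proof -
    have "0 \<le> 2 * (\<gamma> * a2 + ss * E) / a1" using pos E ss by simp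
    then show "0 < Y0" "1 \<le> Y0" "2 * M0 \<le> Y0" "2 * (\<gamma> * a2 + ss * E) / a1 < Y0"
      unfolding Y0_def using m0 by linarith+
  qed
  have "0 < \<sigma>" unfolding \<sigma>_def using ss pos Y0 \<epsilon> E m0 K B0 by simp
  moreover have "B0 < B.per (s, A)"
    if s: "0 < s" "s < \<sigma>" and A: "0 < A" "A < B.amax s" and zero: "\<Phi> (s, A) = 0" for s A
  proof (rule ccontr)
    assume "\<not> B0 < B.per (s, A)"
    then have per: "B.per (s, A) \<le> B0" by simp
    have sm: "s < ss" "s < a1 / (2 * b1 * Y0)" "s < \<epsilon> / E" "s < m0\<^sup>2 / (2 * \<gamma> * c2)"
      "s < \<epsilon> * m0 * K / (c1 * B0)" using s(2) by (auto simp: \<sigma>_def)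
    have sI: "s \<in> {sa<..<sb}" using sm s strong_sa[OF iv strong] iv by (auto simp: interv_def)
    note o = y_ord[OF I_T[OF sI]]
    have b: "m0 < y2 s" "y2 s < M0" using y2_between[OF iv sI] by (auto simp: m0_def M0_def)
    \<comment> \<open>half of the asymptotic position of the upper saddle\<close>
    define Yc where "Yc = a1 / (2 * b1 * s)"
    have "Y0 < Yc" using sm(2) s pos Y0 by (simp add: Yc_def field_simps)
    have Yc: "1 \<le> Yc" "2 * M0 < Yc" "2 * (\<gamma> * a2 + ss * E) / a1 < Yc" using Y0 \<open>Y0 < Yc\<close> by linarith+
    have sE: "s * E \<le> \<epsilon>" using sm(3) E by (simp add: field_simps)
    have Y3: "Yc < y3 s"
    proof -
      have sb: "s * b1 * Yc = a1 / 2" using s pos by (simp add: Yc_def)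
      have "h s Yc = a1 * Yc - \<gamma> * a2 / Yc - (s * b1 * Yc) * Yc - s * (c1 - \<gamma> * b2) + s * (\<gamma> * c2) / Yc\<^sup>2"
        using Yc by (simp add: h_def k_def algebra_simps power2_eq_square)
      also have "\<dots> = a1 * Yc / 2 - \<gamma> * a2 / Yc - s * (c1 - \<gamma> * b2) + s * (\<gamma> * c2) / Yc\<^sup>2"
        unfolding sb by simp
      finally have hY: "h s Yc = a1 * Yc / 2 - \<gamma> * a2 / Yc - s * (c1 - \<gamma> * b2) + s * (\<gamma> * c2) / Yc\<^sup>2" .
      have "\<gamma> * a2 / Yc \<le> \<gamma> * a2 / 1" using Yc pos by (intro divide_left_mono) auto
      moreover have "s * (c1 - \<gamma> * b2) \<le> ss * E"
      proof -
        have "c1 - \<gamma> * b2 \<le> E" using E(2) by linarith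
        then have "s * (c1 - \<gamma> * b2) \<le> s * E" using s by (intro mult_left_mono) auto
        also have "\<dots> \<le> ss * E" using sm(1) E(1) by (intro mult_right_mono) auto
        finally show ?thesis .
      qed
      moreover have "0 \<le> s * (\<gamma> * c2) / Yc\<^sup>2" using s pos by simp
      moreover have "\<gamma> * a2 + ss * E < a1 * Yc / 2" using Yc(3) pos by (simp add: field_simps)
      ultimately have "0 < h s Yc" using hY by simp
      then show ?thesis
        using h_sign(4)[OF three_y[OF I_T[OF sI]] s(1), of Yc] three_y[OF I_T[OF sI]] Yc(1)
        by (cases Yc "y3 s" rule: linorder_cases) (auto simp: three_def)
    qed
    have y3: "1 \<le> y3 s" "2 * M0 \<le> y3 s" "a1 / 2 \<le> s * b1 * y3 s"
    proof -
      show "1 \<le> y3 s" "2 * M0 \<le> y3 s" using Y3 Yc by linarith+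
      have "a1 / 2 = s * b1 * Yc" using s pos by (simp add: Yc_def)
      also have "\<dots> \<le> s * b1 * y3 s" using Y3 s pos by (intro mult_left_mono) auto
      finally show "a1 / 2 \<le> s * b1 * y3 s" .
    qed
    have h3: "h s (y3 s) = 0" using three_y[OF I_T[OF sI]] by (simp add: three_def)
    \<comment> \<open>the remaining terms of \<open>h s (y3 s) = 0\<close> are of order \<open>s\<close>\<close>
    have low: "- \<epsilon> \<le> a1 - s * b1 * y3 s"
    proof -
      have "y3 s * (a1 - s * b1 * y3 s) = h s (y3 s) + \<gamma> * a2 / y3 s + s * (c1 - \<gamma> * b2) - s * (\<gamma> * c2 / (y3 s)\<^sup>2)"
        by (simp add: h_def k_def algebra_simps power2_eq_square)
      moreover have "0 \<le> \<gamma> * a2 / y3 s" using y3 pos by simp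
      moreover have "\<gamma> * c2 / (y3 s)\<^sup>2 \<le> \<gamma> * c2 / 1" using y3 pos by (intro divide_left_mono) auto
      then have "s * (\<gamma> * c2 / (y3 s)\<^sup>2) \<le> s * (\<gamma> * c2)" using s by (intro mult_left_mono) auto
      moreover have "- (s * \<bar>c1 - \<gamma> * b2\<bar>) \<le> s * (c1 - \<gamma> * b2)"
        using s by (metis abs_ge_minus_self abs_minus_cancel less_imp_le minus_le_iff mult_left_mono mult_minus_right)
      ultimately have "- (s * E) \<le> y3 s * (a1 - s * b1 * y3 s)" using h3 by (simp add: E_def algebra_simps)
      then have "- \<epsilon> \<le> y3 s * (a1 - s * b1 * y3 s)" using sE by linarith
      have "y3 s * x \<le> x" if "x < 0" for x using mult_right_mono_neg[of 1 "y3 s" x] y3(1) that by simp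
      from this[of "a1 - s * b1 * y3 s"] show ?thesis
        using \<open>- \<epsilon> \<le> y3 s * (a1 - s * b1 * y3 s)\<close> \<epsilon>(1) by linarith
    qed
    have hle: "h s y \<le> (4 * a1 + 1) * (y3 s - y)" if y: "y2 s \<le> y" "y \<le> y3 s" for y
    proof -
      have y0: "0 < y" "m0 < y" using y b m0 by linarith+
      have "h s y - h s (y3 s) = - (a1 + \<gamma> * a2 / (y * y3 s)) * (y3 s - y)
          + (s * (y3 s + y) * b1 + s * (y3 s + y) * (\<gamma> * c2 / (y\<^sup>2 * (y3 s)\<^sup>2))) * (y3 s - y)"
        if "0 < y3 s" unfolding h_def k_def using y0(1) that by (simp add: field_simps power2_eq_square)
      then have "h s y = - (a1 + \<gamma> * a2 / (y * y3 s)) * (y3 s - y)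
          + (s * (y3 s + y) * b1 + s * (y3 s + y) * (\<gamma> * c2 / (y\<^sup>2 * (y3 s)\<^sup>2))) * (y3 s - y)"
        using h3 y3(1) by simp
      also have "\<dots> \<le> 0 + (4 * a1 + 1) * (y3 s - y)"
      proof (intro add_mono mult_right_mono)
        have "0 \<le> \<gamma> * a2 / (y * y3 s)" using y0 y3 pos by simp
        then have "- (a1 + \<gamma> * a2 / (y * y3 s)) \<le> 0" using pos by linarith
        then show "- (a1 + \<gamma> * a2 / (y * y3 s)) * (y3 s - y) \<le> 0"
          by (rule mult_nonpos_nonneg) (use y in simp)
        have "s * (y3 s + y) * b1 \<le> s * (2 * y3 s) * b1"
          using s pos y by (intro mult_right_mono mult_left_mono) auto
        also have "\<dots> \<le> 4 * a1" using low \<epsilon>(2) by (simp add: algebra_simps)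
        finally show "s * (y3 s + y) * b1 \<le> 4 * a1" .
        have "s * (y3 s + y) * (\<gamma> * c2 / (y\<^sup>2 * (y3 s)\<^sup>2)) \<le> s * (2 * y3 s) * (\<gamma> * c2 / (m0\<^sup>2 * (y3 s)\<^sup>2))"
        proof (rule mult_mono)
          show "s * (y3 s + y) \<le> s * (2 * y3 s)" using s y by (intro mult_left_mono) auto
          have "m0\<^sup>2 \<le> y\<^sup>2" using y0 m0 by (intro power_mono) auto
          then have "m0\<^sup>2 * (y3 s)\<^sup>2 \<le> y\<^sup>2 * (y3 s)\<^sup>2" by (rule mult_right_mono) simp
          then show "\<gamma> * c2 / (y\<^sup>2 * (y3 s)\<^sup>2) \<le> \<gamma> * c2 / (m0\<^sup>2 * (y3 s)\<^sup>2)"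
            using pos m0 y3(1) y0 by (intro divide_left_mono) auto
          show "0 \<le> s * (2 * y3 s)" "0 \<le> \<gamma> * c2 / (y\<^sup>2 * (y3 s)\<^sup>2)" using s y3(1) pos by simp_all
        qed
        also have "\<dots> = 2 * \<gamma> * c2 * s / m0\<^sup>2 / y3 s" using y3(1) by (simp add: field_simps power2_eq_square)
        also have "\<dots> \<le> 2 * \<gamma> * c2 * s / m0\<^sup>2 / 1" using y3(1) s pos by (intro divide_left_mono) auto
        also have "\<dots> \<le> 1" using sm(4) pos m0 by (simp add: field_simps)
        finally show "s * (y3 s + y) * (\<gamma> * c2 / (y\<^sup>2 * (y3 s)\<^sup>2)) \<le> 1" .
      qed (use y in auto)
      finally show ?thesis by simp
    qed
    have Hq: "H s (y3 s) - H s y \<le> (L * (y3 s - y))\<^sup>2" if y: "y2 s \<le> y" "y \<le> y3 s" for y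
    proof (cases "y = y3 s")
      case False
      then have less: "y < y3 s" using y by simp
      obtain \<xi> where \<xi>: "y < \<xi>" "\<xi> < y3 s" "H s (y3 s) - H s y = (y3 s - y) * (h s \<xi> * zp \<xi>)"
      proof (rule MVT2[OF less, THEN exE])
        fix x assume "y \<le> x" "x \<le> y3 s"
        then have "0 < x" using y o by linarith
        then show "(H s has_real_derivative h s x * zp x) (at x)" by (rule H_deriv)
      qed (use that in blast)
      have \<xi>0: "0 < \<xi>" "m0 < \<xi>" using \<xi> y b m0 by linarith+
      have zle: "zp \<xi> \<le> \<delta> + \<gamma> / m0\<^sup>2"
        unfolding zp_def using \<xi>0 m0 pos by (intro add_left_mono divide_left_mono power_mono mult_pos_pos) auto
      have "h s \<xi> * zp \<xi> \<le> ((4 * a1 + 1) * (y3 s - \<xi>)) * (\<delta> + \<gamma> / m0\<^sup>2)"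
        using hle[of \<xi>] \<xi> y zle zp_pos[OF \<xi>0(1)] pos by (intro mult_mono) auto
      also have "\<dots> = L1 * (y3 s - \<xi>)" by (simp add: L1_def)
      also have "\<dots> \<le> L1 * (y3 s - y)" using \<xi> L1 by (intro mult_left_mono) auto
      finally have "(y3 s - y) * (h s \<xi> * zp \<xi>) \<le> (y3 s - y) * (L1 * (y3 s - y))"
        using y by (intro mult_left_mono) auto
      also have "\<dots> = L1 * (y3 s - y)\<^sup>2" by (simp add: power2_eq_square)
      also have "\<dots> \<le> L\<^sup>2 * (y3 s - y)\<^sup>2"
      proof (rule mult_right_mono)
        show "L1 \<le> L\<^sup>2" using L1 by (simp add: L_def power2_eq_square algebra_simps)
      qed simp
      finally show ?thesis using \<xi>(3) by (simp add: power_mult_distrib)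
    qed simp
    define w where "w = (s, A)"
    have w: "w \<in> B.\<Omega>" using sI A by (simp add: w_def B.\<Omega>_def)
    define q where "q = B.Y s A"
    have Ar: "B.G s (y1 s) < A" "A < B.G s (y3 s)" using A by (auto simp: B.amax_def)
    have q: "y1 s < q" "q < y3 s" "B.G s q = A"
      using B.Y_props_strict[OF sI Ar] B.Y_props(3)[OF sI] Ar by (simp_all add: q_def)
    have "\<delta> / L * (ln (y3 s - y2 s) - ln (y3 s - q)) \<le> B.per (s, A)"
      unfolding q_def
    proof (rule B.per_ge_log_hi[OF sI A pos(8) L])
      fix y assume y: "y2 s \<le> y" "y \<le> y3 s"
      then have "0 < y" using o by linarith
      then show "\<delta> \<le> zp y" using pos by (simp add: zp_def)
      show "H s (y3 s) - H s y \<le> (L * (y3 s - y))\<^sup>2" by (rule Hq[OF y])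
    qed
    then have "\<delta> / L * (ln (y3 s - y2 s) - ln (y3 s - q)) \<le> B0" using per by simp
    then have "ln (y3 s - y2 s) - B0 * L / \<delta> \<le> ln (y3 s - q)" proof -
      assume 1: "\<delta> / L * (ln (y3 s - y2 s) - ln (y3 s - q)) \<le> B0"
      have "ln (y3 s - y2 s) - ln (y3 s - q) = L / \<delta> * (\<delta> / L * (ln (y3 s - y2 s) - ln (y3 s - q)))"
        using pos L by simp
      also have "\<dots> \<le> L / \<delta> * B0" using pos L by (intro mult_left_mono[OF 1]) simp
      finally show ?thesis by (simp add: mult.commute)
    qed
    then have "exp (ln (y3 s - y2 s) - B0 * L / \<delta>) \<le> exp (ln (y3 s - q))"
      by (simp only: exp_le_cancel_iff)
    also have "\<dots> = y3 s - q" using q(2) by simp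
    finally have "exp (ln (y3 s - y2 s) - B0 * L / \<delta>) \<le> y3 s - q" .
    moreover have "exp (ln (y3 s - y2 s) + - (B0 * L / \<delta>)) = (y3 s - y2 s) * (2 * \<theta>)"
      unfolding exp_add using o by (simp add: \<theta>_def)
    ultimately have "(y3 s - y2 s) * (2 * \<theta>) \<le> y3 s - q" by simp
    moreover have "y3 s / 2 * (2 * \<theta>) \<le> (y3 s - y2 s) * (2 * \<theta>)"
      using y3(2) b \<theta> by (intro mult_right_mono) auto
    ultimately have gap: "\<theta> * y3 s \<le> y3 s - q" by (simp add: mult.commute)
    have fh_ge: "\<epsilon> * B.orb w \<alpha> - s * c1 \<le> fh s (B.orb w \<alpha>)" for \<alpha>
    proof -
      let ?y = "B.orb w \<alpha>"
      have r: "y1 s < ?y" "?y < y3 s" "0 < ?y" "B.G s ?y = - A * cos \<alpha>"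
        using B.orb_range[OF w, of \<alpha>] by (simp_all add: w_def)
      have "- A * cos \<alpha> \<le> A" using B.abs_Acos[of A \<alpha>] A by (simp add: abs_le_iff)
      then have "\<not> q < ?y" using B.G_less_iff[OF sI, of q ?y] q r by simp
      then have "\<theta> * y3 s \<le> y3 s - ?y" using gap by simp
      then have "s * b1 * (\<theta> * y3 s) \<le> s * b1 * (y3 s - ?y)" using s pos by (intro mult_left_mono) auto
      moreover have "\<theta> * (a1 / 2) \<le> \<theta> * (s * b1 * y3 s)" using y3(3) \<theta> by (intro mult_left_mono) auto
      ultimately have "\<epsilon> \<le> a1 - s * b1 * ?y" using low by (simp add: \<epsilon>_def algebra_simps)
      then have "?y * \<epsilon> \<le> ?y * (a1 - s * b1 * ?y)" using r by (intro mult_left_mono) auto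
      then show ?thesis by (simp add: fh_def algebra_simps power2_eq_square)
    qed
    let ?f = "\<lambda>\<alpha>. fh s (B.orb w \<alpha>) * B.kap w \<alpha>"
    have fc: "continuous_on UNIV ?f" using fh_orb_cont1[OF w] by (simp add: w_def)
    have kc: "continuous_on UNIV (\<lambda>\<alpha>. c * B.kap w \<alpha> + 0)" for c by (intro continuous_intros B.kap_cont1 w)
    have "prim (\<lambda>\<alpha>. - (s * c1) * B.kap w \<alpha> + 0) (pi / 2) - prim (\<lambda>\<alpha>. - (s * c1) * B.kap w \<alpha> + 0) 0
        \<le> prim ?f (pi / 2) - prim ?f 0"
    proof (rule prim_diff_le[OF kc fc])
      fix \<alpha>
      have "0 < B.orb w \<alpha>" using B.orb_range(3)[OF w] .
      then have "- (s * c1) \<le> fh s (B.orb w \<alpha>)"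
        using fh_ge[of \<alpha>] \<epsilon>(1) mult_pos_pos[of \<epsilon> "B.orb w \<alpha>"] by linarith
      then show "- (s * c1) * B.kap w \<alpha> + 0 \<le> ?f \<alpha>"
        using B.kap_pos[OF w, of \<alpha>] by (simp only: add_0_right) (intro mult_right_mono, auto)
    qed simp
    moreover have "prim (\<lambda>\<alpha>. (\<epsilon> * m0 - s * c1) * B.kap w \<alpha> + 0) pi
        - prim (\<lambda>\<alpha>. (\<epsilon> * m0 - s * c1) * B.kap w \<alpha> + 0) (pi / 2) \<le> prim ?f pi - prim ?f (pi / 2)"
    proof (rule prim_diff_le[OF kc fc])
      fix \<alpha> assume \<alpha>: "pi / 2 \<le> \<alpha>" "\<alpha> \<le> pi"
      have "cos \<alpha> \<le> 0" using \<alpha> cos_monotone_0_pi_le[of "pi / 2" \<alpha>] by auto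
      then have "\<not> B.G s (B.orb w \<alpha>) < B.G s (y2 s)"
        using B.orb_range(4)[OF w, of \<alpha>] A by (simp add: w_def mult_le_0_iff not_less)
      then have "y2 s \<le> B.orb w \<alpha>"
        using B.G_less_iff[OF sI, of "B.orb w \<alpha>" "y2 s"] B.orb_range(1,2)[OF w, of \<alpha>] o
        by (simp add: w_def)
      then have "\<epsilon> * m0 \<le> \<epsilon> * B.orb w \<alpha>" using b \<epsilon> by (intro mult_left_mono) auto
      then have "\<epsilon> * m0 - s * c1 \<le> fh s (B.orb w \<alpha>)" using fh_ge[of \<alpha>] by linarith
      then show "(\<epsilon> * m0 - s * c1) * B.kap w \<alpha> + 0 \<le> ?f \<alpha>"
        using B.kap_pos[OF w, of \<alpha>] by (simp only: add_0_right) (intro mult_right_mono, auto)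
    qed simp
    ultimately have sum: "\<epsilon> * m0 * (B.per w - prim (B.kap w) (pi / 2)) \<le> \<Phi> w + s * c1 * B.per w"
      unfolding prim_affine[OF B.kap_cont1[OF w]]
      by (simp add: \<Phi>_def B.per_def w_def algebra_simps)
    have "s * c1 * B0 < \<epsilon> * m0 * K" using sm(5) pos B0 by (simp add: field_simps)
    also have "\<dots> \<le> \<epsilon> * m0 * (B.per w - prim (B.kap w) (pi / 2))"
      using half_period_lower_bound[of s A] w A \<epsilon> m0
      by (intro mult_left_mono) (auto simp: K_def B.per_def w_def)
    also note sum
    also have "\<Phi> w + s * c1 * B.per w \<le> \<Phi> w + s * c1 * B0"
      using per s pos by (intro add_left_mono mult_left_mono) (auto simp: w_def)
    finally have "0 < \<Phi> w" by simp
    then show False using zero by (simp add: w_def)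
  qed
  ultimately show thesis using that by blast
qed

section \<open>Continua of zeros\<close>

text \<open>The second coordinate is the amplitude relative to its maximum, so that the parameters fill a rectangle.\<close>

definition amp :: "real \<times> real \<Rightarrow> real \<times> real" where
  "amp p = (fst p, snd p * B.amax (fst p))"

abbreviation Q :: "(real \<times> real) set" where "Q \<equiv> {sa<..<sb} \<times> {0<..<1}"

lemma amp_\<Omega>: "p \<in> Q \<Longrightarrow> amp p \<in> B.\<Omega> \<and> 0 < snd (amp p)"
  using \<Phi>_amplitude_cont(2)[OF subset_refl, of "fst p" "snd p"] B.amax_pos[of "fst p"]
  by (auto simp: amp_def intro!: mult_pos_pos)

lemma amp_cont: "continuous_on Q amp"
  unfolding amp_def[abs_def]
  by (intro continuous_intros continuous_on_compose2[OF B.amax_cont]) auto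

lemma \<Phi>_amp_cont: "continuous_on Q (\<lambda>p. \<kappa>0 * \<Phi> (amp p))"
  using amp_\<Omega> by (intro continuous_intros continuous_on_compose2[OF \<Phi>_cont amp_cont]) auto

text \<open>The right side of the rectangle may be taken as a line \<open>s = sr\<close> on which the sign is constant.\<close>

lemma separating_zero_set:
  assumes l: "sa < l" "l < ss" and t0: "0 < t0" "t0 < 1" and neg: "\<kappa>0 * \<Phi> (amp (l, t0)) < 0"
  obtains sr C where "ss < sr" "sr < sb" "connected C" "C \<subseteq> {p \<in> Q. \<Phi> (amp p) = 0}"
    "\<And>S. connected S \<Longrightarrow> S \<subseteq> Q \<Longrightarrow> (l, t0) \<in> S \<Longrightarrow> (sr, t0) \<in> S \<Longrightarrow> S \<inter> C \<noteq> {}"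
    "\<And>t. 0 < t \<Longrightarrow> t < 1 \<Longrightarrow> 0 < \<kappa>0 * \<Phi> (amp (sr, t))"
proof -
  have sb: "ss < sb" "0 < sb" using ss_I ss by auto
  obtain \<eta> where \<eta>: "0 < \<eta>"
    "\<And>s A. s \<in> {sa<..<sb} \<Longrightarrow> \<bar>s - sb\<bar> < \<eta> \<Longrightarrow> \<bar>A\<bar> < B.amax s \<Longrightarrow> 0 < \<kappa>0 * (s - ss) * \<Phi> (s, A)"
    using \<Phi>_sign_near_end[of sb] sb by blast
  define sr where "sr = max ((ss + sb) / 2) (sb - \<eta> / 2)"
  have "(ss + sb) / 2 \<le> sr" "sb - \<eta> / 2 \<le> sr" "sr < sb" using sb \<eta>(1) by (auto simp: sr_def)
  then have sr: "ss < sr" "sr < sb" "\<bar>sr - sb\<bar> < \<eta>" using sb \<eta>(1) by auto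
  have srI: "sr \<in> {sa<..<sb}" using sr ss_I by auto
  have right: "0 < \<kappa>0 * \<Phi> (amp (sr, t))" if t: "0 < t" "t < 1" for t
  proof -
    have "\<bar>t * B.amax sr\<bar> < B.amax sr" using t B.amax_pos[OF srI] by (simp add: abs_mult)
    then have "0 < \<kappa>0 * (sr - ss) * \<Phi> (sr, t * B.amax sr)" by (rule \<eta>(2)[OF srI sr(3)])
    then have "0 < (sr - ss) * (\<kappa>0 * \<Phi> (sr, t * B.amax sr))" by (simp only: mult_ac)
    then have "0 < \<kappa>0 * \<Phi> (sr, t * B.amax sr)" by (rule zero_less_mult_pos) (use sr in simp)
    then show ?thesis by (simp add: amp_def)
  qed
  have Qbox: "box (sa, 0) (sb, 1) = Q" by (rule box_real_Pair)
  have mem: "(l, t0) \<in> Q" "(sr, t0) \<in> Q" using l t0 sr srI sb by auto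
  obtain C where C: "connected C" "C \<subseteq> {w \<in> Q. \<kappa>0 * \<Phi> (amp w) = 0}"
    "\<And>S. connected S \<Longrightarrow> S \<subseteq> Q \<Longrightarrow> (l, t0) \<in> S \<Longrightarrow> (sr, t0) \<in> S \<Longrightarrow> S \<inter> C \<noteq> {}"
    using zero_set_component_separates[of "(sa, 0)" "(sb, 1)" "\<lambda>p. \<kappa>0 * \<Phi> (amp p)" "(l, t0)" "(sr, t0)",
        unfolded Qbox, OF \<Phi>_amp_cont mem neg right[OF t0]] by blast
  show thesis
    by (rule that[OF sr(1,2) C(1) _ C(3) right]) (use C(2) \<kappa>0_nz in auto)
qed

text \<open>The path goes from \<open>(l, t0)\<close> to the level \<open>t\<close>, along that level to \<open>s = sr\<close>, and back to \<open>(sr, t0)\<close>. Zeros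
are possible on its horizontal part only.\<close>

lemma level_crossing:
  assumes l: "sa < l" "l < ss" and sr: "ss < sr" "sr < sb" and t0: "0 < t0" "t0 < 1" and t: "0 < t" "t < 1"
    and C: "C \<subseteq> {p \<in> Q. \<Phi> (amp p) = 0}"
      "\<And>S. connected S \<Longrightarrow> S \<subseteq> Q \<Longrightarrow> (l, t0) \<in> S \<Longrightarrow> (sr, t0) \<in> S \<Longrightarrow> S \<inter> C \<noteq> {}"
    and left: "\<And>t'. t' \<in> closed_segment t0 t \<Longrightarrow> \<Phi> (amp (l, t')) \<noteq> 0"
    and right: "\<And>t'. 0 < t' \<Longrightarrow> t' < 1 \<Longrightarrow> \<Phi> (amp (sr, t')) \<noteq> 0"
  shows "\<exists>s\<in>{l..sr}. (s, t) \<in> C"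
proof -
  let ?seg = "closed_segment t0 t"
  have seg: "\<And>t'. t' \<in> ?seg \<Longrightarrow> 0 < t' \<and> t' < 1"
    using t0 t by (auto simp: closed_segment_eq_real_ivl split: if_splits)
  have ends: "t0 \<in> ?seg" "t \<in> ?seg" by auto
  let ?S = "{l} \<times> ?seg \<union> ({l..sr} \<times> {t} \<union> {sr} \<times> ?seg)"
  have c: "connected ({l} \<times> ?seg)" "connected ({l..sr} \<times> {t})" "connected ({sr} \<times> ?seg)"
    by (intro connected_Times connected_Icc connected_segment connected_sing)+
  have "(sr, t) \<in> ({l..sr} \<times> {t}) \<inter> ({sr} \<times> ?seg)" using l sr by auto
  then have "connected ({l..sr} \<times> {t} \<union> {sr} \<times> ?seg)" by (intro connected_Un[OF c(2,3)]) blast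
  moreover have "(l, t) \<in> ({l} \<times> ?seg) \<inter> ({l..sr} \<times> {t} \<union> {sr} \<times> ?seg)" using l sr by auto
  ultimately have "connected ?S" by (intro connected_Un[OF c(1)]) blast+
  moreover have "?S \<subseteq> Q" using seg l sr t by auto
  moreover have "(l, t0) \<in> ?S" "(sr, t0) \<in> ?S" by auto
  ultimately have "?S \<inter> C \<noteq> {}" by (rule C(2))
  then obtain p where p: "p \<in> ?S" "p \<in> C" by blast
  have "\<Phi> (amp p) = 0" using p C(1) by blast
  then show ?thesis using p left right seg by auto
qed

text \<open>Points of the component with \<open>t \<rightarrow> 0\<close> have a limit \<open>(z, 0)\<close> with \<open>\<Phi> (z, 0) = 0\<close>, and \<open>ss\<close> is the only such \<open>z\<close>.\<close>

lemma centre_in_closure: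
  assumes l: "sa < l" "sr < sb" and t0: "0 < t0" "t0 < 1"
    and C: "C \<subseteq> {p \<in> Q. \<Phi> (amp p) = 0}"
    and cross: "\<And>t. 0 < t \<Longrightarrow> t \<le> t0 \<Longrightarrow> \<exists>s\<in>{l..sr}. (s, t) \<in> C"
  shows "(ss, 0) \<in> closure (amp ` C)"
proof -
  define t where "t n = t0 / real (Suc n)" for n
  have t: "0 < t n" "t n \<le> t0" for n using t0 by (auto simp: t_def divide_le_eq)
  have t_lim: "t \<longlonglongrightarrow> 0" unfolding t_def by (rule LIMSEQ_Suc[OF lim_const_over_n])
  obtain s where s: "\<And>n. s n \<in> {l..sr}" "\<And>n. (s n, t n) \<in> C" using cross[OF t] by metis
  obtain z \<rho> where z: "z \<in> {l..sr}" "strict_mono \<rho>" "(s \<circ> \<rho>) \<longlonglongrightarrow> z"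
    using seq_compactE[OF compact_imp_seq_compact[OF compact_Icc], of s l sr] s(1) by blast
  have zI: "z \<in> {sa<..<sb}" using z(1) l by auto
  have lim: "(\<lambda>n. amp (s (\<rho> n), t (\<rho> n))) \<longlonglongrightarrow> (z, 0)"
  proof -
    have "(\<lambda>n. B.amax (s (\<rho> n))) \<longlonglongrightarrow> B.amax z"
    proof (rule continuous_on_tendsto_compose[OF B.amax_cont z(3)[unfolded o_def] zI])
      have "s (\<rho> n) \<in> {sa<..<sb}" for n using s(1)[of "\<rho> n"] l by auto
      then show "\<forall>\<^sub>F n in sequentially. s (\<rho> n) \<in> {sa<..<sb}" by (intro always_eventually) blast
    qed
    moreover have "(\<lambda>n. t (\<rho> n)) \<longlonglongrightarrow> 0" using LIMSEQ_subseq_LIMSEQ[OF t_lim z(2)] by (simp add: o_def)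
    ultimately have "(\<lambda>n. t (\<rho> n) * B.amax (s (\<rho> n))) \<longlonglongrightarrow> 0 * B.amax z" by (intro tendsto_mult)
    then show ?thesis using z(3) by (auto simp: amp_def o_def intro!: tendsto_Pair)
  qed
  have inC: "(s (\<rho> n), t (\<rho> n)) \<in> C" for n by (rule s(2))
  have in\<Omega>: "amp (s (\<rho> n), t (\<rho> n)) \<in> B.\<Omega>" "\<Phi> (amp (s (\<rho> n), t (\<rho> n))) = 0" for n
    using amp_\<Omega> inC[of n] C by blast+
  have "(\<lambda>n. \<Phi> (amp (s (\<rho> n), t (\<rho> n)))) \<longlonglongrightarrow> \<Phi> (z, 0)"
    using continuous_on_tendsto_compose[OF \<Phi>_cont lim B.\<Omega>_center[OF zI]] in\<Omega> by (simp add: always_eventually)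
  then have "\<Phi> (z, 0) = 0" using in\<Omega>(2) by (simp add: LIMSEQ_const_iff)
  then have "z = ss" using \<Phi>_center[OF zI] by force
  then show ?thesis using lim inC unfolding closure_sequential
    by (intro exI[of _ "\<lambda>n. amp (s (\<rho> n), t (\<rho> n))"]) auto
qed

text \<open>The set of parameters of a continuum of solutions that has the constant solution in its closure and contains
a sequence with half periods tending to infinity; \<open>\<sigma>\<close> is the limit of \<open>sqrt \<tau>\<close> along that sequence.\<close>

definition branch :: "(real \<times> real) set \<Rightarrow> real \<Rightarrow> bool" where
  "branch C \<sigma> \<longleftrightarrow> connected C \<and> C \<subseteq> {w \<in> B.\<Omega>. 0 < snd w \<and> \<Phi> w = 0} \<and> (ss, 0) \<in> closure C \<and>
    (\<exists>w. (\<forall>n :: nat. w n \<in> C) \<and> filterlim (\<lambda>n. B.per (w n)) at_top sequentially \<and> (\<lambda>n. fst (w n)) \<longlonglongrightarrow> \<sigma>)"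

lemma branch_amp:
  assumes "connected C" "C \<subseteq> {p \<in> Q. \<Phi> (amp p) = 0}" "(ss, 0) \<in> closure (amp ` C)"
    and "\<And>n. p n \<in> C" "filterlim (\<lambda>n. B.per (amp (p n))) at_top sequentially" "(\<lambda>n. fst (p n)) \<longlonglongrightarrow> \<sigma>"
  shows "branch (amp ` C) \<sigma>"
  unfolding branch_def
proof (intro conjI)
  show "connected (amp ` C)"
    using assms(1,2) by (intro connected_continuous_image continuous_on_subset[OF amp_cont]) auto
  show "amp ` C \<subseteq> {w \<in> B.\<Omega>. 0 < snd w \<and> \<Phi> w = 0}" using assms(2) amp_\<Omega> by auto
  show "\<exists>w. (\<forall>n. w n \<in> amp ` C) \<and> filterlim (\<lambda>n. B.per (w n)) at_top sequentially \<and> (\<lambda>n. fst (w n)) \<longlonglongrightarrow> \<sigma>"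
    using assms(4-6) by (intro exI[of _ "\<lambda>n. amp (p n)"]) (auto simp: amp_def)
qed (rule assms(3))

lemma weak_branch:
  assumes weak: "0 < \<kappa>0"
  obtains C \<sigma> where "0 < \<sigma>" "branch C \<sigma>"
proof -
  have sa: "0 < sa" by (rule weak_sa_pos[OF iv weak])
  obtain \<eta> where \<eta>: "0 < \<eta>"
    "\<And>s A. s \<in> {sa<..<sb} \<Longrightarrow> \<bar>s - sa\<bar> < \<eta> \<Longrightarrow> \<bar>A\<bar> < B.amax s \<Longrightarrow> 0 < \<kappa>0 * (s - ss) * \<Phi> (s, A)"
    using \<Phi>_sign_near_end[of sa] sa by blast
  define l where "l = min ((sa + ss) / 2) (sa + \<eta> / 2)"
  have "l \<le> (sa + ss) / 2" unfolding l_def by (rule min.cobounded1)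
  moreover have "l \<le> sa + \<eta> / 2" unfolding l_def by (rule min.cobounded2)
  moreover have "sa < l" using ss_I \<eta>(1) by (simp add: l_def)
  ultimately have l: "sa < l" "l < ss" "\<bar>l - sa\<bar> < \<eta>" using ss_I \<eta>(1) by auto
  have lI: "l \<in> {sa<..<sb}" using l ss_I by auto
  have left: "\<kappa>0 * \<Phi> (amp (l, t)) < 0" if t: "0 < t" "t < 1" for t
  proof -
    have "\<bar>t * B.amax l\<bar> < B.amax l" using t B.amax_pos[OF lI] by (simp add: abs_mult)
    then have "0 < \<kappa>0 * (l - ss) * \<Phi> (l, t * B.amax l)" by (rule \<eta>(2)[OF lI l(3)])
    then have "0 < (l - ss) * (\<kappa>0 * \<Phi> (l, t * B.amax l))" by (simp only: mult_ac)
    then show ?thesis using l(2) unfolding amp_def by (simp add: zero_less_mult_iff)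
  qed
  have half: "0 < (1 / 2 :: real)" "1 / 2 < (1 :: real)" by auto
  obtain sr C where sr: "ss < sr" "sr < sb" and C: "connected C" "C \<subseteq> {p \<in> Q. \<Phi> (amp p) = 0}"
    "\<And>S. connected S \<Longrightarrow> S \<subseteq> Q \<Longrightarrow> (l, 1 / 2) \<in> S \<Longrightarrow> (sr, 1 / 2) \<in> S \<Longrightarrow> S \<inter> C \<noteq> {}"
    and right: "\<And>t. 0 < t \<Longrightarrow> t < 1 \<Longrightarrow> 0 < \<kappa>0 * \<Phi> (amp (sr, t))"
    by (rule separating_zero_set[OF l(1,2) half left[OF half]], rule that) blast+
  have cross: "\<exists>s\<in>{l..sr}. (s, t) \<in> C" if t: "0 < t" "t < 1" for t
  proof (rule level_crossing[OF l(1,2) sr half t C(2,3)])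
    show "\<Phi> (amp (l, t')) \<noteq> 0" if "t' \<in> closed_segment (1 / 2) t" for t'
      using left[of t'] that t by (auto simp: closed_segment_eq_real_ivl split: if_splits)
    show "\<Phi> (amp (sr, t')) \<noteq> 0" if "0 < t'" "t' < 1" for t' using right[OF that] by auto
  qed
  define t where "t n = 1 - 1 / real (Suc (Suc n))" for n
  have t: "0 < t n" "t n < 1" for n by (auto simp: t_def)
  have t_lim: "t \<longlonglongrightarrow> 1"
  proof -
    have "(\<lambda>n. 1 / real (Suc (Suc n))) \<longlonglongrightarrow> 0" by (rule LIMSEQ_Suc[OF LIMSEQ_Suc[OF lim_const_over_n]])
    from tendsto_diff[OF tendsto_const this, of 1] show ?thesis by (simp add: t_def[abs_def])
  qed
  obtain s where s: "\<And>n. s n \<in> {l..sr}" "\<And>n. (s n, t n) \<in> C" using cross[OF t] by metis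
  obtain z \<rho> where z: "z \<in> {l..sr}" "strict_mono \<rho>" "(s \<circ> \<rho>) \<longlonglongrightarrow> z"
    using seq_compactE[OF compact_imp_seq_compact[OF compact_Icc], of s l sr] s(1) by blast
  have t\<rho>: "(\<lambda>n. t (\<rho> n)) \<longlonglongrightarrow> 1" using LIMSEQ_subseq_LIMSEQ[OF t_lim z(2)] by (simp add: o_def)
  have J: "{l..sr} \<subseteq> {sa<..<sb}" using l sr by auto
  have blow: "filterlim (\<lambda>n. B.per (amp (s (\<rho> n), t (\<rho> n)))) at_top sequentially"
    unfolding filterlim_at_top
  proof
    fix P :: real
    obtain \<epsilon> where \<epsilon>: "0 < \<epsilon>" "\<epsilon> < 1"
      "\<And>s A. s \<in> {l..sr} \<Longrightarrow> (1 - \<epsilon>) * B.amax s < A \<Longrightarrow> A < B.amax s \<Longrightarrow> P < B.per (s, A)"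
      by (rule B.per_blowup[OF compact_Icc J, of P], rule that) blast+
    have "eventually (\<lambda>n. 1 - \<epsilon> < t (\<rho> n)) sequentially"
      using \<epsilon>(1) by (intro order_tendstoD(1)[OF t\<rho>]) simp
    then show "eventually (\<lambda>n. P \<le> B.per (amp (s (\<rho> n), t (\<rho> n)))) sequentially"
    proof eventually_elim
      case (elim n)
      have a: "0 < B.amax (s (\<rho> n))" using J s(1)[of "\<rho> n"] by (intro B.amax_pos) auto
      have "P < B.per (s (\<rho> n), t (\<rho> n) * B.amax (s (\<rho> n)))"
        using elim a t[of "\<rho> n"] by (intro \<epsilon>(3) s(1) mult_strict_right_mono) auto
      then show ?case by (simp add: amp_def)
    qed
  qed
  have "branch (amp ` C) z"
  proof (rule branch_amp[OF C(1,2) _ _ blow])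
    show "(ss, 0) \<in> closure (amp ` C)"
      using cross by (intro centre_in_closure[OF l(1) sr(2) half C(2)]) auto
    show "(s (\<rho> n), t (\<rho> n)) \<in> C" for n by (rule s(2))
    show "(\<lambda>n. fst (s (\<rho> n), t (\<rho> n))) \<longlonglongrightarrow> z" using z(3) by (simp add: o_def)
  qed
  moreover have "0 < z" using z(1) l(1) sa by auto
  ultimately show thesis using that by blast
qed

text \<open>For \<open>0 < \<sigma> < l\<close> consider the path that goes from \<open>(l, t0)\<close> down to a small \<open>t\<close>, left to \<open>s = \<sigma>\<close>, up to \<open>t\<close> near
\<open>1\<close>, right to \<open>s = sr\<close> and back to \<open>(sr, t0)\<close>. Its other four parts lie in regions of constant sign, so the
component meets it at \<open>s = \<sigma>\<close>.\<close>

lemma strong_branch: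
  assumes strong: "\<kappa>0 < 0"
  obtains C where "branch C 0"
proof -
  have sa: "sa = 0" by (rule strong_sa[OF iv strong])
  define l where "l = ss / 2"
  have l: "sa < l" "l < ss" using ss by (auto simp: l_def sa)
  have lI: "{l} \<subseteq> {sa<..<sb}" using l ss_I by auto
  obtain t0 where t0: "0 < t0" "t0 < 1" and left: "\<And>t. 0 \<le> t \<Longrightarrow> t \<le> t0 \<Longrightarrow> \<kappa>0 * \<Phi> (l, t * B.amax l) < 0"
    using \<Phi>_sign_small_amplitude[OF compact_sing lI] l by (metis singletonD singletonI)
  have neg: "\<kappa>0 * \<Phi> (amp (l, t0)) < 0" using left[of t0] t0 by (simp add: amp_def)
  obtain sr C where sr: "ss < sr" "sr < sb" and C: "connected C" "C \<subseteq> {p \<in> Q. \<Phi> (amp p) = 0}"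
    "\<And>S. connected S \<Longrightarrow> S \<subseteq> Q \<Longrightarrow> (l, t0) \<in> S \<Longrightarrow> (sr, t0) \<in> S \<Longrightarrow> S \<inter> C \<noteq> {}"
    and right: "\<And>t. 0 < t \<Longrightarrow> t < 1 \<Longrightarrow> 0 < \<kappa>0 * \<Phi> (amp (sr, t))"
    by (rule separating_zero_set[OF l t0 neg], rule that) blast+
  have cross: "\<exists>s\<in>{l..sr}. (s, t) \<in> C" if t: "0 < t" "t \<le> t0" for t
  proof (rule level_crossing[OF l sr t0 t(1) _ C(2,3)])
    show "t < 1" using t t0 by simp
    show "\<Phi> (amp (l, t')) \<noteq> 0" if "t' \<in> closed_segment t0 t" for t'
      using left[of t'] that t by (auto simp: closed_segment_eq_real_ivl amp_def split: if_splits)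
    show "\<Phi> (amp (sr, t')) \<noteq> 0" if "0 < t'" "t' < 1" for t' using right[OF that] by auto
  qed
  have exit: "\<exists>t. (\<sigma>, t) \<in> C" if \<sigma>: "0 < \<sigma>" "\<sigma> < l" for \<sigma>
  proof -
    have J1: "{\<sigma>..l} \<subseteq> {sa<..<sb}" and J2: "{\<sigma>..sr} \<subseteq> {sa<..<sb}" using \<sigma> l sr sa by auto
    obtain \<eta> where \<eta>: "0 < \<eta>" "\<eta> < 1"
      "\<And>s t. s \<in> {\<sigma>..l} \<Longrightarrow> 0 \<le> t \<Longrightarrow> t \<le> \<eta> \<Longrightarrow> \<kappa>0 * \<Phi> (s, t * B.amax s) < 0"
      by (rule \<Phi>_sign_small_amplitude[OF compact_Icc J1]) (use l in auto)
    obtain P where P: "\<And>w. w \<in> B.\<Omega> \<Longrightarrow> fst w \<in> {\<sigma>..sr} \<Longrightarrow> P < B.per w \<Longrightarrow> \<Phi> w < 0"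
      by (rule per_large_imp_\<Phi>_neg[OF strong compact_Icc J2]) blast
    obtain \<epsilon> where \<epsilon>: "0 < \<epsilon>" "\<epsilon> < 1"
      "\<And>s A. s \<in> {\<sigma>..sr} \<Longrightarrow> (1 - \<epsilon>) * B.amax s < A \<Longrightarrow> A < B.amax s \<Longrightarrow> P < B.per (s, A)"
      by (rule B.per_blowup[OF compact_Icc J2, of P], rule that) blast+
    define t1 where "t1 = min \<eta> t0"
    define t2 where "t2 = max (1 - \<epsilon> / 2) t0"
    have t1: "0 < t1" "t1 \<le> \<eta>" "t1 \<le> t0" using \<eta> t0 by (auto simp: t1_def)
    have t2: "t0 \<le> t2" "1 - \<epsilon> < t2" "t2 < 1" using \<epsilon> t0 by (auto simp: t2_def)
    have top: "\<Phi> (amp (s, t2)) \<noteq> 0" if s: "s \<in> {\<sigma>..sr}" for s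
    proof -
      have a: "0 < B.amax s" using J2 s by (intro B.amax_pos) auto
      have "P < B.per (s, t2 * B.amax s)"
        using t2 t1 t0 a by (intro \<epsilon>(3)[OF s] mult_strict_right_mono) auto
      moreover have "amp (s, t2) \<in> B.\<Omega>" using amp_\<Omega>[of "(s, t2)"] s J2 t2 t0 by auto
      ultimately show ?thesis using P[of "amp (s, t2)"] s by (simp add: amp_def)
    qed
    \<comment> \<open>the five parts of the path, in the order in which they are run through\<close>
    let ?S1 = "{l} \<times> {t1..t0}" and ?S2 = "{\<sigma>..l} \<times> {t1}" and ?S3 = "{\<sigma>} \<times> {t1..t2}"
      and ?S4 = "{\<sigma>..sr} \<times> {t2}" and ?S5 = "{sr} \<times> {t0..t2}"
    have "(l, t1) \<in> ?S1 \<inter> (?S2 \<union> (?S3 \<union> (?S4 \<union> ?S5)))" "(\<sigma>, t1) \<in> ?S2 \<inter> (?S3 \<union> (?S4 \<union> ?S5))"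
      "(\<sigma>, t2) \<in> ?S3 \<inter> (?S4 \<union> ?S5)" "(sr, t2) \<in> ?S4 \<inter> ?S5"
      using \<sigma> t1 t2 l sr by auto
    then have ne: "?S1 \<inter> (?S2 \<union> (?S3 \<union> (?S4 \<union> ?S5))) \<noteq> {}" "?S2 \<inter> (?S3 \<union> (?S4 \<union> ?S5)) \<noteq> {}"
      "?S3 \<inter> (?S4 \<union> ?S5) \<noteq> {}" "?S4 \<inter> ?S5 \<noteq> {}" by blast+
    have "connected (?S1 \<union> (?S2 \<union> (?S3 \<union> (?S4 \<union> ?S5))))"
      by (intro connected_Un ne connected_Times connected_Icc connected_sing)
    moreover have "?S1 \<union> (?S2 \<union> (?S3 \<union> (?S4 \<union> ?S5))) \<subseteq> Q"
      using \<sigma> t1 t2 t0 l sr sa by auto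
    moreover have "(l, t0) \<in> ?S1 \<union> (?S2 \<union> (?S3 \<union> (?S4 \<union> ?S5)))" "(sr, t0) \<in> ?S1 \<union> (?S2 \<union> (?S3 \<union> (?S4 \<union> ?S5)))"
      using t1 t2 by auto
    ultimately have "(?S1 \<union> (?S2 \<union> (?S3 \<union> (?S4 \<union> ?S5)))) \<inter> C \<noteq> {}" by (rule C(3))
    then obtain p where p: "p \<in> ?S1 \<union> (?S2 \<union> (?S3 \<union> (?S4 \<union> ?S5)))" "p \<in> C" by blast
    have zero: "\<Phi> (amp p) = 0" using p C(2) by blast
    have "p \<notin> ?S1"
    proof
      assume "p \<in> ?S1"
      then obtain t where "p = (l, t)" "t1 \<le> t" "t \<le> t0" by auto
      then show False using left[of t] zero t1 by (simp add: amp_def)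
    qed
    moreover have "p \<notin> ?S2"
    proof
      assume "p \<in> ?S2"
      then obtain s where "p = (s, t1)" "s \<in> {\<sigma>..l}" by auto
      then show False using \<eta>(3)[of s t1] zero t1 by (simp add: amp_def)
    qed
    moreover have "p \<notin> ?S4" using top zero by auto
    moreover have "p \<notin> ?S5"
    proof
      assume "p \<in> ?S5"
      then obtain t where "p = (sr, t)" "t0 \<le> t" "t \<le> t2" by auto
      then show False using right[of t] zero t0 t2 by simp
    qed
    ultimately show ?thesis using p by auto
  qed
  define \<sigma> where "\<sigma> n = l / real (Suc (Suc n))" for n
  have \<sigma>: "0 < \<sigma> n" "\<sigma> n < l" for n using l sa by (auto simp: \<sigma>_def divide_less_eq)
  have \<sigma>_lim: "\<sigma> \<longlonglongrightarrow> 0" unfolding \<sigma>_def by (rule LIMSEQ_Suc[OF LIMSEQ_Suc[OF lim_const_over_n]])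
  obtain t where t: "\<And>n. (\<sigma> n, t n) \<in> C" using exit[OF \<sigma>] by metis
  have blow: "filterlim (\<lambda>n. B.per (amp (\<sigma> n, t n))) at_top sequentially"
    unfolding filterlim_at_top
  proof
    fix P :: real
    have "0 < max P 1" by simp
    then obtain \<beta> where \<beta>: "0 < \<beta>"
      "\<And>s A. 0 < s \<Longrightarrow> s < \<beta> \<Longrightarrow> 0 < A \<Longrightarrow> A < B.amax s \<Longrightarrow> \<Phi> (s, A) = 0 \<Longrightarrow> max P 1 < B.per (s, A)"
      using per_blowup_small_s[OF strong] by blast
    have "eventually (\<lambda>n. \<sigma> n < \<beta>) sequentially" by (rule order_tendstoD(2)[OF \<sigma>_lim \<beta>(1)])
    then show "eventually (\<lambda>n. P \<le> B.per (amp (\<sigma> n, t n))) sequentially"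
    proof eventually_elim
      case (elim n)
      have w: "amp (\<sigma> n, t n) \<in> B.\<Omega> \<and> 0 < snd (amp (\<sigma> n, t n))" "\<Phi> (amp (\<sigma> n, t n)) = 0"
        using t[of n] C(2) amp_\<Omega> by blast+
      have "max P 1 < B.per (\<sigma> n, t n * B.amax (\<sigma> n))"
        using w elim by (intro \<beta>(2) \<sigma>(1)) (auto simp: amp_def B.\<Omega>_def)
      then show ?case by (simp add: amp_def)
    qed
  qed
  have "branch (amp ` C) 0"
  proof (rule branch_amp[OF C(1,2) _ t blow])
    show "(ss, 0) \<in> closure (amp ` C)"
      by (rule centre_in_closure[OF l(1) sr(2) t0 C(2) cross])
    show "(\<lambda>n. fst (\<sigma> n, t n)) \<longlonglongrightarrow> 0" using \<sigma>_lim by simp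
  qed
  then show thesis by (rule that)
qed

lemma branch_solutions:
  assumes b: "branch C \<sigma>" and j: "1 \<le> j"
  shows "\<exists>\<Gamma>p \<Gamma>m. connected \<Gamma>p \<and> connected \<Gamma>m \<and>
    \<Gamma>p \<subseteq> S_plus a1 a2 b1 b2 c1 c2 \<gamma> \<delta> j \<and> \<Gamma>m \<subseteq> S_minus a1 a2 b1 b2 c1 c2 \<gamma> \<delta> j \<and>
    \<Theta> j (ss, 0) \<in> closure \<Gamma>p \<and>
    (\<exists>(d :: nat \<Rightarrow> real) u \<tau>. (\<forall>n. (d n, u n, \<tau> n) \<in> \<Gamma>p) \<and> d \<longlonglongrightarrow> 0 \<and> \<tau> \<longlonglongrightarrow> \<sigma>\<^sup>2) \<and>
    \<Gamma>m = (\<lambda>(d, u, \<tau>). (d, shift_C1 j u, \<tau>)) ` \<Gamma>p"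
proof -
  have C: "connected C" "C \<subseteq> B.\<Omega>" "\<And>w. w \<in> C \<Longrightarrow> 0 < snd w \<and> \<Phi> w = 0" "(ss, 0) \<in> closure C"
    using b by (auto simp: branch_def)
  obtain w where w: "\<And>n :: nat. w n \<in> C" "filterlim (\<lambda>n. B.per (w n)) at_top sequentially"
    "(\<lambda>n. fst (w n)) \<longlonglongrightarrow> \<sigma>" using b by (auto simp: branch_def)
  define \<nu> where "\<nu> = (\<lambda>w :: real \<times> real. (fst w, - snd w))"
  have \<nu>: "\<nu> w \<in> B.\<Omega>" "\<Phi> (\<nu> w) = 0" "snd (\<nu> w) < 0" if "w \<in> C" for w
    using C(2) C(3)[OF that] that B.\<Omega>_uminus[of "fst w" "snd w"] \<Phi>_uminus[of "fst w" "snd w"]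
    by (auto simp: \<nu>_def)
  have c\<nu>: "continuous_on C \<nu>" unfolding \<nu>_def by (intro continuous_intros)
  let ?p = "\<Theta> j ` C" and ?m = "(\<lambda>w. \<Theta> j (\<nu> w)) ` C"
  have d0: "(\<lambda>n. diff j (w n)) \<longlonglongrightarrow> 0"
  proof -
    have "filterlim (\<lambda>n. real j * B.per (w n)) at_top sequentially"
      using j w(2) by (intro filterlim_tendsto_pos_mult_at_top[OF tendsto_const]) auto
    then have "filterlim (\<lambda>n. (real j * B.per (w n))\<^sup>2) at_top sequentially"
      by (intro filterlim_pow_at_top) auto
    then show ?thesis unfolding diff_def
      by (intro tendsto_divide_0[OF tendsto_const] filterlim_at_top_imp_at_infinity)
  qed
  show ?thesis
  proof (rule exI[of _ ?p], rule exI[of _ ?m], intro conjI)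
    show "connected ?p"
      using C by (intro connected_continuous_image continuous_on_subset[OF \<Theta>_cont[OF j]])
    show "connected ?m"
      using C(1) \<nu>(1) by (intro connected_continuous_image continuous_on_compose2[OF \<Theta>_cont[OF j] c\<nu>]) auto
    show "?p \<subseteq> S_plus a1 a2 b1 b2 c1 c2 \<gamma> \<delta> j" using C by (auto intro!: \<Theta>_S_plus[OF j])
    show "?m \<subseteq> S_minus a1 a2 b1 b2 c1 c2 \<gamma> \<delta> j" using \<nu> by (auto intro!: \<Theta>_S_minus[OF j])
    show "\<Theta> j (ss, 0) \<in> closure ?p"
      by (rule continuous_on_closure_image[OF \<Theta>_cont[OF j] C(2,4) B.\<Omega>_center[OF ss_I]])
    show "?m = (\<lambda>(d, u, \<tau>). (d, shift_C1 j u, \<tau>)) ` ?p"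
    proof -
      have "\<Theta> j (\<nu> w) = (\<lambda>(d, u, \<tau>). (d, shift_C1 j u, \<tau>)) (\<Theta> j w)" if "w \<in> C" for w
        using shift_\<Theta>[OF j, of "fst w" "snd w"] C(2) that by (auto simp: \<nu>_def)
      then show ?thesis unfolding image_image by (intro image_cong refl)
    qed
    show "\<exists>(d :: nat \<Rightarrow> real) u \<tau>. (\<forall>n. (d n, u n, \<tau> n) \<in> ?p) \<and> d \<longlonglongrightarrow> 0 \<and> \<tau> \<longlonglongrightarrow> \<sigma>\<^sup>2"
      using w d0 by (intro exI[of _ "\<lambda>n. diff j (w n)"] exI[of _ "\<lambda>n. sol j (w n)"] exI[of _ "\<lambda>n. (fst (w n))\<^sup>2"])
        (auto simp: \<Theta>_def image_iff intro!: tendsto_power)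
  qed
qed

end

section \<open>Bifurcation and singular limits\<close>

theorem theorem3p3:
  fixes a1 a2 b1 b2 c1 c2 \<gamma> \<delta> A B C :: real
  assumes pos: "a1 > 0" "a2 > 0" "b1 > 0" "b2 > 0" "c1 > 0" "c2 > 0" "\<gamma> > 0" "\<delta> > 0"
    and ABC: "A = a1 / a2" "B = b1 / b2" "C = c1 / c2"
    and competition: "C < A \<and> A < B \<or> B < A \<and> A < C"
    and D_pos: "D_discr a1 a2 b1 b2 c1 c2 \<gamma> > 0"
  shows "\<forall>j::nat. j \<ge> 1 \<longrightarrow>
    (\<exists>\<Gamma>p \<Gamma>m :: (real \<times> C1_01 \<times> real) set.
       connected \<Gamma>p \<and> connected \<Gamma>m \<and>
       \<Gamma>p \<subseteq> S_plus a1 a2 b1 b2 c1 c2 \<gamma> \<delta> j \<and>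
       \<Gamma>m \<subseteq> S_minus a1 a2 b1 b2 c1 c2 \<gamma> \<delta> j \<and>
       (d_bif a1 a2 b1 b2 c1 c2 \<gamma> \<delta> j, const_C1 (u_star a1 a2 b1 b2 c1 c2),
          tau_star a1 a2 b1 b2 c1 c2) \<in> closure \<Gamma>p \<and>
       (\<exists>\<tau>0\<ge>0.
          (\<exists>(d :: nat \<Rightarrow> real) u \<tau>. (\<forall>n. (d n, u n, \<tau> n) \<in> \<Gamma>p) \<and>
              d \<longlonglongrightarrow> 0 \<and> \<tau> \<longlonglongrightarrow> \<tau>0) \<and>
          (C < A \<and> A < B \<longrightarrow> \<tau>0 > 0) \<and>
          (B < A \<and> A < C \<longrightarrow> \<tau>0 = 0)) \<and>
       \<Gamma>m = (\<lambda>(d, u, \<tau>). (d, shift_C1 j u, \<tau>)) ` \<Gamma>p)"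
proof -
  define us where "us = u_star a1 a2 b1 b2 c1 c2"
  define vs where "vs = v_star a1 a2 b1 b2 c1 c2"
  have cmp: "C < A \<longleftrightarrow> a2 * c1 < a1 * c2" "A < B \<longleftrightarrow> a1 * b2 < a2 * b1"
    "B < A \<longleftrightarrow> a2 * b1 < a1 * b2" "A < C \<longleftrightarrow> a1 * c2 < a2 * c1"
    using pos by (simp_all add: ABC field_simps)
  have weak_strong: "(C < A \<and> A < B \<and> 0 < a2 * b1 - a1 * b2 \<and> 0 < a1 * c2 - a2 * c1 \<and> 0 < b1 * c2 - b2 * c1) \<or>
      (B < A \<and> A < C \<and> a2 * b1 - a1 * b2 < 0 \<and> a1 * c2 - a2 * c1 < 0 \<and> b1 * c2 - b2 * c1 < 0)"
  proof -
    have "C < B \<longleftrightarrow> b2 * c1 < b1 * c2" "B < C \<longleftrightarrow> b1 * c2 < b2 * c1"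
      using pos by (simp_all add: ABC field_simps)
    then show ?thesis using competition cmp by auto
  qed
  then have E: "b1 * c2 - b2 * c1 \<noteq> 0" and "us > 0" "vs > 0"
    by (auto simp: us_def vs_def u_star_def v_star_def divide_neg_neg mult.commute)
  have lin: "a1 = b1 * us + c1 * vs" "a2 = b2 * us + c2 * vs"
  proof -
    have "(b1 * c2 - b2 * c1) * us = a1 * c2 - a2 * c1" "(b1 * c2 - b2 * c1) * vs = b1 * a2 - b2 * a1"
      using E by (simp_all add: us_def vs_def u_star_def v_star_def)
    then have "(b1 * c2 - b2 * c1) * (b1 * us + c1 * vs) = (b1 * c2 - b2 * c1) * a1"
      "(b1 * c2 - b2 * c1) * (b2 * us + c2 * vs) = (b1 * c2 - b2 * c1) * a2" by algebra+
    then show "a1 = b1 * us + c1 * vs" "a2 = b2 * us + c2 * vs" using E by simp_all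
  qed
  \<comment> \<open>the scaled coordinates \<open>sqrt (u v)\<close> and \<open>sqrt (u / v)\<close> of the constant solution\<close>
  define ss where "ss = sqrt (us * vs)"
  define ys where "ys = sqrt (us / vs)"
  have ss: "0 < ss" "ss\<^sup>2 = us * vs" and ys: "0 < ys" "ys\<^sup>2 = us / vs"
    using \<open>us > 0\<close> \<open>vs > 0\<close> by (simp_all add: ss_def ys_def)
  note ss_sq = ss(2)
  have us_eq: "ss * ys = us"
    using \<open>us > 0\<close> \<open>vs > 0\<close> by (simp add: ss_def ys_def real_sqrt_mult[symmetric] real_sqrt_divide[symmetric])
  have "ss * (ys * vs) = ss * ss" using us_eq ss(2) by (simp add: power2_eq_square mult.assoc[symmetric])
  then have vs_eq: "ss / ys = vs" using ss(1) ys(1) by (simp add: field_simps)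
  \<comment> \<open>the two expressions for \<open>d\<^sup>(\<^sup>j\<^sup>)\<close> link the sign of the discriminant to the instability\<close>
  have N: "0 < (\<gamma> * b2 + c1) * (us * vs) - b1 * us\<^sup>2 - \<gamma> * c2 * vs\<^sup>2"
  proof -
    have "0 < d_bif a1 a2 b1 b2 c1 c2 \<gamma> \<delta> 1"
      using E D_pos pos \<open>us > 0\<close> \<open>vs > 0\<close> unfolding us_def vs_def
      by (subst d_bif_eq[OF pos(1-6)]) (auto intro!: divide_pos_pos mult_pos_pos add_pos_pos)
    moreover have "0 < (\<delta> * us + \<gamma> * vs) * (real 1 * pi)\<^sup>2"
      using pos \<open>us > 0\<close> \<open>vs > 0\<close> by (intro mult_pos_pos add_pos_pos) auto
    ultimately show ?thesis
      by (simp add: d_bif_def Let_def tau_star_def us_def[symmetric] vs_def[symmetric] zero_less_divide_iff)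
  qed
  interpret skt_equilibrium a1 a2 b1 b2 c1 c2 \<gamma> \<delta> ss ys
  proof
    show "0 < c1 + \<gamma> * b2 - b1 * ys\<^sup>2 - \<gamma> * c2 / ys\<^sup>2"
    proof -
      have "us * vs * (c1 + \<gamma> * b2 - b1 * ys\<^sup>2 - \<gamma> * c2 / ys\<^sup>2) = (\<gamma> * b2 + c1) * (us * vs) - b1 * us\<^sup>2 - \<gamma> * c2 * vs\<^sup>2"
        unfolding ys(2) using \<open>us > 0\<close> \<open>vs > 0\<close> by (simp add: field_simps power2_eq_square)
      then show ?thesis using N \<open>us > 0\<close> \<open>vs > 0\<close> by (metis mult_pos_pos zero_less_mult_pos)
    qed
    have e: "ss * ys\<^sup>2 = us * ys" using us_eq by (simp add: power2_eq_square mult.assoc[symmetric])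
    have e': "ss = vs * ys" using vs_eq ys by (simp add: field_simps)
    show "a1 * ys = ss * (b1 * ys\<^sup>2 + c1)" "a2 * ys = ss * (b2 * ys\<^sup>2 + c2)"
      unfolding lin using e e' by algebra+
    show "a2 * b1 \<noteq> a1 * b2" using weak_strong by auto
  qed (use pos ss ys in auto)
  obtain sa sb where iv: "interv sa sb" using interv_exists by blast
  interpret skt_interval a1 a2 b1 b2 c1 c2 \<gamma> \<delta> ss ys sa sb by unfold_locales (rule iv)
  obtain Z \<sigma> where Z: "branch Z \<sigma>" "C < A \<and> A < B \<longrightarrow> \<sigma> > 0" "B < A \<and> A < C \<longrightarrow> \<sigma> = 0"
    using weak_branch strong_branch weak_strong unfolding \<kappa>0_def by (metis less_asym)
  have start: "\<Theta> j (ss, 0) = (d_bif a1 a2 b1 b2 c1 c2 \<gamma> \<delta> j, const_C1 us, tau_star a1 a2 b1 b2 c1 c2)"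
    if "1 \<le> j" for j
    unfolding \<Theta>_center[OF that] us_eq vs_eq ss_sq
    by (simp add: d_bif_def Let_def tau_star_def us_def vs_def)
  have tau0: "0 \<le> \<sigma>\<^sup>2" "C < A \<and> A < B \<longrightarrow> \<sigma>\<^sup>2 > 0" "B < A \<and> A < C \<longrightarrow> \<sigma>\<^sup>2 = 0" using Z(2,3) by auto
  show ?thesis
  proof (intro allI impI)
    fix j :: nat assume j: "j \<ge> 1"
    obtain \<Gamma>p \<Gamma>m where G: "connected \<Gamma>p" "connected \<Gamma>m" "\<Gamma>p \<subseteq> S_plus a1 a2 b1 b2 c1 c2 \<gamma> \<delta> j"
      "\<Gamma>m \<subseteq> S_minus a1 a2 b1 b2 c1 c2 \<gamma> \<delta> j" "\<Theta> j (ss, 0) \<in> closure \<Gamma>p"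
      "\<exists>(d :: nat \<Rightarrow> real) u \<tau>. (\<forall>n. (d n, u n, \<tau> n) \<in> \<Gamma>p) \<and> d \<longlonglongrightarrow> 0 \<and> \<tau> \<longlonglongrightarrow> \<sigma>\<^sup>2"
      "\<Gamma>m = (\<lambda>(d, u, \<tau>). (d, shift_C1 j u, \<tau>)) ` \<Gamma>p"
      using branch_solutions[OF Z(1) j] by blast
    show "\<exists>\<Gamma>p \<Gamma>m :: (real \<times> C1_01 \<times> real) set.
       connected \<Gamma>p \<and> connected \<Gamma>m \<and>
       \<Gamma>p \<subseteq> S_plus a1 a2 b1 b2 c1 c2 \<gamma> \<delta> j \<and>
       \<Gamma>m \<subseteq> S_minus a1 a2 b1 b2 c1 c2 \<gamma> \<delta> j \<and>
       (d_bif a1 a2 b1 b2 c1 c2 \<gamma> \<delta> j, const_C1 (u_star a1 a2 b1 b2 c1 c2),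
          tau_star a1 a2 b1 b2 c1 c2) \<in> closure \<Gamma>p \<and>
       (\<exists>\<tau>0\<ge>0.
          (\<exists>(d :: nat \<Rightarrow> real) u \<tau>. (\<forall>n. (d n, u n, \<tau> n) \<in> \<Gamma>p) \<and>
              d \<longlonglongrightarrow> 0 \<and> \<tau> \<longlonglongrightarrow> \<tau>0) \<and>
          (C < A \<and> A < B \<longrightarrow> \<tau>0 > 0) \<and>
          (B < A \<and> A < C \<longrightarrow> \<tau>0 = 0)) \<and>
       \<Gamma>m = (\<lambda>(d, u, \<tau>). (d, shift_C1 j u, \<tau>)) ` \<Gamma>p"
      by (rule exI[of _ \<Gamma>p], rule exI[of _ \<Gamma>m])
        (use G(1-4) G(5)[unfolded start[OF j] us_def] G(7) tau0 G(6) in blast)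
  qed
qed

end
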